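(* Let $h\neq0$ be a constant, let $u=u(x,t)$, $v=v(x,t)$ be fields with $x\in S^1$, and let $\nu=\nu(x,t)$ satisfy $\nu^2=h-u_x^2$, $\nu\ne0$. The Hamiltonian equations of motion of the two-dimensional elliptic $\mathrm{sl}(2,\mathbb C)$ Calogero–Moser model produced by $$H_0^{CM}=\oint dx\left[-\frac{v^2}{16\pi^2}\Bigl(1-\frac{u_x^2}{h}\Bigr)+(3u_x^2-h)\wp(2u)-\frac{u_{xx}^2}{4\nu^2}\right],$$ namely $$u_t=-\frac{v}{8\pi^2}\Bigl(1-\frac{u_x^2}{h}\Bigr),$$ $$v_t=\frac{1}{8\pi^2h}\partial_x(v^2u_x)-2(3u_x^2-h)\wp'(2u)+6\,\partial_x(u_x\wp(2u))+\frac12\partial_x\Bigl(\frac{u_{xxx}\nu-\nu_xu_{xx}}{\nu^3}\Bigr),$$ can be represented in the form of the Zakharov–Shabat equation (holding identically in the spectral parameter $z$) $$\partial_tL-\partial_xM+[M,L]=0$$ with the traceless $2\times2$ matrices $L$, $M$ ($L_{22}=-L_{11}$, $M_{22}=-M_{11}$) given by $$L_{11}=-\frac{v}{4\pi\sqrt{-1}}-u_xE_1(z),\qquad L_{12}=\nu\,\phi(2u,z),\qquad L_{21}=\nu\,\phi(-2u,z),$$ $$M_{11}=-u_tE_1(z)-\frac{1}{4\pi\sqrt{-1}}\Bigl(\frac{v^2u_x}{8\pi^2h}+6u_x\wp(2u)+\frac{u_{xxx}\nu-\nu_xu_{xx}}{2\nu^3}\Bigr)+\frac{u_x}{2\pi\sqrt{-1}}\bigl(E_2(2u)-E_2(z)\bigr),$$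 $$M_{12}=-\frac{\nu}{2\pi\sqrt{-1}}\phi'(2u,z)+\Bigl(\frac{\nu}{2\pi\sqrt{-1}}E_1(z)+\frac{vu_x\nu}{8\pi^2h}-\frac{1}{4\pi\sqrt{-1}}\frac{u_{xx}}{\nu}\Bigr)\phi(2u,z),$$ $$M_{21}=-\frac{\nu}{2\pi\sqrt{-1}}\phi'(-2u,z)+\Bigl(\frac{\nu}{2\pi\sqrt{-1}}E_1(z)+\frac{vu_x\nu}{8\pi^2h}+\frac{1}{4\pi\sqrt{-1}}\frac{u_{xx}}{\nu}\Bigr)\phi(-2u,z).$$
   Context: Elliptic functions with modular parameter $\tau$, $\mathrm{Im}\,\tau>0$: $\vartheta(z)=\sum_{j\in\mathbb Z}\exp\bigl(\pi\sqrt{-1}(j+\tfrac12)^2\tau+2\pi\sqrt{-1}(j+\tfrac12)(z+\tfrac12)\bigr)$; $E_1(z)=\partial_z\log\vartheta(z)$; $E_2(z)=-\partial_zE_1(z)$; $\wp(z)$ is the Weierstrass function of the lattice $\mathbb Z+\tau\mathbb Z$, so $\wp(z)=E_2(z)-2\eta_1$ with $\eta_1$ the constant for which $E_1(z)=\frac1z-2\eta_1z+\dots$ near $z=0$; $\phi(u,z)=\frac{\vartheta(u+z)\vartheta'(0)}{\vartheta(u)\vartheta(z)}$. The prime in $\phi'(\pm2u,z)$ denotes the derivative with respect to the first argument, evaluated at $\pm2u$, and $\wp'$ is the derivative of $\wp$. Subscripts $x,t$ denote partial derivatives. The fields are canonically conjugate, so the equations of motion for a Hamiltonian $H$ are $u_t=\delta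 H/\delta v$, $v_t=-\delta H/\delta u$. *)

theory Defs
  imports "HOL-Analysis.Analysis"
begin

section \<open>Elliptic functions with modular parameter \<open>\<tau>\<close>\<close>

definition period_lattice :: "complex \<Rightarrow> complex set" where
  "period_lattice \<tau> = {of_int m + of_int n * \<tau> | m n :: int. True}"

definition theta :: "complex \<Rightarrow> complex \<Rightarrow> complex" where
  "theta \<tau> z = (\<Sum>\<^sub>\<infinity>j::int.
     exp (of_real pi * \<i> * (of_int j + 1/2)^2 * \<tau>
          + 2 * of_real pi * \<i> * (of_int j + 1/2) * (z + 1/2)))"

text \<open>\<open>\<partial>\<^sub>z log \<theta>(z)\<close> is read as the (single-valued) logarithmic derivative.\<close>

definition E1 :: "complex \<Rightarrow> complex \<Rightarrow> complex" where
  "E1 \<tau> z = deriv (theta \<tau>) z / theta \<tau> z"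

definition E2 :: "complex \<Rightarrow> complex \<Rightarrow> complex" where
  "E2 \<tau> z = - deriv (E1 \<tau>) z"

definition wp :: "complex \<Rightarrow> complex \<Rightarrow> complex" where
  "wp \<tau> z = 1 / z^2 + (\<Sum>\<^sub>\<infinity>\<omega>\<in>period_lattice \<tau> - {0}. 1 / (z - \<omega>)^2 - 1 / \<omega>^2)"

definition phi :: "complex \<Rightarrow> complex \<Rightarrow> complex \<Rightarrow> complex" where
  "phi \<tau> w z = theta \<tau> (w + z) * deriv (theta \<tau>) 0 / (theta \<tau> w * theta \<tau> z)"

definition phi' :: "complex \<Rightarrow> complex \<Rightarrow> complex \<Rightarrow> complex" where
  "phi' \<tau> w z = deriv (\<lambda>s. phi \<tau> s z) w"


section \<open>Functions on the circle and fields on circle times time\<close>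

definition ddx :: "(real \<Rightarrow> 'a::real_normed_vector) \<Rightarrow> real \<Rightarrow> 'a" where
  "ddx f x = vector_derivative f (at x)"

definition smooth_loop :: "real \<Rightarrow> (real \<Rightarrow> complex) \<Rightarrow> bool" where
  "smooth_loop l f \<longleftrightarrow> (\<forall>x. f (x + l) = f x) \<and> (\<forall>k x. (ddx ^^ k) f differentiable at x)"

definition Dx :: "(real \<Rightarrow> real \<Rightarrow> 'a::real_normed_vector) \<Rightarrow> real \<Rightarrow> real \<Rightarrow> 'a" where
  "Dx f x t = vector_derivative (\<lambda>s. f s t) (at x)"

definition Dt :: "(real \<Rightarrow> real \<Rightarrow> 'a::real_normed_vector) \<Rightarrow> real \<Rightarrow> real \<Rightarrow> 'a" where
  "Dt f x t = vector_derivative (\<lambda>s. f x s) (at t)"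

text \<open>The circle is \<open>\<real> / l\<int>\<close> for an arbitrary length \<open>l > 0\<close>.
  \<open>Ck_field k T\<close> is the class \<open>C\<^sup>k\<close> on \<open>\<real> \<times> T\<close>, meant for open \<open>T\<close>.\<close>

fun Ck_field :: "nat \<Rightarrow> real set \<Rightarrow> (real \<Rightarrow> real \<Rightarrow> complex) \<Rightarrow> bool" where
  "Ck_field 0 T f \<longleftrightarrow> continuous_on (UNIV \<times> T) (\<lambda>(x, t). f x t)"
| "Ck_field (Suc k) T f \<longleftrightarrow>
     continuous_on (UNIV \<times> T) (\<lambda>(x, t). f x t) \<and>
     (\<forall>x. \<forall>t\<in>T. (\<lambda>s. f s t) differentiable at x \<and> (\<lambda>s. f x s) differentiable at t) \<and>
     Ck_field k T (Dx f) \<and> Ck_field k T (Dt f)"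

definition smooth_circle_field :: "real \<Rightarrow> real set \<Rightarrow> (real \<Rightarrow> real \<Rightarrow> complex) \<Rightarrow> bool" where
  "smooth_circle_field l T f \<longleftrightarrow>
     (\<forall>x. \<forall>t\<in>T. f (x + l) t = f x t) \<and> (\<forall>k. Ck_field k T f)"


section \<open>Hamiltonian equations of motion\<close>

text \<open>\<open>g = \<delta>F/\<delta>w\<close>: the variation of \<open>F\<close> at \<open>w\<close> is represented by \<open>g\<close>.  The fields are complex
  valued, so the variation parameter is complex; \<open>g\<close> is unique if it exists.\<close>

definition has_variational_derivative ::
    "real \<Rightarrow> ((real \<Rightarrow> complex) \<Rightarrow> complex) \<Rightarrow> (real \<Rightarrow> complex) \<Rightarrow> (real \<Rightarrow> complex) \<Rightarrow> bool" where
  "has_variational_derivative l F w g \<longleftrightarrow>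
     smooth_loop l g \<and>
     (\<forall>\<eta>. smooth_loop l \<eta> \<longrightarrow>
        ((\<lambda>\<epsilon>::complex. F (\<lambda>x. w x + \<epsilon> * \<eta> x)) has_field_derivative
           integral {0..l} (\<lambda>x. g x * \<eta> x)) (at 0))"

definition hamilton_equations ::
    "real \<Rightarrow> ((real \<Rightarrow> complex) \<Rightarrow> (real \<Rightarrow> complex) \<Rightarrow> complex) \<Rightarrow> real set \<Rightarrow>
     (real \<Rightarrow> real \<Rightarrow> complex) \<Rightarrow> (real \<Rightarrow> real \<Rightarrow> complex) \<Rightarrow> bool" where
  "hamilton_equations l H T u v \<longleftrightarrow>
     (\<forall>t\<in>T.
        has_variational_derivative l (\<lambda>w. H (\<lambda>x. u x t) w) (\<lambda>x. v x t) (\<lambda>x. Dt u x t) \<and>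
        has_variational_derivative l (\<lambda>w. H w (\<lambda>x. v x t)) (\<lambda>x. u x t) (\<lambda>x. - Dt v x t))"


section \<open>The two-dimensional elliptic Calogero--Moser model\<close>

text \<open>As a functional of \<open>(u, v)\<close> the Hamiltonian contains \<open>\<nu>\<^sup>2\<close> only as an abbreviation for
  \<open>h - u\<^sub>x\<^sup>2\<close>.\<close>

definition H_CM ::
    "complex \<Rightarrow> complex \<Rightarrow> real \<Rightarrow> (real \<Rightarrow> complex) \<Rightarrow> (real \<Rightarrow> complex) \<Rightarrow> complex" where
  "H_CM \<tau> h l u v = integral {0..l} (\<lambda>x.
     - ((v x)^2 / (16 * of_real pi ^ 2)) * (1 - (ddx u x)^2 / h)
     + (3 * (ddx u x)^2 - h) * wp \<tau> (2 * u x)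
     - (ddx (ddx u) x)^2 / (4 * (h - (ddx u x)^2)))"

definition CM_rhs_u ::
    "complex \<Rightarrow> (real \<Rightarrow> real \<Rightarrow> complex) \<Rightarrow> (real \<Rightarrow> real \<Rightarrow> complex) \<Rightarrow> real \<Rightarrow> real \<Rightarrow> complex" where
  "CM_rhs_u h u v x t = - v x t / (8 * of_real pi ^ 2) * (1 - (Dx u x t)^2 / h)"

definition CM_rhs_v ::
    "complex \<Rightarrow> complex \<Rightarrow> (real \<Rightarrow> real \<Rightarrow> complex) \<Rightarrow> (real \<Rightarrow> real \<Rightarrow> complex) \<Rightarrow>
     (real \<Rightarrow> real \<Rightarrow> complex) \<Rightarrow> real \<Rightarrow> real \<Rightarrow> complex" where
  "CM_rhs_v \<tau> h u v \<nu> x t =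
     1 / (8 * of_real pi ^ 2 * h) * Dx (\<lambda>x t. (v x t)^2 * Dx u x t) x t
     - 2 * (3 * (Dx u x t)^2 - h) * deriv (wp \<tau>) (2 * u x t)
     + 6 * Dx (\<lambda>x t. Dx u x t * wp \<tau> (2 * u x t)) x t
     + 1/2 * Dx (\<lambda>x t. (Dx (Dx (Dx u)) x t * \<nu> x t - Dx \<nu> x t * Dx (Dx u) x t) / (\<nu> x t)^3) x t"

definition CM_L ::
    "complex \<Rightarrow> (real \<Rightarrow> real \<Rightarrow> complex) \<Rightarrow> (real \<Rightarrow> real \<Rightarrow> complex) \<Rightarrow>
     (real \<Rightarrow> real \<Rightarrow> complex) \<Rightarrow> complex \<Rightarrow> real \<Rightarrow> real \<Rightarrow> complex^2^2" where
  "CM_L \<tau> u v \<nu> z x t =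
     (let L11 = - v x t / (4 * of_real pi * \<i>) - Dx u x t * E1 \<tau> z;
          L12 = \<nu> x t * phi \<tau> (2 * u x t) z;
          L21 = \<nu> x t * phi \<tau> (- 2 * u x t) z
      in vector [vector [L11, L12], vector [L21, - L11]])"

definition CM_M ::
    "complex \<Rightarrow> complex \<Rightarrow> (real \<Rightarrow> real \<Rightarrow> complex) \<Rightarrow> (real \<Rightarrow> real \<Rightarrow> complex) \<Rightarrow>
     (real \<Rightarrow> real \<Rightarrow> complex) \<Rightarrow> complex \<Rightarrow> real \<Rightarrow> real \<Rightarrow> complex^2^2" where
  "CM_M \<tau> h u v \<nu> z x t =
     (let ux = Dx u x t; uxx = Dx (Dx u) x t; uxxx = Dx (Dx (Dx u)) x t;
          n = \<nu> x t; nx = Dx \<nu> x t; U = u x t; V = v x t;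
          M11 = - Dt u x t * E1 \<tau> z
                - 1 / (4 * of_real pi * \<i>) *
                    (V^2 * ux / (8 * of_real pi ^ 2 * h) + 6 * ux * wp \<tau> (2 * U)
                     + (uxxx * n - nx * uxx) / (2 * n^3))
                + ux / (2 * of_real pi * \<i>) * (E2 \<tau> (2 * U) - E2 \<tau> z);
          M12 = - n / (2 * of_real pi * \<i>) * phi' \<tau> (2 * U) z
                + (n / (2 * of_real pi * \<i>) * E1 \<tau> z + V * ux * n / (8 * of_real pi ^ 2 * h)
                   - 1 / (4 * of_real pi * \<i>) * (uxx / n)) * phi \<tau> (2 * U) z;
          M21 = - n / (2 * of_real pi * \<i>) * phi' \<tau> (- 2 * U) z
                + (n / (2 * of_real pi * \<i>) * E1 \<tau> z + V * ux * n / (8 * of_real pi ^ 2 * h)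
                   + 1 / (4 * of_real pi * \<i>) * (uxx / n)) * phi \<tau> (- 2 * U) z
      in vector [vector [M11, M12], vector [M21, - M11]])"

end

theory Submission
  imports Defs "HOL-Complex_Analysis.Complex_Analysis"
begin

text \<open>
  Liouville's theorem identifies \<open>\<theta>\<close>, up to a factor \<open>C exp (- \<pi> \<i> z)\<close>, with an infinite product, so that its
  zeros are exactly the lattice points and are simple.  Liouville's theorem then also gives that \<open>\<wp> - E\<^sub>2\<close> is constant,
  that \<open>\<phi>(w,z) \<phi>(-w,z) = \<wp>(z) - \<wp>(w)\<close>, and that
  \<open>(E\<^sub>1(w+z) - E\<^sub>1(w) - E\<^sub>1(z))\<^sup>2 = \<wp>(w+z) + \<wp>(w) + \<wp>(z)\<close>, which is a second order linear equation for \<open>\<phi>\<close> in \<open>w\<close>.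

  With these identities the diagonal of the curvature becomes a multiple of the defect of the \<open>v\<^sub>t\<close> equation, while the
  off-diagonal entries are combinations of the defect \<open>D\<close> of the \<open>u\<^sub>t\<close> equation and of \<open>D\<^sub>x\<close>.  The double pole at
  \<open>z = 0\<close> isolates \<open>D\<close>, which gives the converse.  Uniqueness of variational derivatives follows by testing with the
  complex conjugate of the difference of two candidates.
\<close>

section \<open>The period lattice\<close>

text \<open>The zeros of theta come before everything else because \<open>E1\<close> and
  \<open>phi\<close> are quotients by theta and division by zero returns 0: most identities hold
  only off the lattice, and those that fail at further isolated points, such as the zeros of phi in
  its first argument, are completed by continuity. Each appeal to Liouville's theorem costs only a
  limit at one representative of every class of singular points, and a limit or a zero of the
  function then supplies the constant. The second derivative of phi enters the curvature only
  through M_x, so a linear equation of order two in w closes the algebra. The converse is delicate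
  because at a single z the off-diagonal entries mix D with D_x, two numbers that are unrelated at a
  single point. In them D_x multiplies phi, with a simple pole at z = 0, whereas D multiplies phi' -
  E1(z) phi, with a double one. Varying z therefore gives D = 0 point by point, with no differential
  equation in x to solve.\<close>

locale upper_half =
  fixes \<tau> :: complex
  assumes Im_pos: "Im \<tau> > 0"
begin

abbreviation \<Lambda> :: "complex set" where "\<Lambda> \<equiv> period_lattice \<tau>"

lemma lattice_iff: "z \<in> \<Lambda> \<longleftrightarrow> (\<exists>m n :: int. z = of_int m + of_int n * \<tau>)"
  by (auto simp: period_lattice_def)

lemma zero_lattice [simp]: "0 \<in> \<Lambda>"
  unfolding lattice_iff by (rule exI[of _ 0], rule exI[of _ 0]) simp

lemma one_lattice [simp]: "1 \<in> \<Lambda>"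
  unfolding lattice_iff by (rule exI[of _ 1], rule exI[of _ 0]) simp

lemma tau_lattice [simp]: "\<tau> \<in> \<Lambda>"
  unfolding lattice_iff by (rule exI[of _ 0], rule exI[of _ 1]) simp

lemma lattice_add: assumes "a \<in> \<Lambda>" "b \<in> \<Lambda>" shows "a + b \<in> \<Lambda>"
proof -
  from assms obtain m n m' n' :: int
    where "a = of_int m + of_int n * \<tau>" "b = of_int m' + of_int n' * \<tau>"
    unfolding lattice_iff by blast
  then have "a + b = of_int (m + m') + of_int (n + n') * \<tau>" by (simp add: algebra_simps)
  then show ?thesis unfolding lattice_iff by blast
qed

lemma lattice_minus: assumes "a \<in> \<Lambda>" shows "- a \<in> \<Lambda>"
proof -
  from assms obtain m n :: int where "a = of_int m + of_int n * \<tau>" unfolding lattice_iff by blast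
  then have "- a = of_int (- m) + of_int (- n) * \<tau>" by simp
  then show ?thesis unfolding lattice_iff by blast
qed

lemma lattice_minus_iff [simp]: "- a \<in> \<Lambda> \<longleftrightarrow> a \<in> \<Lambda>"
  using lattice_minus[of a] lattice_minus[of "-a"] by auto

lemma lattice_add_iff: "b \<in> \<Lambda> \<Longrightarrow> a + b \<in> \<Lambda> \<longleftrightarrow> a \<in> \<Lambda>"
  using lattice_add[of a b] lattice_add[of "a + b" "- b"] by auto

lemma lattice_diff: "a \<in> \<Lambda> \<Longrightarrow> b \<in> \<Lambda> \<Longrightarrow> a - b \<in> \<Lambda>"
  using lattice_add[of a "-b"] by auto

lemma lattice_add_1_iff [simp]: "z + 1 \<in> \<Lambda> \<longleftrightarrow> z \<in> \<Lambda>"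
  and lattice_add_tau_iff [simp]: "z + \<tau> \<in> \<Lambda> \<longleftrightarrow> z \<in> \<Lambda>"
  by (simp_all add: lattice_add_iff)

definition lattice_bound :: real where "lattice_bound = 1 + (1 + norm \<tau>) / Im \<tau>"

lemma lattice_bound_pos: "lattice_bound > 0"
  unfolding lattice_bound_def using Im_pos by (simp add: add_pos_nonneg)

text \<open>The imaginary part controls y, since Im \<tau> > 0, and the triangle inequality then
  controls x; adding the two bounds produces the constant \<open>lattice_bound\<close>.\<close>

lemma lattice_norm_ge: "\<bar>x\<bar> + \<bar>y\<bar> \<le> lattice_bound * norm (of_real x + of_real y * \<tau>)"
proof -
  let ?w = "of_real x + of_real y * \<tau>"
  have "\<bar>y\<bar> * Im \<tau> = \<bar>Im ?w\<bar>" using Im_pos by (simp add: abs_mult)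
  also have "\<dots> \<le> norm ?w" by (rule abs_Im_le_cmod)
  finally have y: "\<bar>y\<bar> \<le> norm ?w / Im \<tau>" using Im_pos by (simp add: field_simps)
  have "\<bar>x\<bar> = norm (?w - of_real y * \<tau>)" by simp
  also have "\<dots> \<le> norm ?w + norm (of_real y * \<tau>)" by (rule norm_triangle_ineq4)
  also have "\<dots> = norm ?w + \<bar>y\<bar> * norm \<tau>" by (simp add: norm_mult)
  also have "\<dots> \<le> norm ?w + norm ?w / Im \<tau> * norm \<tau>" using y by (intro add_left_mono mult_right_mono) auto
  finally show ?thesis using y unfolding lattice_bound_def by (simp add: algebra_simps add_divide_distrib)
qed

lemma of_int_tau_eq_iff:
  "of_int m + of_int n * \<tau> = of_int m' + of_int n' * \<tau> \<longleftrightarrow> m = m' \<and> n = n'"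
proof
  assume *: "of_int m + of_int n * \<tau> = of_int m' + of_int n' * \<tau>"
  from arg_cong[OF this, of Im] have "real_of_int n * Im \<tau> = real_of_int n' * Im \<tau>" by simp
  then have "n = n'" using Im_pos by simp
  with * show "m = m' \<and> n = n'" by simp
qed simp

lemma lattice_nonzero_norm: assumes "a \<in> \<Lambda>" "a \<noteq> 0" shows "norm a \<ge> 1 / lattice_bound"
proof -
  obtain m n :: int where a: "a = of_int m + of_int n * \<tau>" using assms(1) unfolding lattice_iff by blast
  with assms(2) have "m \<noteq> 0 \<or> n \<noteq> 0" by auto
  then have "1 \<le> \<bar>m\<bar> + \<bar>n\<bar>" by linarith
  then have "1 \<le> \<bar>real_of_int m\<bar> + \<bar>real_of_int n\<bar>" by linarith
  also have "\<dots> \<le> lattice_bound * norm a" using lattice_norm_ge[of m n] a by simp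
  finally show ?thesis using lattice_bound_pos by (simp add: field_simps)
qed

lemma lattice_not_islimpt: "\<not> z islimpt \<Lambda>"
proof (rule discrete_imp_not_islimpt)
  show "1 / lattice_bound > 0" using lattice_bound_pos by simp
  fix x y assume "x \<in> \<Lambda>" "y \<in> \<Lambda>" "dist y x < 1 / lattice_bound"
  then show "y = x" using lattice_nonzero_norm[of "y - x"] lattice_diff[of y x]
    by (force simp: dist_norm)
qed

lemma closed_lattice: "closed \<Lambda>"
  using lattice_not_islimpt closed_limpt by blast

lemma open_nonlattice [simp]: "open (- \<Lambda>)"
  using closed_lattice by (simp add: open_Compl)

lemma eventually_nonlattice: "eventually (\<lambda>z. z \<notin> \<Lambda>) (at a)"
  using lattice_not_islimpt[of a] by (simp add: islimpt_iff_eventually)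

text \<open>Only the forward steps by 1 and \<tau> are assumed. For a backward step, forward
  invariance of S shows that z - m lies outside S, and the forward statement applied at z - m then
  compares the values.\<close>

lemma lattice_shift_invariant:
  assumes "\<And>z. z \<notin> S \<Longrightarrow> z + 1 \<notin> S \<and> f (z + 1) = f z"
    and "\<And>z. z \<notin> S \<Longrightarrow> z + \<tau> \<notin> S \<and> f (z + \<tau>) = f z"
    and "\<And>z. z \<in> S \<Longrightarrow> z + 1 \<in> S" and "\<And>z. z \<in> S \<Longrightarrow> z + \<tau> \<in> S"
    and "z \<notin> S" "w \<in> \<Lambda>"
  shows "z + w \<notin> S \<and> f (z + w) = f z"
proof -
  have up1: "z + of_nat m \<notin> S \<and> f (z + of_nat m) = f z" if "z \<notin> S" for z m
  proof (induction m)
    case (Suc m)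
    then show ?case using assms(1)[of "z + of_nat m"] by (simp add: ac_simps)
  qed (use that in simp)
  have uptau: "z + of_nat m * \<tau> \<notin> S \<and> f (z + of_nat m * \<tau>) = f z" if "z \<notin> S" for z m
  proof (induction m)
    case (Suc m)
    then show ?case using assms(2)[of "z + of_nat m * \<tau>"] by (simp add: algebra_simps)
  qed (use that in simp)
  have dn1: "z - of_nat m \<notin> S" if "z \<notin> S" for z m
  proof
    have "z - of_nat m + of_nat k \<in> S" if "z - of_nat m \<in> S" for k
    proof (induction k)
      case (Suc k)
      then show ?case using assms(3)[OF Suc] by (simp add: algebra_simps)
    qed (use that in simp)
    from this[of m] show False if "z - of_nat m \<in> S" using that \<open>z \<notin> S\<close> by simp
  qed
  have dntau: "z - of_nat m * \<tau> \<notin> S" if "z \<notin> S" for z m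
  proof
    have "z - of_nat m * \<tau> + of_nat k * \<tau> \<in> S" if "z - of_nat m * \<tau> \<in> S" for k
    proof (induction k)
      case (Suc k)
      then show ?case using assms(4)[OF Suc] by (simp add: algebra_simps)
    qed (use that in simp)
    from this[of m] show False if "z - of_nat m * \<tau> \<in> S" using that \<open>z \<notin> S\<close> by simp
  qed
  have int1: "z + of_int m \<notin> S \<and> f (z + of_int m) = f z" if "z \<notin> S" for z m
  proof (cases m rule: int_cases2)
    case (nonneg n) then show ?thesis using up1[OF that] by simp
  next
    case (nonpos n)
    then show ?thesis using up1[OF dn1[OF that, of n], of n] dn1[OF that, of n] by simp
  qed
  have inttau: "z + of_int m * \<tau> \<notin> S \<and> f (z + of_int m * \<tau>) = f z" if "z \<notin> S" for z m
  proof (cases m rule: int_cases2)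
    case (nonneg n) then show ?thesis using uptau[OF that] by simp
  next
    case (nonpos n)
    then show ?thesis using uptau[OF dntau[OF that, of n], of n] dntau[OF that, of n] by simp
  qed
  obtain m n :: int where w: "w = of_int m + of_int n * \<tau>" using assms(6) unfolding lattice_iff by blast
  show ?thesis
    using int1[OF assms(5), of m] inttau[of "z + of_int m" n] unfolding w by (simp add: add.assoc)
qed

lemma fundamental_parallelogram:
  obtains w x y where "w \<in> \<Lambda>" "x \<in> {0..1}" "y \<in> {0..1}" "z + w = of_real x + of_real y * \<tau>"
proof -
  define y where "y = Im z / Im \<tau>"
  define x where "x = Re z - y * Re \<tau>"
  have z: "z = of_real x + of_real y * \<tau>"
    using Im_pos by (simp add: complex_eq_iff x_def y_def)
  show ?thesis
  proof (rule that)
    show "- (of_int \<lfloor>x\<rfloor> + of_int \<lfloor>y\<rfloor> * \<tau>) \<in> \<Lambda>" by (simp only: lattice_minus_iff) (auto simp: lattice_iff)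
    show "frac x \<in> {0..1}" "frac y \<in> {0..1}"
      using frac_lt_1[of x] frac_lt_1[of y] by (simp_all add: less_imp_le)
    show "z + - (of_int \<lfloor>x\<rfloor> + of_int \<lfloor>y\<rfloor> * \<tau>) = of_real (frac x) + of_real (frac y) * \<tau>"
      unfolding z frac_def by (simp add: algebra_simps)
  qed
qed

text \<open>The values of \<open>f\<close> on the exceptional set \<open>S\<close> are junk.\<close>

lemma elliptic_without_poles_const:
  assumes hol: "f holomorphic_on - S"
    and S: "\<And>z. \<not> z islimpt S"
    and p1: "\<And>z. z \<notin> S \<Longrightarrow> z + 1 \<notin> S \<and> f (z + 1) = f z"
    and pt: "\<And>z. z \<notin> S \<Longrightarrow> z + \<tau> \<notin> S \<and> f (z + \<tau>) = f z"
    and s1: "\<And>z. z \<in> S \<Longrightarrow> z + 1 \<in> S" and st: "\<And>z. z \<in> S \<Longrightarrow> z + \<tau> \<in> S"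
    and lim: "\<And>z. z \<in> S \<Longrightarrow> \<exists>w\<in>\<Lambda>. \<exists>L. (f \<longlongrightarrow> L) (at (z + w))"
  obtains c where "\<And>z. z \<notin> S \<Longrightarrow> f z = c"
proof -
  have shift: "z + w \<notin> S \<and> f (z + w) = f z" if "z \<notin> S" "w \<in> \<Lambda>" for z w
    by (rule lattice_shift_invariant[OF p1 pt s1 st that])
  have evS: "eventually (\<lambda>z. z \<notin> S) (at a)" for a
    using S[of a] by (simp add: islimpt_iff_eventually)
  have closed: "closed S" using S closed_limpt by blast
  then have opn: "open (- S)" by (simp add: open_Compl)
  \<comment> \<open>Periodicity carries a limit at a translate back to z; in applications to
    \<Lambda> it is therefore enough to examine the origin.\<close>
  have lim': "\<exists>L. (f \<longlongrightarrow> L) (at z)" if "z \<in> S" for z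
  proof -
    obtain w L where w: "w \<in> \<Lambda>" and L: "(f \<longlongrightarrow> L) (at (z + w))" using lim[OF \<open>z \<in> S\<close>] by blast
    have "((\<lambda>x. f (x + w)) \<longlongrightarrow> L) (at z)"
      using LIM_offset[OF L, of w] by simp
    moreover have "eventually (\<lambda>x. f (x + w) = f x) (at z)"
      using evS[of z] by eventually_elim (use shift w in auto)
    ultimately have "(f \<longlongrightarrow> L) (at z)" using tendsto_cong by force
    then show ?thesis by blast
  qed
  \<comment> \<open>The junk values on S are replaced by limits. S has no limit point, so each
    singularity is isolated and removable.\<close>
  define g where "g z = (if z \<in> S then Lim (at z) f else f z)" for z
  have fg: "eventually (\<lambda>x. f x = g x) (at z)" for z
    using evS[of z] by eventually_elim (simp add: g_def)
  have glim: "(g \<longlongrightarrow> g z) (at z)" if "z \<in> S" for z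
  proof -
    obtain L where L: "(f \<longlongrightarrow> L) (at z)" using lim'[OF \<open>z \<in> S\<close>] by blast
    then have "Lim (at z) f = L" by (intro tendsto_Lim) auto
    with L have "(f \<longlongrightarrow> g z) (at z)" using that by (simp add: g_def)
    then show ?thesis using tendsto_cong[OF fg[of z]] by blast
  qed
  have gS: "g holomorphic_on - S"
    using hol by (rule holomorphic_transform) (simp add: g_def)
  have hol_g: "g holomorphic_on UNIV"
  proof -
    have "\<exists>e>0. g holomorphic_on ball z e" for z
    proof -
      from evS[of z] obtain e where e: "e > 0" "\<And>x. x \<noteq> z \<Longrightarrow> dist x z < e \<Longrightarrow> x \<notin> S"
        unfolding eventually_at by auto
      have "g holomorphic_on ball z e"
      proof (rule no_isolated_singularity'[where K = "S \<inter> {z}"])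
        show "g holomorphic_on ball z e - S \<inter> {z}"
          by (rule holomorphic_on_subset[OF gS]) (use e in \<open>fastforce simp: dist_commute\<close>)
        show "(g \<longlongrightarrow> g x) (at x within ball z e)" if "x \<in> S \<inter> {z}" for x
          using glim that tendsto_within_subset[OF glim[of x]] by auto
      qed auto
      with e show ?thesis by blast
    qed
    then show ?thesis
      by (metis (full_types) UNIV_I centre_in_ball holomorphic_on_def holomorphic_on_imp_differentiable_at open_ball
          field_differentiable_at_within)
  qed
  then have cont_g: "continuous_on A g" for A
    using holomorphic_on_imp_continuous_on continuous_on_subset by blast
  let ?P = "(\<lambda>p. of_real (fst p) + of_real (snd p) * \<tau>) ` ({0..1} \<times> {0..1})"
  have "compact ?P" by (intro compact_continuous_image continuous_intros compact_Times) auto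
  then have "bounded (g ` ?P)"
    using compact_continuous_image[OF cont_g] compact_imp_bounded by blast
  then obtain B where B: "\<And>z. z \<in> ?P \<Longrightarrow> norm (g z) \<le> B" unfolding bounded_iff by blast
  have bnd: "norm (g z) \<le> B" if "z \<notin> S" for z
  proof -
    obtain w x y where w: "w \<in> \<Lambda>" "x \<in> {0..1}" "y \<in> {0..1}" "z + w = of_real x + of_real y * \<tau>"
      by (rule fundamental_parallelogram)
    have "g (z + w) = g z" using shift[OF that w(1)] that by (simp add: g_def)
    moreover have "z + w \<in> ?P" unfolding w(4) using w(2,3) by (intro image_eqI[of _ _ "(x, y)"]) auto
    ultimately show ?thesis using B[of "z + w"] by simp
  qed
  \<comment> \<open>Periodicity is available only outside S; the bound reaches the points of S by
    continuity of g.\<close>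
  have bnd': "norm (g z) \<le> B" for z
  proof (rule tendsto_upperbound)
    have "isCont g z" using cont_g[of UNIV] by (simp add: continuous_on_eq_continuous_at)
    then show "((\<lambda>x. norm (g x)) \<longlongrightarrow> norm (g z)) (at z)" by (intro tendsto_norm) (simp add: isCont_def)
    show "eventually (\<lambda>x. norm (g x) \<le> B) (at z)"
      using evS[of z] by eventually_elim (use bnd in auto)
  qed simp
  then have "bounded (range g)" unfolding bounded_iff by blast
  from Liouville_theorem[OF hol_g this] obtain c where "\<And>z. g z = c" unfolding constant_on_def by blast
  then show ?thesis using that[of c] by (metis g_def)
qed

end

section \<open>The Weierstrass function\<close>

lemma summable_on_int_even:
  fixes f :: "int \<Rightarrow> real"
  assumes "summable (\<lambda>n. f (int n))" "\<And>m. f (- m) = f m" "\<And>m. f m \<ge> 0"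
  shows "f summable_on UNIV"
proof -
  have *: "(\<lambda>n::nat. f (int n)) summable_on UNIV"
    using assms by (subst summable_on_UNIV_nonneg_real_iff) auto
  have "f summable_on range int"
    by (subst summable_on_reindex) (use * in \<open>auto simp: o_def\<close>)
  moreover have "f summable_on range (\<lambda>n. - int n)"
    by (subst summable_on_reindex) (use * assms in \<open>auto simp: o_def inj_on_def\<close>)
  moreover have "(UNIV :: int set) = range int \<union> range (\<lambda>n. - int n)"
  proof -
    have "m \<in> range int \<union> range (\<lambda>n. - int n)" for m by (cases m rule: int_cases2) auto
    then show ?thesis by blast
  qed
  ultimately show ?thesis by (metis summable_on_union)
qed

text \<open>The exponent is half of the 3 in the lattice sum: a product of two such terms, one for
  each coordinate, dominates the inverse cube of the norm.\<close>

lemma summable_on_int_powr: "(\<lambda>m::int. (1 + \<bar>real_of_int m\<bar>) powr (-3/2)) summable_on UNIV"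
proof (rule summable_on_int_even)
  have "summable (\<lambda>n. real (Suc n) powr (-3/2))"
    by (rule iffD2[OF summable_Suc_iff[of "\<lambda>n. real n powr (-3/2)"]])
       (simp add: summable_real_powr_iff)
  then show "summable (\<lambda>n. (1 + \<bar>real_of_int (int n)\<bar>) powr (-3/2))" by simp
qed auto

text \<open>The difference is z (2w - z) / ((z - w)^2 w^2), of order |w|^-3. With |2w - z| \<le> 5/2
  |w| and |z - w| \<ge> |w|/2 the constant is 5/2 * 4 = 10.\<close>

lemma wp_term_bound:
  fixes z w :: complex
  assumes "norm z \<le> R" "norm w \<ge> 2 * R" "R > 0"
  shows "norm (1 / (z - w)^2 - 1 / w^2) \<le> 10 * R * (1 / norm w ^ 3)"
proof -
  have w: "norm w > 0" using assms by auto
  have zw: "norm (z - w) \<ge> norm w / 2"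
    using norm_triangle_ineq2[of w z] assms by (simp add: norm_minus_commute)
  have nz: "w \<noteq> 0" "z - w \<noteq> 0" using w zw by auto
  have "1 / (z - w)^2 - 1 / w^2 = z * (2 * w - z) / ((z - w)^2 * w^2)"
    using nz by (simp add: field_simps) (simp add: power2_eq_square algebra_simps)
  then have "norm (1 / (z - w)^2 - 1 / w^2) = norm z * norm (2 * w - z) / (norm (z - w)^2 * norm w ^2)"
    by (simp add: norm_mult norm_divide norm_power)
  also have "\<dots> \<le> R * (5/2 * norm w) / ((norm w / 2)^2 * norm w ^2)"
  proof (intro frac_le mult_mono power_mono)
    have "norm (2 * w - z) \<le> 2 * norm w + norm z" using norm_triangle_ineq4[of "2 * w" z] by (simp add: norm_mult)
    also have "\<dots> \<le> 5/2 * norm w" using assms by simp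
    finally show "norm (2 * w - z) \<le> 5/2 * norm w" .
  qed (use assms zw w in auto)
  also have "\<dots> = 10 * R * (1 / norm w ^ 3)"
    using w by (simp add: field_simps power2_eq_square power3_eq_cube)
  finally show ?thesis .
qed

context upper_half begin

text \<open>Both 1 + |m| and 1 + |n| are at most 2 \<open>lattice_bound\<close> |w|. Multiplying the
  two bounds and raising to the power 3/2 compares |w|^-3 with a product of two convergent
  one-dimensional series.\<close>

lemma summable_lattice_cube: "(\<lambda>w. 1 / norm w ^ 3) summable_on \<Lambda> - {0}"
proof -
  let ?a = "\<lambda>m::int. (1 + \<bar>real_of_int m\<bar>) powr (-3/2)"
  let ?h = "\<lambda>(m, n). of_int m + of_int n * \<tau>"
  have inj: "inj_on ?h A" for A by (auto simp: inj_on_def of_int_tau_eq_iff)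
  have img: "\<Lambda> - {0} = ?h ` (UNIV \<times> UNIV - {(0, 0)})"
  proof -
    have "?h p = 0 \<longleftrightarrow> p = (0, 0)" for p using of_int_tau_eq_iff[of "fst p" "snd p" 0 0] by (auto simp: case_prod_unfold prod_eq_iff)
    moreover have "\<Lambda> = range ?h" unfolding period_lattice_def by fastforce
    ultimately show ?thesis by auto
  qed
  have "(\<lambda>p. case p of (m, n) \<Rightarrow> ?a m * ?a n) summable_on (UNIV \<times> UNIV)"
  proof (rule summable_on_SigmaI)
    fix m :: int
    show "((\<lambda>n. case (m, n) of (m, n) \<Rightarrow> ?a m * ?a n) has_sum (?a m * infsum ?a UNIV)) UNIV"
      using has_sum_cmult_right[OF has_sum_infsum[OF summable_on_int_powr]] by simp
    show "(\<lambda>m. ?a m * infsum ?a UNIV) summable_on UNIV"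
      by (rule summable_on_cmult_left[OF summable_on_int_powr])
  qed auto
  then have "(\<lambda>p. (2 * lattice_bound)^3 * (case p of (m, n) \<Rightarrow> ?a m * ?a n)) summable_on (UNIV \<times> UNIV)"
    by (rule summable_on_cmult_right)
  then have "(\<lambda>p. (2 * lattice_bound)^3 * (case p of (m, n) \<Rightarrow> ?a m * ?a n)) summable_on (UNIV \<times> UNIV - {(0, 0)})"
    by (rule summable_on_subset) auto
  then have "(\<lambda>p. 1 / norm (?h p) ^ 3) summable_on (UNIV \<times> UNIV - {(0, 0)})"
  proof (rule summable_on_comparison_test)
    fix p :: "int \<times> int" assume p: "p \<in> UNIV \<times> UNIV - {(0, 0)}"
    obtain m n where mn: "p = (m, n)" by (cases p)
    let ?x = "1 + \<bar>real_of_int m\<bar>" and ?y = "1 + \<bar>real_of_int n\<bar>"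
    let ?w = "norm (?h p)"
    \<comment> \<open>Excluding the origin lets |m| + |n| absorb the summand 1, which accounts for
      the factor 2.\<close>
    have 1: "1 \<le> \<bar>real_of_int m\<bar> + \<bar>real_of_int n\<bar>" using p mn by (cases "m = 0") auto
    have B: "\<bar>real_of_int m\<bar> + \<bar>real_of_int n\<bar> \<le> lattice_bound * ?w"
      using lattice_norm_ge[of m n] mn by simp
    have "0 < lattice_bound * ?w" using 1 B by linarith
    then have w: "?w > 0" using lattice_bound_pos by (simp only: zero_less_mult_pos)
    have "?x \<le> 2 * lattice_bound * ?w" "?y \<le> 2 * lattice_bound * ?w" using 1 B by auto
    then have "?x * ?y \<le> (2 * lattice_bound * ?w) * (2 * lattice_bound * ?w)"
      by (intro mult_mono) auto
    then have "(?x * ?y) powr (3/2) \<le> ((2 * lattice_bound * ?w)^2) powr (3/2)"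
      by (intro powr_mono2) (auto simp: power2_eq_square)
    also have "\<dots> = (2 * lattice_bound * ?w) ^ 3"
    proof -
      have "(X^2) powr (3/2) = X^3" if "X > 0" for X :: real
      proof -
        have "X^2 = X powr 2" using that by (simp add: powr_numeral)
        then have "(X^2) powr (3/2) = X powr 3" by (simp add: powr_powr)
        then show ?thesis using that by (simp add: powr_numeral)
      qed
      then show ?thesis using w lattice_bound_pos by (simp del: power_mult_distrib)
    qed
    finally have *: "(?x * ?y) powr (3/2) \<le> (2 * lattice_bound)^3 * ?w ^ 3" by (simp add: power_mult_distrib)
    have a: "?a m * ?a n = 1 / (?x * ?y) powr (3/2)"
      using powr_mult[of ?x ?y "-3/2"] powr_minus_divide[of "?x * ?y" "3/2"] by simp
    have pos: "(?x * ?y) powr (3/2) > 0"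
      by (metis abs_ge_zero add_pos_nonneg less_irrefl mult_pos_pos powr_gt_zero zero_less_one)
    show "1 / norm (?h p) ^ 3 \<le> (2 * lattice_bound)^3 * (case p of (m, n) \<Rightarrow> ?a m * ?a n)"
    proof -
      have "1 / ?w ^ 3 \<le> c / q" if "q \<le> c * ?w ^ 3" "q > 0" for c q
        using that w by (simp add: field_simps)
      from this[OF * pos] show ?thesis using a mn by simp
    qed
  qed auto
  then show ?thesis unfolding img by (subst summable_on_reindex[OF inj]) (simp add: o_def case_prod_unfold)
qed

lemma finite_lattice_ball: "finite {w \<in> \<Lambda>. norm w \<le> R}"
proof -
  have "finite (cball 0 R \<inter> \<Lambda>)"
    using lattice_not_islimpt by (metis compact_cball finite_not_islimpt_in_compact)
  moreover have "{w \<in> \<Lambda>. norm w \<le> R} = cball 0 R \<inter> \<Lambda>" by auto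
  ultimately show ?thesis by simp
qed

text \<open>The tail of the series. The cut at 2R instead of R keeps |w| \<ge> 2|z| on the disc of
  radius R, as \<open>wp_term_bound\<close> demands, and leaves no pole there.\<close>

definition wp_far :: "real \<Rightarrow> complex \<Rightarrow> complex" where
  "wp_far R z = (\<Sum>\<^sub>\<infinity>w\<in>{w \<in> \<Lambda>. norm w > 2 * R}. 1 / (z - w)^2 - 1 / w^2)"

lemma wp_far_holomorphic:
  assumes "R > 0" shows "wp_far R holomorphic_on ball 0 R"
proof -
  let ?X = "{w \<in> \<Lambda>. norm w > 2 * R}"
  have sum: "(\<lambda>w. 10 * R * (1 / norm w ^ 3)) summable_on ?X"
    by (rule summable_on_cmult_right, rule summable_on_subset[OF summable_lattice_cube]) (use assms in auto)
  have ul: "uniform_limit (cball 0 R) (\<lambda>X z. \<Sum>w\<in>X. 1 / (z - w)^2 - 1 / w^2) (wp_far R) (finite_subsets_at_top ?X)"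
    unfolding wp_far_def[abs_def]
    by (rule Weierstrass_m_test_general[OF _ sum]) (use wp_term_bound assms in auto)
  have hol: "\<forall>\<^sub>F X in finite_subsets_at_top ?X. (\<lambda>z. \<Sum>w\<in>X. 1 / (z - w)^2 - 1 / w^2) holomorphic_on cball 0 R"
  proof (rule eventually_finite_subsets_at_top_weakI)
    fix X assume "finite X" "X \<subseteq> ?X"
    then show "(\<lambda>z. \<Sum>w\<in>X. 1 / (z - w)^2 - 1 / w^2) holomorphic_on cball 0 R"
      using assms by (intro holomorphic_intros) fastforce+
  qed
  have "\<forall>\<^sub>F X in finite_subsets_at_top ?X. continuous_on (cball 0 R) (\<lambda>z. \<Sum>w\<in>X. 1 / (z - w)^2 - 1 / w^2) \<and>
      (\<lambda>z. \<Sum>w\<in>X. 1 / (z - w)^2 - 1 / w^2) holomorphic_on ball 0 R"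
    using hol by eventually_elim
      (auto intro: holomorphic_on_imp_continuous_on holomorphic_on_subset[OF _ ball_subset_cball])
  from holomorphic_uniform_limit[OF this ul] show ?thesis by auto
qed

lemma wp_summable:
  "(\<lambda>w. 1 / (z - w)^2 - 1 / w^2) summable_on \<Lambda> - {0}"
proof -
  define R where "R = norm z + 1"
  have R: "R > 0" "norm z \<le> R" unfolding R_def by (auto simp: add_nonneg_pos)
  let ?X = "{w \<in> \<Lambda>. norm w > 2 * R}"
  have "(\<lambda>w. 10 * R * (1 / norm w ^ 3)) summable_on ?X"
    by (rule summable_on_cmult_right, rule summable_on_subset[OF summable_lattice_cube]) (use R in auto)
  then have "(\<lambda>w. norm (1 / (z - w)^2 - 1 / w^2)) summable_on ?X"
    by (rule Infinite_Sum.abs_summable_on_comparison_test') (use wp_term_bound R in auto)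
  then have 1: "(\<lambda>w. 1 / (z - w)^2 - 1 / w^2) summable_on ?X"
    by (rule abs_summable_summable)
  have 2: "(\<lambda>w. 1 / (z - w)^2 - 1 / w^2) summable_on {w \<in> \<Lambda>. norm w \<le> 2 * R}"
    by (rule summable_on_finite[OF finite_lattice_ball])
  show ?thesis
    by (rule summable_on_subset[OF summable_on_union[OF 1 2]]) auto
qed

lemma wp_decompose:
  assumes "R > 0"
  shows "wp \<tau> z = 1 / z^2 + (\<Sum>w\<in>{w \<in> \<Lambda> - {0}. norm w \<le> 2 * R}. 1 / (z - w)^2 - 1 / w^2) + wp_far R z"
proof -
  let ?X = "{w \<in> \<Lambda>. norm w > 2 * R}" and ?Y = "{w \<in> \<Lambda> - {0}. norm w \<le> 2 * R}"
  have eq: "\<Lambda> - {0} = ?Y \<union> ?X" using assms by auto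
  have "finite ?Y" by (rule finite_subset[OF _ finite_lattice_ball[of "2 * R"]]) auto
  have "infsum (\<lambda>w. 1 / (z - w)^2 - 1 / w^2) (?Y \<union> ?X) =
      infsum (\<lambda>w. 1 / (z - w)^2 - 1 / w^2) ?Y + infsum (\<lambda>w. 1 / (z - w)^2 - 1 / w^2) ?X"
    by (rule infsum_Un_disjoint) (use assms in \<open>auto intro!: summable_on_subset[OF wp_summable]\<close>)
  then show ?thesis using \<open>finite ?Y\<close> unfolding wp_def wp_far_def by (subst eq) simp
qed

section \<open>Holomorphy, principal part, parity and periods of the Weierstrass function\<close>

lemma wp_holomorphic: "wp \<tau> holomorphic_on - \<Lambda>"
proof -
  have "\<exists>U. open U \<and> z \<in> U \<and> wp \<tau> holomorphic_on U" if z: "z \<notin> \<Lambda>" for z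
  proof (intro exI conjI)
    define R where "R = norm z + 1"
    have R: "R > 0" unfolding R_def by (auto simp: add_nonneg_pos)
    show "open (ball 0 R - \<Lambda>)" using closed_lattice by auto
    show "z \<in> ball 0 R - \<Lambda>" using z unfolding R_def by auto
    have nz: "x \<noteq> 0" if "x \<in> ball 0 R - \<Lambda>" for x using that by auto
    have nw: "x - w \<noteq> 0" if "x \<in> ball 0 R - \<Lambda>" "w \<in> \<Lambda>" for x w using that by auto
    have "(\<lambda>z. 1 / z^2 + (\<Sum>w\<in>{w \<in> \<Lambda> - {0}. norm w \<le> 2 * R}. 1 / (z - w)^2 - 1 / w^2) + wp_far R z) holomorphic_on ball 0 R - \<Lambda>"
      by (intro holomorphic_intros holomorphic_on_subset[OF wp_far_holomorphic[OF R]]) (use nz nw in auto)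
    then show "wp \<tau> holomorphic_on ball 0 R - \<Lambda>"
      by (rule holomorphic_transform) (use wp_decompose[OF R] in auto)
  qed
  then show ?thesis
    by (meson ComplD holomorphic_on_imp_differentiable_at holomorphic_on_def field_differentiable_at_within)
qed

lemma wp_near_0: "\<exists>s. s analytic_on {0} \<and> s 0 = 0 \<and> (\<forall>z. wp \<tau> z = 1 / z^2 + s z)"
proof (intro exI conjI allI)
  \<comment> \<open>With this radius 2R is below the least norm of a nonzero period, so the finite
    part of the decomposition is empty and s is the whole tail. Each summand of the tail vanishes at
    0.\<close>
  define R where "R = 1 / (4 * lattice_bound)"
  have R: "R > 0" unfolding R_def using lattice_bound_pos by simp
  have Y: "{w \<in> \<Lambda> - {0}. norm w \<le> 2 * R} = {}"
    using lattice_nonzero_norm lattice_bound_pos unfolding R_def by (fastforce simp: field_simps)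
  show "wp \<tau> z = 1 / z^2 + wp_far R z" for z
    using wp_decompose[OF R, of z] unfolding Y by simp
  show "wp_far R analytic_on {0}"
    using wp_far_holomorphic[OF R] R by (auto simp: analytic_on_def intro!: exI[of _ R])
  show "wp_far R 0 = 0" unfolding wp_far_def by simp
qed

lemma wp_minus [simp]: "wp \<tau> (- z) = wp \<tau> z"
proof -
  have "infsum (\<lambda>w. 1 / (- z - w)^2 - 1 / w^2) (\<Lambda> - {0}) = infsum (\<lambda>w. 1 / (z - w)^2 - 1 / w^2) (\<Lambda> - {0})"
    by (rule infsum_reindex_bij_witness[of _ uminus uminus]) (auto simp: power2_commute add.commute)
  then show ?thesis by (simp add: wp_def)
qed

text \<open>In a difference the corrections 1/w^2 cancel, and the terms at the origin fill the gap w
  = 0. The resulting sum runs over the full lattice and may be translated by a period.\<close>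

lemma wp_diff_has_sum:
  assumes "z \<notin> \<Lambda>" "z' \<notin> \<Lambda>"
  shows "((\<lambda>w. 1 / (z - w)^2 - 1 / (z' - w)^2) has_sum (wp \<tau> z - wp \<tau> z')) \<Lambda>"
proof -
  have "((\<lambda>w. (1 / (z - w)^2 - 1 / w^2) - (1 / (z' - w)^2 - 1 / w^2)) has_sum
     (wp \<tau> z - 1 / z^2 - (wp \<tau> z' - 1 / z'^2))) (\<Lambda> - {0})"
    unfolding wp_def using has_sum_add[OF has_sum_infsum[OF wp_summable[of z]] has_sum_uminusI[OF has_sum_infsum[OF wp_summable[of z']]]]
    by simp
  then have "((\<lambda>w. 1 / (z - w)^2 - 1 / (z' - w)^2) has_sum
     (wp \<tau> z - 1 / z^2 - (wp \<tau> z' - 1 / z'^2))) (\<Lambda> - {0})" by simp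
  from has_sum_insert[OF _ this, of 0] have
    "((\<lambda>w. 1 / (z - w)^2 - 1 / (z' - w)^2) has_sum
      ((1 / z^2 - 1 / z'^2) + (wp \<tau> z - 1 / z^2 - (wp \<tau> z' - 1 / z'^2)))) (insert 0 (\<Lambda> - {0}))" by simp
  moreover have "insert 0 (\<Lambda> - {0}) = \<Lambda>" by auto
  ultimately show ?thesis by simp
qed

text \<open>Translating the absolutely convergent series for \<open>\<wp>(z) - \<wp>(z')\<close> shows that
  \<open>\<wp>(z + p) - \<wp>(z)\<close> is constant in \<open>z\<close>; evenness, at \<open>z = -p/2\<close>, makes it zero.\<close>

lemma wp_periodic_aux:
  assumes p: "p \<in> \<Lambda>" "p / 2 \<notin> \<Lambda>" and z: "z \<notin> \<Lambda>"
  shows "wp \<tau> (z + p) = wp \<tau> z"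
proof -
  let ?z' = "- (p / 2)"
  have z': "?z' \<notin> \<Lambda>" using p by simp
  have eq: "?z' + p = p / 2" by simp
  have zp: "z + p \<notin> \<Lambda>" using z p lattice_add_iff by blast
  have "infsum (\<lambda>w. 1 / (z + p - w)^2 - 1 / (p / 2 - w)^2) \<Lambda> = infsum (\<lambda>w. 1 / (z - w)^2 - 1 / (?z' - w)^2) \<Lambda>"
    by (rule infsum_reindex_bij_witness[of _ "\<lambda>w. w + p" "\<lambda>w. w - p"])
       (use p in \<open>auto simp: lattice_add lattice_diff algebra_simps\<close>)
  then have "wp \<tau> (z + p) - wp \<tau> (p / 2) = wp \<tau> z - wp \<tau> ?z'"
    using infsumI[OF wp_diff_has_sum[OF zp p(2)]] infsumI[OF wp_diff_has_sum[OF z z']] by simp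
  then show ?thesis by simp
qed

lemma half_not_lattice: "1 / 2 \<notin> \<Lambda>" "\<tau> / 2 \<notin> \<Lambda>"
proof -
  have False if 1: "1 / 2 = of_int m + of_int n * \<tau>" for m n
  proof -
    have "of_int 1 + of_int 0 * \<tau> = of_int (2 * m) + of_int (2 * n) * \<tau>" using 1 by (simp add: field_simps)
    then have "1 = 2 * m" unfolding of_int_tau_eq_iff by simp
    then show False by presburger
  qed
  then show "1 / 2 \<notin> \<Lambda>" unfolding lattice_iff by blast
  have False if 1: "\<tau> / 2 = of_int m + of_int n * \<tau>" for m n
  proof -
    have "of_int 0 + of_int 1 * \<tau> = of_int (2 * m) + of_int (2 * n) * \<tau>" using 1 by (simp add: field_simps)
    then have "1 = 2 * n" unfolding of_int_tau_eq_iff by simp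
    then show False by presburger
  qed
  then show "\<tau> / 2 \<notin> \<Lambda>" unfolding lattice_iff by blast
qed

lemma wp_add_1: "z \<notin> \<Lambda> \<Longrightarrow> wp \<tau> (z + 1) = wp \<tau> z"
  and wp_add_tau: "z \<notin> \<Lambda> \<Longrightarrow> wp \<tau> (z + \<tau>) = wp \<tau> z"
  using wp_periodic_aux half_not_lattice by auto

end

section \<open>The theta series\<close>

lemma exp_2_pi_i_half_int: "exp (2 * of_real pi * \<i> * (of_int j + 1/2)) = - 1"
proof -
  have "2 * of_real pi * \<i> * (of_int j + 1/2) = (2 * of_int j * of_real pi) * \<i> + of_real pi * \<i>"
    by (simp add: algebra_simps)
  then show ?thesis using exp_integer_2pi[of "of_int j"] by (simp add: exp_add)
qed

context upper_half begin

section \<open>Convergence, parity and quasi-periods of the theta series\<close>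

definition theta_term :: "int \<Rightarrow> complex \<Rightarrow> complex" where
  "theta_term j z = exp (of_real pi * \<i> * (of_int j + 1/2)^2 * \<tau>
          + 2 * of_real pi * \<i> * (of_int j + 1/2) * (z + 1/2))"

lemma theta_eq: "theta \<tau> z = (\<Sum>\<^sub>\<infinity>j. theta_term j z)"
  by (simp add: theta_def theta_term_def)

text \<open>With r = j + 1/2 the real part of the exponent is at most -pi r^2 Im \<tau> + 2 pi R
  |r|. Completing the square with 2 pi R + 1 in place of 2 pi R leaves the summand -|r|, which
  decays geometrically; the 1 in the exponent pays for replacing |r| by |j|.\<close>

definition theta_majorant :: "real \<Rightarrow> int \<Rightarrow> real" where
  "theta_majorant R j = exp ((2 * pi * R + 1)^2 / (4 * pi * Im \<tau>) + 1) * exp (- \<bar>of_int j\<bar>)"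

lemma norm_theta_term_le:
  assumes "norm z \<le> R" shows "norm (theta_term j z) \<le> theta_majorant R j"
proof -
  define r where "r = real_of_int j + 1/2"
  have r: "of_int j + 1/2 = complex_of_real r" by (simp add: r_def)
  have R: "\<bar>Im z\<bar> \<le> R" using assms abs_Im_le_cmod[of z] by linarith
  have "Re (of_real pi * \<i> * (of_real r)^2 * \<tau> + 2 * of_real pi * \<i> * of_real r * (z + 1/2)) =
      - pi * r^2 * Im \<tau> - 2 * pi * r * Im z"
    by (simp add: power2_eq_square)
  also have "\<dots> \<le> - pi * r^2 * Im \<tau> + 2 * pi * R * \<bar>r\<bar>"
  proof -
    have "- (r * Im z) \<le> \<bar>r\<bar> * \<bar>Im z\<bar>" by (metis abs_ge_minus_self abs_mult)
    also have "\<dots> \<le> \<bar>r\<bar> * R" using R by (intro mult_left_mono) auto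
    finally have "2 * pi * (- (r * Im z)) \<le> 2 * pi * (\<bar>r\<bar> * R)" by (intro mult_left_mono) auto
    then show ?thesis by (simp add: algebra_simps)
  qed
  also have "\<dots> \<le> (2 * pi * R + 1)^2 / (4 * pi * Im \<tau>) - \<bar>r\<bar>"
  proof -
    have "0 \<le> (2 * pi * Im \<tau> * \<bar>r\<bar> - (2 * pi * R + 1))^2 / (4 * pi * Im \<tau>)"
      using Im_pos by simp
    also have "\<dots> = pi * r^2 * Im \<tau> - (2 * pi * R + 1) * \<bar>r\<bar> + (2 * pi * R + 1)^2 / (4 * pi * Im \<tau>)"
    proof -
      have "(2 * P * a - b)^2 / (4 * P) = P * a^2 - b * a + b^2 / (4 * P)" if "P > 0" for P a b :: real
        using that by (simp add: field_simps power2_eq_square)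
      from this[of "pi * Im \<tau>" "\<bar>r\<bar>" "2 * pi * R + 1"] show ?thesis
        using Im_pos by (simp add: mult_ac)
    qed
    finally show ?thesis by (simp add: algebra_simps)
  qed
  also have "\<dots> \<le> (2 * pi * R + 1)^2 / (4 * pi * Im \<tau>) + 1 - \<bar>of_int j\<bar>" unfolding r_def by linarith
  finally show ?thesis
    unfolding theta_term_def r theta_majorant_def by (simp add: exp_add[symmetric])
qed

lemma theta_majorant_summable: "theta_majorant R summable_on UNIV"
proof -
  have "(\<lambda>j. exp (- \<bar>real_of_int j\<bar>)) summable_on UNIV"
  proof (rule summable_on_int_even)
    have "summable (\<lambda>n. (exp (- 1 :: real)) ^ n)" by (rule summable_geometric) simp
    then show "summable (\<lambda>n. exp (- \<bar>real_of_int (int n)\<bar>))"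
      by (simp add: exp_of_nat_mult[symmetric])
  qed auto
  then show ?thesis unfolding theta_majorant_def[abs_def] by (rule summable_on_cmult_right)
qed

lemma theta_uniform_limit:
  "uniform_limit (cball 0 R) (\<lambda>X z. \<Sum>j\<in>X. theta_term j z) (theta \<tau>) (finite_subsets_at_top UNIV)"
  unfolding theta_eq[abs_def]
  by (rule Weierstrass_m_test_general[OF _ theta_majorant_summable[of R]]) (use norm_theta_term_le in auto)

lemma theta_term_holomorphic [holomorphic_intros]: "theta_term j holomorphic_on A"
  unfolding theta_term_def[abs_def] by (intro holomorphic_intros)

lemma theta_holomorphic_UNIV: "theta \<tau> holomorphic_on UNIV"
proof -
  have "theta \<tau> holomorphic_on ball 0 R" for R
  proof -
    have "\<forall>\<^sub>F X in finite_subsets_at_top UNIV. continuous_on (cball 0 R) (\<lambda>z. \<Sum>j\<in>X. theta_term j z) \<and>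
        (\<lambda>z. \<Sum>j\<in>X. theta_term j z) holomorphic_on ball 0 R"
      by (intro always_eventually allI conjI holomorphic_on_imp_continuous_on holomorphic_intros)
    from holomorphic_uniform_limit[OF this theta_uniform_limit] show ?thesis by auto
  qed
  then have "theta \<tau> field_differentiable at z" for z
    by (rule holomorphic_on_imp_differentiable_at[of _ "ball 0 (norm z + 1)"]) auto
  then show ?thesis by (simp add: holomorphic_on_def field_differentiable_at_within)
qed

lemma theta_holomorphic [holomorphic_intros]:
  assumes "f holomorphic_on A" shows "(\<lambda>z. theta \<tau> (f z)) holomorphic_on A"
  using holomorphic_on_compose[OF assms holomorphic_on_subset[OF theta_holomorphic_UNIV]] by (simp add: o_def)

lemma theta_add_1: "theta \<tau> (z + 1) = - theta \<tau> z"
proof -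
  have "theta_term j (z + 1) = - theta_term j z" for j
  proof -
    have "theta_term j (z + 1) = theta_term j z * exp (2 * of_real pi * \<i> * (of_int j + 1/2))"
      unfolding theta_term_def exp_add[symmetric] by (simp add: algebra_simps)
    then show ?thesis by (simp only: exp_2_pi_i_half_int) simp
  qed
  then show ?thesis unfolding theta_eq by (simp add: infsum_uminus)
qed

text \<open>The reflection j -> -1 - j negates j + 1/2. The shift of z by 1/2 is not reflected and
  leaves the factor exp(2 pi i (j + 1/2)) = -1.\<close>

lemma theta_minus: "theta \<tau> (- z) = - theta \<tau> z"
proof -
  have "theta_term (- 1 - j) (- z) = - theta_term j z" for j
  proof -
    have "theta_term j z = theta_term (- 1 - j) (- z) * exp (2 * of_real pi * \<i> * (of_int j + 1/2))"
    proof -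
      have r: "of_int (- 1 - j) + 1/2 = - (of_int j + 1/2 :: complex)" by simp
      have "A * r^2 * t + B * r * (z + 1/2) = A * (- r)^2 * t + B * (- r) * (- z + 1/2) + B * r" for A B r t :: complex
        by (simp add: field_simps)
      then show ?thesis unfolding theta_term_def exp_add[symmetric] r by (rule arg_cong)
    qed
    then show ?thesis by (simp only: exp_2_pi_i_half_int) simp
  qed
  from this[of "- 1 - _"] have "- theta_term (- 1 - j) z = theta_term j (- z)" for j by simp
  then have "(\<Sum>\<^sub>\<infinity>j. theta_term j (- z)) = (\<Sum>\<^sub>\<infinity>j. - theta_term j z)"
    by (intro infsum_reindex_bij_witness[of _ "\<lambda>j. - 1 - j" "\<lambda>j. - 1 - j"])
       auto
  then show ?thesis unfolding theta_eq by (simp add: infsum_uminus)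
qed

text \<open>Completing the square, (j + 1/2)^2 + 2 (j + 1/2) = (j + 3/2)^2 - 1, so the shift by
  \<tau> is an index shift by one. The sign is again due to the 1/2 added to z.\<close>

lemma theta_add_tau: "theta \<tau> (z + \<tau>) = - exp (- of_real pi * \<i> * \<tau> - 2 * of_real pi * \<i> * z) * theta \<tau> z"
proof -
  have "theta_term j (z + \<tau>) = - exp (- of_real pi * \<i> * \<tau> - 2 * of_real pi * \<i> * z) * theta_term (j + 1) z" for j
  proof -
    have "theta_term j (z + \<tau>) * exp (of_real pi * \<i>) =
       exp (- of_real pi * \<i> * \<tau> - 2 * of_real pi * \<i> * z) * theta_term (j + 1) z"
      unfolding theta_term_def exp_add[symmetric] by (rule arg_cong[where f = exp])
         (simp add: field_simps power2_eq_square)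
    then show ?thesis by (simp add: minus_equation_iff[of "theta_term j (z + \<tau>)"])
  qed
  then have "theta \<tau> (z + \<tau>) = - exp (- of_real pi * \<i> * \<tau> - 2 * of_real pi * \<i> * z) * (\<Sum>\<^sub>\<infinity>j. theta_term (j + 1) z)"
    unfolding theta_eq by (simp add: infsum_cmult_right' infsum_uminus)
  also have "(\<Sum>\<^sub>\<infinity>j. theta_term (j + 1) z) = theta \<tau> z"
    unfolding theta_eq by (rule infsum_reindex_bij_witness[of _ "\<lambda>j. j - 1" "\<lambda>j. j + 1"]) auto
  finally show ?thesis .
qed

lemma theta_0 [simp]: "theta \<tau> 0 = 0"
  using theta_minus[of 0] by simp

text \<open>Integrating the series against \<open>exp (- \<pi> \<i> x)\<close> over a period isolates the coefficient \<open>j = 0\<close>.\<close>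

lemma theta_not_identically_0: "\<exists>z. theta \<tau> z \<noteq> 0"
proof (rule ccontr)
  assume *: "\<nexists>z. theta \<tau> z \<noteq> 0"
  define F where "F X x = (\<Sum>j\<in>X. theta_term j (complex_of_real x) * exp (- of_real pi * \<i> * of_real x))" for X and x :: real
  define a where "a j = theta_term j 0" for j
  \<comment> \<open>The factor exp(- pi i x) turns the half-integer frequency into the integer j, so
    orthogonality on [0,1] applies.\<close>
  have trm: "theta_term j (of_real x) * exp (- of_real pi * \<i> * of_real x) = a j * exp (2 * of_real pi * \<i> * of_int j * of_real x)" for j x
    unfolding a_def theta_term_def exp_add[symmetric] by (simp add: field_simps)
  have "uniform_limit {0..1::real} (\<lambda>X x. \<Sum>j\<in>X. theta_term j (of_real x) * exp (- of_real pi * \<i> * of_real x)) 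
      (\<lambda>x. \<Sum>\<^sub>\<infinity>j. theta_term j (of_real x) * exp (- of_real pi * \<i> * of_real x)) (finite_subsets_at_top UNIV)"
  proof (rule Weierstrass_m_test_general[OF _ theta_majorant_summable[of 1]])
    fix j and x :: real assume "x \<in> {0..1}"
    then show "norm (theta_term j (of_real x) * exp (- of_real pi * \<i> * of_real x)) \<le> theta_majorant 1 j"
      using norm_theta_term_le[of "of_real x" 1 j] by (simp add: norm_mult)
  qed
  moreover have "(\<Sum>\<^sub>\<infinity>j. theta_term j (of_real x) * exp (- of_real pi * \<i> * of_real x)) = 0" for x
    using * by (simp add: infsum_cmult_left' theta_eq)
  ultimately have "uniform_limit {0..1::real} F (\<lambda>x. 0) (finite_subsets_at_top UNIV)"
    unfolding F_def[abs_def] by simp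
  moreover have "continuous_on {0..1} (F X)" for X
    unfolding F_def[abs_def] theta_term_def by (intro continuous_intros)
  ultimately obtain I J where I: "\<And>X. (F X has_integral I X) {0..1}" and J: "((\<lambda>x::real. 0) has_integral J) {0..1}"
    and lim: "(I \<longlongrightarrow> J) (finite_subsets_at_top UNIV)"
    by (rule uniform_limit_integral) auto
  have "J = 0" using J by simp
  have int: "((\<lambda>x. exp (2 * of_real pi * \<i> * of_int j * of_real x)) has_integral (if j = 0 then 1 else 0)) {0..1}" for j :: int
  proof (cases "j = 0")
    case True
    then show ?thesis using has_integral_const_real[of "1::complex" 0 1] by simp
  next
    case False
    let ?c = "2 * of_real pi * \<i> * of_int j :: complex"
    have c: "?c \<noteq> 0" using False by simp
    have "((\<lambda>x. exp (?c * of_real x)) has_integral (exp (?c * of_real 1) / ?c - exp (?c * of_real 0) / ?c)) {0..1}"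
    proof (rule fundamental_theorem_of_calculus)
      fix x :: real
      have "((\<lambda>z. exp (?c * z) / ?c) has_field_derivative exp (?c * of_real x)) (at (of_real x))"
        using c by (auto intro!: derivative_eq_intros)
      then show "((\<lambda>x. exp (?c * of_real x) / ?c) has_vector_derivative exp (?c * of_real x)) (at x within {0..1})"
        by (intro has_vector_derivative_real_field) 
    qed simp
    moreover have "exp ?c = 1" using exp_integer_2pi[of "of_int j"] by (simp add: mult_ac)
    ultimately show ?thesis using False by simp
  qed
  have "I X = a 0" if "finite X" "0 \<in> X" for X
  proof -
    have "(F X has_integral (\<Sum>j\<in>X. a j * (if j = 0 then 1 else 0))) {0..1}"
      unfolding F_def[abs_def] trm by (intro has_integral_sum has_integral_mult_right int that)
    then show ?thesis using has_integral_unique[OF I] that by (simp add: sum.delta' if_distrib cong: if_cong)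
  qed
  then have "eventually (\<lambda>X. I X = a 0) (finite_subsets_at_top UNIV)"
    unfolding eventually_finite_subsets_at_top by (intro exI[of _ "{0}"]) auto
  then have "(I \<longlongrightarrow> a 0) (finite_subsets_at_top UNIV)" by (simp add: tendsto_eventually)
  with lim \<open>J = 0\<close> have "a 0 = 0" using tendsto_unique[OF _ lim] by (metis finite_subsets_at_top_neq_bot)
  then show False by (simp add: a_def theta_term_def)
qed

end

section \<open>The zeros of the theta function\<close>

text \<open>The q-Pochhammer symbol (w; p) of infinite order.\<close>

definition qprod :: "complex \<Rightarrow> complex \<Rightarrow> complex" where
  "qprod p w = (\<Prod>n. 1 - p ^ n * w)"

lemma qprod_has_prod:
  assumes "norm p < 1" shows "(\<lambda>n. 1 - p ^ n * w) has_prod qprod p w"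
proof -
  have "summable (\<lambda>n. norm p ^ n * norm w)"
    by (intro summable_mult2 summable_geometric) (use assms in simp)
  then have "abs_convergent_prod (\<lambda>n. 1 - p ^ n * w)"
    by (simp add: abs_convergent_prod_conv_summable norm_mult norm_power)
  then show ?thesis unfolding qprod_def
    by (intro convergent_prod_has_prod abs_convergent_prod_imp_convergent_prod)
qed

lemma qprod_eq_0_iff:
  assumes "norm p < 1" shows "qprod p w = 0 \<longleftrightarrow> (\<exists>n. p ^ n * w = 1)"
  using has_prod_eq_0_iff[OF qprod_has_prod[OF assms, of w]] by (auto simp: image_iff)

lemma qprod_rec:
  assumes "norm p < 1" shows "qprod p w = (1 - w) * qprod p (p * w)"
proof -
  have "(\<lambda>n. 1 - p ^ Suc n * w) has_prod qprod p (p * w)"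
    using qprod_has_prod[OF assms, of "p * w"] by (simp add: mult_ac)
  from has_prod_Suc_imp[OF this] have "(\<lambda>n. 1 - p ^ n * w) has_prod (qprod p (p * w) * (1 - w))" by simp
  then show ?thesis using has_prod_unique2[OF qprod_has_prod[OF assms, of w]] by (simp add: mult.commute)
qed

lemma qprod_holomorphic_UNIV:
  assumes "norm p < 1" shows "qprod p holomorphic_on UNIV"
proof (rule holomorphic_uniform_sequence[where f = "\<lambda>N w. \<Prod>n<N. 1 - p ^ n * w"])
  fix x :: complex
  define R where "R = norm x + 1"
  have "uniformly_convergent_on (cball x 1) (\<lambda>N w. \<Sum>n<N. norm (- (p ^ n * w)))"
  proof (rule Weierstrass_m_test')
    show "summable (\<lambda>n. norm p ^ n * R)"
      by (intro summable_mult2 summable_geometric) (use assms in simp)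
    fix n w assume "w \<in> cball x 1"
    then have "norm w \<le> R" unfolding R_def using norm_triangle_ineq2[of w x] by (simp add: dist_norm norm_minus_commute)
    then show "norm (norm (- (p ^ n * w))) \<le> norm p ^ n * R"
      by (simp add: norm_mult norm_power mult_left_mono)
  qed
  then have "uniformly_convergent_on (cball x 1) (\<lambda>N w. \<Prod>n<N. 1 + - (p ^ n * w))"
    by (intro uniformly_convergent_on_prod continuous_intros) auto
  then obtain g where g: "uniform_limit (cball x 1) (\<lambda>N w. \<Prod>n<N. 1 - p ^ n * w) g sequentially"
    by (auto simp: uniformly_convergent_on_def)
  have "g w = qprod p w" if "w \<in> cball x 1" for w
    using tendsto_uniform_limitI[OF g that] has_prod_imp_tendsto'[OF qprod_has_prod[OF assms, of w]]
    by (rule LIMSEQ_unique)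
  then have "uniform_limit (cball x 1) (\<lambda>N w. \<Prod>n<N. 1 - p ^ n * w) (qprod p) sequentially"
    using g uniform_limit_cong'[of "cball x 1" _ _ g "qprod p" sequentially] by simp
  then show "\<exists>d>0. cball x d \<subseteq> UNIV \<and> uniform_limit (cball x d) (\<lambda>N w. \<Prod>n<N. 1 - p ^ n * w) (qprod p) sequentially"
    by (intro exI[of _ 1]) simp
qed (auto intro!: holomorphic_intros)

text \<open>The difference quotients of f and g have a convergent quotient. Applied at the origin,
  it supplies the removable singularity needed for comparing theta with its product.\<close>

lemma tendsto_quotient_of_zeros:
  fixes f g :: "complex \<Rightarrow> complex"
  assumes "(f has_field_derivative f') (at a)" "(g has_field_derivative g') (at a)" "f a = 0" "g a = 0" "g' \<noteq> 0"
  shows "((\<lambda>z. f z / g z) \<longlongrightarrow> f' / g') (at a)"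
proof -
  have "((\<lambda>z. ((f z - f a) / (z - a)) / ((g z - g a) / (z - a))) \<longlongrightarrow> f' / g') (at a)"
    using assms unfolding has_field_derivative_iff by (intro tendsto_divide) auto
  moreover have "eventually (\<lambda>z. ((f z - f a) / (z - a)) / ((g z - g a) / (z - a)) = f z / g z) (at a)"
    using eventually_neq_at_within[of a a UNIV] by eventually_elim (use assms in auto)
  ultimately show ?thesis by (simp cong: tendsto_cong)
qed

lemma exp_2_pi_i_eq_1_iff: "exp (2 * of_real pi * \<i> * z) = 1 \<longleftrightarrow> z \<in> \<int>"
proof -
  have "exp (2 * of_real pi * \<i> * z) = 1 \<longleftrightarrow> (\<exists>n::int. Re z = of_int n \<and> Im z = 0)"
    by (auto simp: exp_eq_1)
  also have "\<dots> \<longleftrightarrow> z \<in> \<int>"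
    by (auto simp: Ints_def complex_eq_iff)
  finally show ?thesis .
qed

context upper_half begin

section \<open>The product with the zeros and multipliers of theta\<close>

definition nome_sq :: complex where "nome_sq = exp (2 * of_real pi * \<i> * \<tau>)"

text \<open>The part of the Jacobi triple product that depends on w = exp(2 pi i z), up to the power
  w^(-1/2). The constant factors are left out: for locating zeros it matters only that they do not
  vanish.\<close>

definition theta_prod :: "complex \<Rightarrow> complex" where
  "theta_prod z = qprod nome_sq (exp (2 * of_real pi * \<i> * z)) * qprod nome_sq (nome_sq * exp (- (2 * of_real pi * \<i> * z)))"

lemma norm_nome_sq: "norm nome_sq < 1"
  using Im_pos by (simp add: nome_sq_def)

lemmas qprod_holomorphic [holomorphic_intros] =
  holomorphic_on_compose_gen[OF _ qprod_holomorphic_UNIV[OF norm_nome_sq], unfolded o_def, simplified]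

lemma theta_prod_holomorphic [holomorphic_intros]: "theta_prod holomorphic_on A"
  unfolding theta_prod_def[abs_def] by (intro holomorphic_intros)

text \<open>A convergent product vanishes only through one of its factors, and here each factor
  vanishes exactly when z differs from a multiple of \<tau> by an integer.\<close>

lemma theta_prod_eq_0D: assumes "theta_prod z = 0" shows "z \<in> \<Lambda>"
proof -
  have *: "z \<in> \<Lambda>" if "z - of_int k * \<tau> \<in> \<int>" for k
  proof -
    from that obtain m where "z - of_int k * \<tau> = of_int m" by (auto elim: Ints_cases)
    then have "z = of_int m + of_int k * \<tau>" by (simp add: algebra_simps)
    then show ?thesis unfolding lattice_iff by blast
  qed
  from assms consider n where "nome_sq ^ n * exp (2 * of_real pi * \<i> * z) = 1"
    | n where "nome_sq ^ n * (nome_sq * exp (- (2 * of_real pi * \<i> * z))) = 1"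
    unfolding theta_prod_def by (auto simp: qprod_eq_0_iff[OF norm_nome_sq])
  then show ?thesis
  proof cases
    case 1
    then have "exp (2 * of_real pi * \<i> * (z - of_int (- int n) * \<tau>)) = 1"
      by (simp add: nome_sq_def exp_of_nat_mult[symmetric] exp_add[symmetric] algebra_simps)
    then show ?thesis using * unfolding exp_2_pi_i_eq_1_iff by blast
  next
    case 2
    have "nome_sq ^ n * (nome_sq * exp (- (2 * of_real pi * \<i> * z))) =
        exp (2 * of_real pi * \<i> * (- (z - of_int (int (Suc n)) * \<tau>)))"
      by (simp add: nome_sq_def exp_of_nat_mult[symmetric] exp_add[symmetric] algebra_simps)
    with 2 have "- (z - of_int (int (Suc n)) * \<tau>) \<in> \<int>" by (simp only: exp_2_pi_i_eq_1_iff)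
    then have "z - of_int (int (Suc n)) * \<tau> \<in> \<int>" by (simp only: minus_in_Ints_iff)
    then show ?thesis by (rule *)
  qed
qed

lemma theta_prod_add_1: "theta_prod (z + 1) = theta_prod z"
proof -
  have "exp (2 * of_real pi * \<i> * (z + 1)) = exp (2 * of_real pi * \<i> * z)"
    by (simp add: algebra_simps exp_add exp_two_pi_i exp_two_pi_i')
  then show ?thesis unfolding theta_prod_def by (simp add: exp_minus)
qed

text \<open>The shift multiplies w by \<open>nome_sq\<close>: the first product loses the factor 1 -
  w, the second gains 1 - 1/w, and their ratio is -1/w.\<close>

lemma theta_prod_add_tau: "theta_prod (z + \<tau>) = - exp (- (2 * of_real pi * \<i> * z)) * theta_prod z"
proof -
  define w where "w = exp (2 * of_real pi * \<i> * z)"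
  have w: "w \<noteq> 0" "exp (- (2 * of_real pi * \<i> * z)) = 1 / w" by (simp_all add: w_def exp_minus field_simps)
  have p: "nome_sq \<noteq> 0" by (simp add: nome_sq_def)
  have "exp (2 * of_real pi * \<i> * (z + \<tau>)) = nome_sq * w"
    by (simp add: w_def nome_sq_def exp_add[symmetric] algebra_simps)
  then have "theta_prod (z + \<tau>) = qprod nome_sq (nome_sq * w) * qprod nome_sq (nome_sq * (1 / (nome_sq * w)))"
    unfolding theta_prod_def by (simp add: exp_minus divide_inverse)
  also have "nome_sq * (1 / (nome_sq * w)) = 1 / w" using p w by (simp add: field_simps)
  also have "qprod nome_sq (1 / w) = (1 - 1 / w) * qprod nome_sq (nome_sq * (1 / w))"
    by (rule qprod_rec[OF norm_nome_sq])
  finally have "theta_prod (z + \<tau>) = (1 - 1 / w) * (qprod nome_sq (nome_sq * w) * qprod nome_sq (nome_sq * (1 / w)))"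
    by simp
  moreover have "theta_prod z = (1 - w) * qprod nome_sq (nome_sq * w) * qprod nome_sq (nome_sq * (1 / w))"
    unfolding theta_prod_def w w_def[symmetric] using qprod_rec[OF norm_nome_sq, of w] by simp
  moreover have "1 - 1 / w = - (1 / w) * (1 - w)" using w by (simp add: field_simps)
  ultimately show ?thesis using w by simp
qed

lemma theta_prod_0: "theta_prod 0 = 0"
  unfolding theta_prod_def using qprod_rec[OF norm_nome_sq, of 1] by simp

text \<open>Splitting off the factor 1 - w exhibits a simple zero; the cofactor at 0 is the square
  of a product that cannot vanish because |\<open>nome_sq\<close>| < 1.\<close>

lemma deriv_theta_prod_0: "deriv theta_prod 0 \<noteq> 0"
proof -
  have nz: "qprod nome_sq nome_sq \<noteq> 0"
  proof
    assume "qprod nome_sq nome_sq = 0"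
    then obtain n where "nome_sq ^ n * nome_sq = 1" using qprod_eq_0_iff[OF norm_nome_sq] by blast
    then have "nome_sq ^ Suc n = 1" by (simp add: mult.commute)
    then have "norm nome_sq ^ Suc n = 1" by (metis norm_one norm_power)
    moreover have "norm nome_sq ^ Suc n < 1" using norm_nome_sq by (intro power_Suc_less_one) (auto simp: nome_sq_def)
    ultimately show False by simp
  qed
  define g where "g z = qprod nome_sq (nome_sq * exp (2 * of_real pi * \<i> * z)) * qprod nome_sq (nome_sq * exp (- (2 * of_real pi * \<i> * z)))" for z
  have eq: "theta_prod = (\<lambda>z. (1 - exp (2 * of_real pi * \<i> * z)) * g z)"
  proof
    fix z
    show "theta_prod z = (1 - exp (2 * of_real pi * \<i> * z)) * g z"
      unfolding theta_prod_def g_def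
      by (subst qprod_rec[OF norm_nome_sq, of "exp (2 * of_real pi * \<i> * z)"]) simp
  qed
  have "g holomorphic_on UNIV" unfolding g_def[abs_def] by (intro holomorphic_intros)
  then have g: "(g has_field_derivative deriv g 0) (at 0)"
    by (simp add: holomorphic_derivI)
  have "(theta_prod has_field_derivative (- (2 * of_real pi * \<i>) * g 0)) (at 0)"
    unfolding eq by (auto intro!: derivative_eq_intros g)
  then have "deriv theta_prod 0 = - (2 * of_real pi * \<i>) * g 0" by (rule DERIV_imp_deriv)
  then show ?thesis using nz by (simp add: g_def)
qed

text \<open>A form of the Jacobi triple product: both sides have the same zeros and multipliers.\<close>

lemma theta_eq_theta_prod:
  "\<exists>C. C \<noteq> 0 \<and> (\<forall>z. theta \<tau> z = C * exp (- (of_real pi * \<i> * z)) * theta_prod z)"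
proof -
  \<comment> \<open>The exponential cancels the sign in the step by 1 and the factor exp(- pi i
    \<tau>) in the step by \<tau>, so F has precisely the multipliers of
    \<open>theta_prod\<close>.\<close>
  define F where "F z = exp (of_real pi * \<i> * z) * theta \<tau> z" for z
  have hol_F: "F holomorphic_on A" for A unfolding F_def[abs_def] by (intro holomorphic_intros)
  have F1: "F (z + 1) = F z" for z
    unfolding F_def theta_add_1 by (simp add: algebra_simps exp_add exp_pi_i')
  have Ft: "F (z + \<tau>) = - exp (- (2 * of_real pi * \<i> * z)) * F z" for z
  proof -
    have "exp (of_real pi * \<i> * (z + \<tau>)) * exp (- of_real pi * \<i> * \<tau> - 2 * of_real pi * \<i> * z) =
       exp (- (2 * of_real pi * \<i> * z)) * exp (of_real pi * \<i> * z)"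
      unfolding exp_add[symmetric] by (simp add: algebra_simps)
    then show ?thesis unfolding F_def theta_add_tau by (simp add: mult_ac)
  qed
  have nz: "theta_prod z \<noteq> 0" if "z \<notin> \<Lambda>" for z using theta_prod_eq_0D that by blast
  obtain C where C: "\<And>z. z \<notin> \<Lambda> \<Longrightarrow> F z / theta_prod z = C"
  proof (rule elliptic_without_poles_const[of "\<lambda>z. F z / theta_prod z" \<Lambda>])
    show "(\<lambda>z. F z / theta_prod z) holomorphic_on - \<Lambda>" by (intro holomorphic_intros hol_F) (use nz in auto)
    show "\<exists>w\<in>\<Lambda>. \<exists>L. ((\<lambda>z. F z / theta_prod z) \<longlongrightarrow> L) (at (z + w))" if "z \<in> \<Lambda>" for z
    proof (intro bexI exI)
      show "- z \<in> \<Lambda>" using that by simp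
      show "((\<lambda>z. F z / theta_prod z) \<longlongrightarrow> deriv F 0 / deriv theta_prod 0) (at (z + - z))"
        using tendsto_quotient_of_zeros[of F "deriv F 0" 0 theta_prod "deriv theta_prod 0"]
          holomorphic_derivI[OF hol_F[of UNIV]] holomorphic_derivI[OF theta_prod_holomorphic[of UNIV]]
          theta_prod_0 deriv_theta_prod_0 by (simp add: F_def)
    qed
  qed (use lattice_not_islimpt in \<open>auto simp: F1 Ft theta_prod_add_1 theta_prod_add_tau\<close>)
  \<comment> \<open>The constancy of the quotient says nothing at lattice points, where
    \<open>theta_prod\<close> may vanish; continuity of both sides covers them.\<close>
  have eq: "F z = C * theta_prod z" for z
  proof (cases "z \<in> \<Lambda>")
    case False then show ?thesis using C[of z] nz[of z] by (simp add: field_simps)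
  next
    case True
    have "isCont F z" "isCont theta_prod z"
      using holomorphic_on_imp_continuous_on[OF hol_F[of UNIV]] holomorphic_on_imp_continuous_on[OF theta_prod_holomorphic[of UNIV]]
      by (auto simp: continuous_on_eq_continuous_at)
    then have 1: "(F \<longlongrightarrow> F z) (at z)" and 2: "((\<lambda>z. C * theta_prod z) \<longlongrightarrow> C * theta_prod z) (at z)"
      by (auto simp: isCont_def intro: tendsto_mult_left)
    have "eventually (\<lambda>z. F z = C * theta_prod z) (at z)"
      using eventually_nonlattice[of z] by eventually_elim (use C nz in \<open>auto simp: field_simps\<close>)
    from Lim_transform_eventually[OF 1 this] 2 show ?thesis by (rule LIM_unique)
  qed
  have th: "theta \<tau> z = C * exp (- (of_real pi * \<i> * z)) * theta_prod z" for z
    using eq[of z] unfolding F_def by (simp add: exp_minus field_simps)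
  moreover have "C \<noteq> 0" using th theta_not_identically_0 by auto
  ultimately show ?thesis by blast
qed

text \<open>The multipliers never vanish, so the zero set of theta is invariant under the lattice
  and contains \<Lambda> together with 0. The constant function serves as f because only membership
  is to be propagated.\<close>

lemma theta_lattice: assumes "z \<in> \<Lambda>" shows "theta \<tau> z = 0"
proof (rule ccontr)
  assume "theta \<tau> z \<noteq> 0"
  moreover have "theta \<tau> (z + w) \<noteq> 0" if "theta \<tau> z \<noteq> 0" "w \<in> \<Lambda>" for z w
    using lattice_shift_invariant[of "{z. theta \<tau> z = 0}" "\<lambda>_. ()" z w] that
    by (auto simp: theta_add_1 theta_add_tau)
  ultimately have "theta \<tau> (z + - z) \<noteq> 0" using assms lattice_minus by blast
  then show False by simp
qed

lemma theta_eq_0_iff [simp]: "theta \<tau> z = 0 \<longleftrightarrow> z \<in> \<Lambda>"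
proof
  obtain C where "C \<noteq> 0" "\<And>z. theta \<tau> z = C * exp (- (of_real pi * \<i> * z)) * theta_prod z"
    using theta_eq_theta_prod by blast
  then show "theta \<tau> z = 0 \<Longrightarrow> z \<in> \<Lambda>" using theta_prod_eq_0D by auto
qed (rule theta_lattice)

lemma deriv_theta_0 [simp]: "deriv (theta \<tau>) 0 \<noteq> 0"
proof -
  obtain C where C: "C \<noteq> 0" and eq: "\<And>z. theta \<tau> z = C * exp (- (of_real pi * \<i> * z)) * theta_prod z"
    using theta_eq_theta_prod by blast
  have "(theta \<tau> has_field_derivative C * deriv theta_prod 0) (at 0)"
    unfolding eq[abs_def] by (rule derivative_eq_intros holomorphic_derivI[OF theta_prod_holomorphic[of UNIV]] | simp add: theta_prod_0)+
  then show ?thesis using C deriv_theta_prod_0 by (simp add: DERIV_imp_deriv)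
qed

end

section \<open>\<open>E\<^sub>1\<close>, \<open>E\<^sub>2\<close> and \<open>\<wp>\<close>\<close>

text \<open>The difference quotient h of g at 0 extends holomorphically with h(0) = g'(0) = 0, so
  dividing by z once more converges to h'(0).\<close>

lemma tendsto_second_order:
  fixes g :: "complex \<Rightarrow> complex"
  assumes "r > 0" "g holomorphic_on ball 0 r" "deriv g 0 = 0"
  shows "\<exists>L. ((\<lambda>z. (g z - g 0) / z^2) \<longlongrightarrow> L) (at 0)"
proof -
  define h where "h z = (if z = 0 then deriv g 0 else (g z - g 0) / (z - 0))" for z
  have "h holomorphic_on ball 0 r"
    unfolding h_def[abs_def] by (rule pole_lemma[OF assms(2)]) (use assms in simp)
  then have "(h has_field_derivative deriv h 0) (at 0)"
    using assms(1) by (intro holomorphic_derivI[of _ "ball 0 r"]) auto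
  then have "((\<lambda>z. (h z - h 0) / (z - 0)) \<longlongrightarrow> deriv h 0) (at 0)"
    by (simp add: has_field_derivative_iff)
  then show ?thesis
  proof (intro exI, rule Lim_transform_eventually)
    show "eventually (\<lambda>z. (h z - h 0) / (z - 0) = (g z - g 0) / z^2) (at 0)"
    using eventually_neq_at_within[of 0 0 UNIV]
    by eventually_elim (use assms(3) in \<open>auto simp: h_def power2_eq_square\<close>)
  qed
qed

lemma tendsto_eventually_const_eq:
  fixes f :: "complex \<Rightarrow> complex"
  assumes "(f \<longlongrightarrow> L) (at a)" "eventually (\<lambda>z. f z = c) (at a)"
  shows "L = c"
proof (rule LIM_unique[OF assms(1)])
  show "(f \<longlongrightarrow> c) (at a)" using assms(2) by (rule tendsto_eventually)
qed

lemma DERIV_transfer_on_open: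
  assumes "(f has_field_derivative D) (at z)" "(g has_field_derivative D') (at z)"
    and "open S" "z \<in> S" "\<And>x. x \<in> S \<Longrightarrow> f x = g x"
  shows "D = D'"
  using has_field_derivative_transform_within_open[OF assms(1,3,4)] assms(2,5) DERIV_unique by blast

context upper_half begin

lemma theta_DERIV [derivative_intros]:
  assumes "(f has_field_derivative D) (at z within A)"
  shows "((\<lambda>z. theta \<tau> (f z)) has_field_derivative (deriv (theta \<tau>) (f z) * D)) (at z within A)"
  using DERIV_chain2[OF holomorphic_derivI[OF theta_holomorphic_UNIV] assms] by simp

lemma deriv_theta_holomorphic [holomorphic_intros]:
  assumes "f holomorphic_on A" shows "(\<lambda>z. deriv (theta \<tau>) (f z)) holomorphic_on A"
  using holomorphic_on_compose[OF assms holomorphic_on_subset[OF holomorphic_deriv[OF theta_holomorphic_UNIV]]]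
  by (simp add: o_def)

lemma deriv_theta_add_1: "deriv (theta \<tau>) (z + 1) = - deriv (theta \<tau>) z"
proof (rule DERIV_unique)
  show "((\<lambda>z. theta \<tau> (z + 1)) has_field_derivative deriv (theta \<tau>) (z + 1)) (at z)"
    by (auto intro!: derivative_eq_intros)
  show "((\<lambda>z. theta \<tau> (z + 1)) has_field_derivative - deriv (theta \<tau>) z) (at z)"
    unfolding theta_add_1 by (auto intro!: derivative_eq_intros)
qed

lemma deriv_theta_minus: "deriv (theta \<tau>) (- z) = deriv (theta \<tau>) z"
proof -
  have "- deriv (theta \<tau>) (- z) = - deriv (theta \<tau>) z"
  proof (rule DERIV_unique)
    show "((\<lambda>z. theta \<tau> (- z)) has_field_derivative - deriv (theta \<tau>) (- z)) (at z)"
      by (auto intro!: derivative_eq_intros)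
    show "((\<lambda>z. theta \<tau> (- z)) has_field_derivative - deriv (theta \<tau>) z) (at z)"
      unfolding theta_minus by (auto intro!: derivative_eq_intros)
  qed
  then show ?thesis by simp
qed

lemma deriv_theta_add_tau:
  "deriv (theta \<tau>) (z + \<tau>) =
     - exp (- of_real pi * \<i> * \<tau> - 2 * of_real pi * \<i> * z) * (deriv (theta \<tau>) z - 2 * of_real pi * \<i> * theta \<tau> z)"
proof (rule DERIV_unique)
  show "((\<lambda>z. theta \<tau> (z + \<tau>)) has_field_derivative deriv (theta \<tau>) (z + \<tau>)) (at z)"
    by (auto intro!: derivative_eq_intros)
  show "((\<lambda>z. theta \<tau> (z + \<tau>)) has_field_derivative 
      - exp (- of_real pi * \<i> * \<tau> - 2 * of_real pi * \<i> * z) * (deriv (theta \<tau>) z - 2 * of_real pi * \<i> * theta \<tau> z)) (at z)"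
    unfolding theta_add_tau by (auto intro!: derivative_eq_intros simp: algebra_simps)
qed

section \<open>Parity and periods of \<open>E1\<close> and \<open>E2\<close>\<close>

lemma E1_minus [simp]: "E1 \<tau> (- z) = - E1 \<tau> z"
  by (simp add: E1_def deriv_theta_minus theta_minus)

lemma E1_add_1 [simp]: "E1 \<tau> (z + 1) = E1 \<tau> z"
  by (simp add: E1_def deriv_theta_add_1 theta_add_1)

lemma E1_add_tau: "z \<notin> \<Lambda> \<Longrightarrow> E1 \<tau> (z + \<tau>) = E1 \<tau> z - 2 * of_real pi * \<i>"
  unfolding E1_def deriv_theta_add_tau theta_add_tau by (simp add: diff_divide_distrib)

lemma E1_holomorphic: "E1 \<tau> holomorphic_on - \<Lambda>"
  unfolding E1_def[abs_def] by (intro holomorphic_intros) auto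

lemma E2_holomorphic: "E2 \<tau> holomorphic_on - \<Lambda>"
  unfolding E2_def[abs_def] by (intro holomorphic_intros holomorphic_deriv E1_holomorphic) auto

lemma E1_DERIV: "z \<notin> \<Lambda> \<Longrightarrow> (E1 \<tau> has_field_derivative - E2 \<tau> z) (at z)"
  unfolding E2_def using holomorphic_derivI[OF E1_holomorphic open_nonlattice, of z] by simp

lemma E1_DERIV' [derivative_intros]:
  assumes "(f has_field_derivative D) (at z within A)" "f z \<notin> \<Lambda>"
  shows "((\<lambda>z. E1 \<tau> (f z)) has_field_derivative (- E2 \<tau> (f z) * D)) (at z within A)"
  using DERIV_chain2[OF E1_DERIV[OF assms(2)] assms(1)] by simp

lemma E2_add_1: assumes "z \<notin> \<Lambda>" shows "E2 \<tau> (z + 1) = E2 \<tau> z"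
proof -
  have "- E2 \<tau> (z + 1) = - E2 \<tau> z"
  proof (rule DERIV_unique)
    show "((\<lambda>z. E1 \<tau> (z + 1)) has_field_derivative - E2 \<tau> (z + 1)) (at z)"
      by (auto intro!: derivative_eq_intros simp: assms simp del: E1_add_1)
    show "((\<lambda>z. E1 \<tau> (z + 1)) has_field_derivative - E2 \<tau> z) (at z)"
      unfolding E1_add_1 using E1_DERIV[OF assms] .
  qed
  then show ?thesis by simp
qed

lemma E2_add_tau: assumes "z \<notin> \<Lambda>" shows "E2 \<tau> (z + \<tau>) = E2 \<tau> z"
proof -
  have "- E2 \<tau> (z + \<tau>) = - E2 \<tau> z"
  proof (rule DERIV_transfer_on_open[OF _ _ open_nonlattice])
    show "((\<lambda>z. E1 \<tau> (z + \<tau>)) has_field_derivative - E2 \<tau> (z + \<tau>)) (at z)"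
      by (auto intro!: derivative_eq_intros simp: assms)
    show "((\<lambda>z. E1 \<tau> z - 2 * of_real pi * \<i>) has_field_derivative - E2 \<tau> z) (at z)"
      by (auto intro!: derivative_eq_intros simp: assms)
  qed (use assms E1_add_tau in auto)
  then show ?thesis by simp
qed

section \<open>Behaviour of \<open>E1\<close> and \<open>E2\<close> at the origin\<close>

definition theta_over_id :: "complex \<Rightarrow> complex" where
  "theta_over_id z = (if z = 0 then deriv (theta \<tau>) 0 else theta \<tau> z / z)"

lemma theta_over_id_holomorphic: "theta_over_id holomorphic_on A"
proof -
  have "theta_over_id = (\<lambda>z. if z = 0 then deriv (theta \<tau>) 0 else (theta \<tau> z - theta \<tau> 0) / (z - 0))"
    by (auto simp: theta_over_id_def fun_eq_iff)
  then have "theta_over_id holomorphic_on UNIV"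
    using pole_lemma[OF theta_holomorphic_UNIV, of 0] by simp
  then show ?thesis by (rule holomorphic_on_subset) simp
qed

definition lattice_radius :: real where "lattice_radius = 1 / lattice_bound"

lemma lattice_radius_pos: "lattice_radius > 0"
  using lattice_bound_pos by (simp add: lattice_radius_def)

lemma lattice_radius: "z \<in> ball 0 lattice_radius \<Longrightarrow> z \<in> \<Lambda> \<longleftrightarrow> z = 0"
  using lattice_nonzero_norm[of z] by (auto simp: lattice_radius_def)

lemma theta_over_id_nonzero: "z \<in> ball 0 lattice_radius \<Longrightarrow> theta_over_id z \<noteq> 0"
  using lattice_radius[of z] by (auto simp: theta_over_id_def)

text \<open>The logarithmic derivative of theta(z)/z, which is the regular part of \<open>E1\<close>
  at 0. It vanishes at 0 by oddness, and its derivative there is the classical constant -2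
  \<eta>_1.\<close>

definition E1_reg :: "complex \<Rightarrow> complex" where
  "E1_reg z = deriv theta_over_id z / theta_over_id z"

lemma E1_reg_holomorphic: "E1_reg holomorphic_on ball 0 lattice_radius"
  unfolding E1_reg_def[abs_def]
  by (intro holomorphic_intros holomorphic_deriv theta_over_id_holomorphic) (use theta_over_id_nonzero in auto)

lemma E1_near_0:
  assumes "z \<in> ball 0 lattice_radius" "z \<noteq> 0" shows "E1 \<tau> z = 1 / z + E1_reg z"
proof -
  have "(theta_over_id has_field_derivative deriv theta_over_id z) (at z)"
    using holomorphic_derivI[OF theta_over_id_holomorphic[of UNIV]] by simp
  then have "((\<lambda>z. z * theta_over_id z) has_field_derivative theta_over_id z + z * deriv theta_over_id z) (at z)"
    by (auto intro!: derivative_eq_intros)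
  moreover have "(\<lambda>z. z * theta_over_id z) = theta \<tau>" by (auto simp: theta_over_id_def fun_eq_iff)
  ultimately have "deriv (theta \<tau>) z = theta_over_id z + z * deriv theta_over_id z"
    by (simp add: DERIV_imp_deriv)
  moreover have "theta \<tau> z = z * theta_over_id z" using assms by (simp add: theta_over_id_def)
  ultimately show ?thesis
    using assms theta_over_id_nonzero[OF assms(1)] by (simp add: E1_def E1_reg_def field_simps)
qed

lemma E2_near_0:
  assumes "z \<in> ball 0 lattice_radius" "z \<noteq> 0" shows "E2 \<tau> z = 1 / z^2 - deriv E1_reg z"
proof -
  have "- E2 \<tau> z = - 1 / z^2 + deriv E1_reg z"
  proof (rule DERIV_transfer_on_open)
    show "(E1 \<tau> has_field_derivative - E2 \<tau> z) (at z)"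
      using assms lattice_radius by (intro E1_DERIV) auto
    show "((\<lambda>z. 1 / z + E1_reg z) has_field_derivative - 1 / z^2 + deriv E1_reg z) (at z)"
      using assms holomorphic_derivI[OF E1_reg_holomorphic, of z]
      by (auto intro!: derivative_eq_intros simp: power2_eq_square)
    show "open (ball 0 lattice_radius - {0::complex})" by auto
  qed (use assms E1_near_0 in auto)
  then show ?thesis by (simp add: algebra_simps)
qed

lemma eventually_near_0: "eventually (\<lambda>z. z \<in> ball 0 lattice_radius \<and> z \<noteq> 0) (at (0::complex))"
  using lattice_radius_pos by (auto simp: eventually_at dist_commute intro!: exI[of _ lattice_radius])

lemma E1_reg_isCont: "isCont E1_reg 0" and deriv_E1_reg_isCont: "isCont (deriv E1_reg) 0"
  using holomorphic_on_imp_continuous_on[OF E1_reg_holomorphic]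
    holomorphic_on_imp_continuous_on[OF holomorphic_deriv[OF E1_reg_holomorphic]] lattice_radius_pos
  by (auto simp: continuous_on_eq_continuous_at)

lemma E1_reg_0: "E1_reg 0 = 0"
proof -
  have lim: "(E1_reg \<longlongrightarrow> E1_reg 0) (at 0)" using E1_reg_isCont by (simp add: isCont_def)
  have "((\<lambda>z. E1_reg (- z)) \<longlongrightarrow> E1_reg (- 0)) (at 0)"
    by (rule isCont_tendsto_compose[of _ E1_reg]) (use E1_reg_isCont in \<open>auto intro!: tendsto_eq_intros\<close>)
  then have "((\<lambda>z. - E1_reg (- z)) \<longlongrightarrow> - E1_reg 0) (at 0)" by (auto intro: tendsto_minus)
  moreover have "eventually (\<lambda>z. - E1_reg (- z) = E1_reg z) (at 0)"
    using eventually_near_0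
  proof eventually_elim
    case (elim z)
    have "1 / (- z) + E1_reg (- z) = - (1 / z + E1_reg z)"
      using E1_near_0[of z] E1_near_0[of "- z"] elim by simp
    then show ?case by simp
  qed
  ultimately have "(E1_reg \<longlongrightarrow> - E1_reg 0) (at 0)" by (rule Lim_transform_eventually)
  with lim have "E1_reg 0 = - E1_reg 0" by (rule LIM_unique)
  then show ?thesis by simp
qed

text \<open>Both functions have principal part 1/z^2. The limit of their difference at 0 thus
  removes the only class of singularities and also evaluates the constant, since the remainder of wp
  is 0 at the origin.\<close>

lemma wp_eq_E2:
  assumes "z \<notin> \<Lambda>" shows "wp \<tau> z = E2 \<tau> z + deriv E1_reg 0"
proof -
  obtain s where s: "s analytic_on {0}" "s 0 = 0" and wp: "\<And>z. wp \<tau> z = 1 / z^2 + s z"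
    using wp_near_0 by blast
  let ?f = "\<lambda>z. E2 \<tau> z - wp \<tau> z"
  have "(s \<longlongrightarrow> 0) (at 0)"
    using analytic_at_imp_isCont[OF s(1)] s(2) by (simp add: isCont_def)
  then have "((\<lambda>z. - deriv E1_reg z - s z) \<longlongrightarrow> - deriv E1_reg 0 - 0) (at 0)"
    using deriv_E1_reg_isCont by (intro tendsto_intros) (auto simp: isCont_def)
  moreover have "eventually (\<lambda>z. - deriv E1_reg z - s z = ?f z) (at 0)"
    using eventually_near_0 by eventually_elim (simp add: E2_near_0 wp)
  ultimately have "(?f \<longlongrightarrow> - deriv E1_reg 0 - 0) (at 0)" by (rule Lim_transform_eventually)
  then have lim: "(?f \<longlongrightarrow> - deriv E1_reg 0) (at 0)" by simp
  obtain c where c: "\<And>z. z \<notin> \<Lambda> \<Longrightarrow> ?f z = c"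
  proof (rule elliptic_without_poles_const[of ?f \<Lambda>])
    show "?f holomorphic_on - \<Lambda>" by (intro holomorphic_intros E2_holomorphic wp_holomorphic)
    show "\<exists>w\<in>\<Lambda>. \<exists>L. (?f \<longlongrightarrow> L) (at (z + w))" if "z \<in> \<Lambda>" for z
      using lim lattice_minus[OF that] by (intro bexI[of _ "- z"] exI[of _ "- deriv E1_reg 0"]) auto
  qed (use lattice_not_islimpt in \<open>auto simp: E2_add_1 E2_add_tau wp_add_1 wp_add_tau\<close>)
  have "eventually (\<lambda>z. ?f z = c) (at 0)"
    using eventually_nonlattice[of 0] by eventually_elim (use c in auto)
  with lim have "- deriv E1_reg 0 = c" by (rule tendsto_eventually_const_eq)
  with c[OF assms] show ?thesis by (auto simp: algebra_simps)
qed

lemma wp_DERIV [derivative_intros]: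
  assumes "(f has_field_derivative D) (at z within A)" "f z \<notin> \<Lambda>"
  shows "((\<lambda>z. wp \<tau> (f z)) has_field_derivative (deriv (wp \<tau>) (f z) * D)) (at z within A)"
  using DERIV_chain2[OF holomorphic_derivI[OF wp_holomorphic open_nonlattice] assms(1)] assms(2) by simp

text \<open>\<open>E2\<close> and \<open>wp\<close> differ by a constant off the lattice, so the
  derivative can be recorded as that of \<open>wp\<close>, the function in the equations of
  motion.\<close>

lemma E2_DERIV [derivative_intros]:
  assumes "(f has_field_derivative D) (at z within A)" "f z \<notin> \<Lambda>"
  shows "((\<lambda>z. E2 \<tau> (f z)) has_field_derivative (deriv (wp \<tau>) (f z) * D)) (at z within A)"
proof -
  have "((\<lambda>z. wp \<tau> z - deriv E1_reg 0) has_field_derivative deriv (wp \<tau>) (f z)) (at (f z))"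
    using assms(2) by (auto intro!: derivative_eq_intros)
  then have "(E2 \<tau> has_field_derivative deriv (wp \<tau>) (f z)) (at (f z))"
    by (rule has_field_derivative_transform_within_open[OF _ open_nonlattice]) (use assms(2) wp_eq_E2 in auto)
  then show ?thesis using DERIV_chain2[OF _ assms(1)] by blast
qed

section \<open>The function \<open>\<phi>\<close>\<close>

lemma phi_holomorphic: "(\<lambda>s. phi \<tau> s z) holomorphic_on - \<Lambda>"
  unfolding phi_def[abs_def] 
  \<comment> \<open>For z in \<Lambda> the denominator is 0 and phi is identically 0 by the
    convention for division.\<close>
  by (cases "z \<in> \<Lambda>") (auto intro!: holomorphic_intros)

lemma phi'_holomorphic: "(\<lambda>s. phi' \<tau> s z) holomorphic_on - \<Lambda>"
  unfolding phi'_def[abs_def] by (intro holomorphic_deriv phi_holomorphic open_nonlattice)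

definition phi'' :: "complex \<Rightarrow> complex \<Rightarrow> complex" where
  "phi'' w z = deriv (\<lambda>s. phi' \<tau> s z) w"

lemma phi''_holomorphic: "(\<lambda>s. phi'' s z) holomorphic_on - \<Lambda>"
  unfolding phi''_def[abs_def] by (intro holomorphic_deriv phi'_holomorphic open_nonlattice)

lemma phi_DERIV: "w \<notin> \<Lambda> \<Longrightarrow> ((\<lambda>s. phi \<tau> s z) has_field_derivative phi' \<tau> w z) (at w)"
  unfolding phi'_def using holomorphic_derivI[OF phi_holomorphic open_nonlattice, of w] by simp

lemma phi'_DERIV: "w \<notin> \<Lambda> \<Longrightarrow> ((\<lambda>s. phi' \<tau> s z) has_field_derivative phi'' w z) (at w)"
  unfolding phi''_def using holomorphic_derivI[OF phi'_holomorphic open_nonlattice, of w] by simp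

lemma phi_add_1: "phi \<tau> w (z + 1) = phi \<tau> w z"
  using theta_add_1[of "w + z"] by (simp add: phi_def theta_add_1 add.assoc)

lemma phi_add_tau: "phi \<tau> w (z + \<tau>) = exp (- (2 * of_real pi * \<i> * w)) * phi \<tau> w z"
proof -
  have "theta \<tau> (w + (z + \<tau>)) = - exp (- (2 * of_real pi * \<i> * w)) * exp (- of_real pi * \<i> * \<tau> - 2 * of_real pi * \<i> * z) * theta \<tau> (w + z)"
    using theta_add_tau[of "w + z"] by (simp add: add.assoc exp_add[symmetric] algebra_simps)
  then show ?thesis unfolding phi_def theta_add_tau by simp
qed

text \<open>The multipliers of the two factors in z are inverse to each other, so the product is
  elliptic in z. It is even, hence has no residue at 0, and its double pole there is that of
  \<open>wp\<close>. The constant is read off at z = w, where phi(-w,w) = 0.\<close>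

lemma phi_mult_phi_minus:
  assumes w: "w \<notin> \<Lambda>" and z: "z \<notin> \<Lambda>"
  shows "phi \<tau> w z * phi \<tau> (- w) z = wp \<tau> z - wp \<tau> w"
proof -
  let ?f = "\<lambda>z. phi \<tau> w z * phi \<tau> (- w) z - wp \<tau> z"
  \<comment> \<open>\<alpha> and \<beta> are z phi(w,z) and z phi(-w,z) with the singularity at 0
    filled in; both equal 1 there.\<close>
  define \<alpha> where "\<alpha> z = theta \<tau> (w + z) * deriv (theta \<tau>) 0 / (theta \<tau> w * theta_over_id z)" for z
  define \<beta> where "\<beta> z = theta \<tau> (- w + z) * deriv (theta \<tau>) 0 / (theta \<tau> (- w) * theta_over_id z)" for z
  define g where "g z = \<alpha> z * \<beta> z" for z
  have k0: "theta_over_id 0 = deriv (theta \<tau>) 0" by (simp add: theta_over_id_def)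
  have kodd: "theta_over_id (- z) = theta_over_id z" for z by (simp add: theta_over_id_def theta_minus)
  have hol: "g holomorphic_on ball 0 lattice_radius"
    unfolding g_def[abs_def] \<alpha>_def \<beta>_def
    by (intro holomorphic_intros theta_over_id_holomorphic) (use w theta_over_id_nonzero in auto)
  have g0: "g 0 = 1" using w by (simp add: g_def \<alpha>_def \<beta>_def k0)
  have even: "g (- z) = g z" for z
    using theta_minus[of "z - w"] theta_minus[of "w + z"]
    by (simp add: g_def \<alpha>_def \<beta>_def kodd theta_minus)
  have "deriv g 0 = 0"
  proof -
    have D: "(g has_field_derivative deriv g 0) (at 0)"
      using holomorphic_derivI[OF hol] lattice_radius_pos by simp
    have D': "(g has_field_derivative deriv g (- 0)) (at (- 0))" using D by simp
    have "((\<lambda>z. g (- z)) has_field_derivative deriv g (- 0) * (- 1)) (at 0)"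
      by (rule DERIV_chain2[where f = g and g = uminus, OF D']) (auto intro!: derivative_eq_intros)
    then have "(g has_field_derivative - deriv g 0) (at 0)" unfolding even by simp
    with D have "deriv g 0 = - deriv g 0" by (rule DERIV_unique)
    then show ?thesis by simp
  qed
  then obtain L where "((\<lambda>z. (g z - g 0) / z^2) \<longlongrightarrow> L) (at 0)"
    using tendsto_second_order[OF lattice_radius_pos hol] by blast
  then have "((\<lambda>z. (g z - g 0) / z^2 + deriv E1_reg z - deriv E1_reg 0) \<longlongrightarrow> L + deriv E1_reg 0 - deriv E1_reg 0) (at 0)"
    using deriv_E1_reg_isCont by (intro tendsto_intros) (auto simp: isCont_def)
  moreover have "eventually (\<lambda>z. (g z - g 0) / z^2 + deriv E1_reg z - deriv E1_reg 0 = ?f z) (at 0)"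
    using eventually_near_0
  proof eventually_elim
    case (elim z)
    then have zL: "z \<notin> \<Lambda>" using lattice_radius by auto
    have th: "theta \<tau> z = z * theta_over_id z" using elim by (simp add: theta_over_id_def)
    have "phi \<tau> w z * phi \<tau> (- w) z = g z / z^2"
      using elim theta_over_id_nonzero[of z] w unfolding phi_def g_def \<alpha>_def \<beta>_def th
      by (simp add: field_simps power2_eq_square)
    then show ?case using elim zL by (simp add: wp_eq_E2 E2_near_0 g0 diff_divide_distrib)
  qed
  ultimately have lim: "(?f \<longlongrightarrow> L + deriv E1_reg 0 - deriv E1_reg 0) (at 0)"
    by (rule Lim_transform_eventually)
  obtain c where c: "\<And>z. z \<notin> \<Lambda> \<Longrightarrow> ?f z = c"
  proof (rule elliptic_without_poles_const[of ?f \<Lambda>])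
    show "?f holomorphic_on - \<Lambda>"
      unfolding phi_def by (intro holomorphic_intros wp_holomorphic) (use w in auto)
    show "\<exists>w\<in>\<Lambda>. \<exists>L. (?f \<longlongrightarrow> L) (at (z + w))" if "z \<in> \<Lambda>" for z
      using lim lattice_minus[OF that] by (intro bexI[of _ "- z"] exI) auto
    show "z + \<tau> \<notin> \<Lambda> \<and> ?f (z + \<tau>) = ?f z" if "z \<notin> \<Lambda>" for z
      using that by (simp add: phi_add_tau wp_add_tau exp_minus)
  qed (use lattice_not_islimpt in \<open>auto simp: phi_add_1 wp_add_1\<close>)
  have "phi \<tau> (- w) w = 0" by (simp add: phi_def)
  then have "c = - wp \<tau> w" using c[OF w] by simp
  with c[OF z] show ?thesis by (simp add: algebra_simps)
qed

text \<open>This is the derivative of \<open>phi_mult_phi_minus\<close> in w; the inner derivative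
  -1 of phi(-w,z) makes it a Wronskian.\<close>

lemma phi_wronskian:
  assumes w: "w \<notin> \<Lambda>" and z: "z \<notin> \<Lambda>"
  shows "phi' \<tau> w z * phi \<tau> (- w) z - phi \<tau> w z * phi' \<tau> (- w) z = - deriv (wp \<tau>) w"
proof (rule DERIV_transfer_on_open[OF _ _ open_nonlattice])
  have "((\<lambda>s. phi \<tau> (- s) z) has_field_derivative phi' \<tau> (- w) z * (- 1)) (at w)"
    by (rule DERIV_chain2[OF phi_DERIV]) (use w in \<open>auto intro!: derivative_eq_intros\<close>)
  then show "((\<lambda>s. phi \<tau> s z * phi \<tau> (- s) z) has_field_derivative
     phi' \<tau> w z * phi \<tau> (- w) z - phi \<tau> w z * phi' \<tau> (- w) z) (at w)"
    by (auto intro!: derivative_eq_intros phi_DERIV w)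
  show "((\<lambda>s. wp \<tau> z - wp \<tau> s) has_field_derivative - deriv (wp \<tau>) w) (at w)"
    by (auto intro!: derivative_eq_intros w)
qed (use w z phi_mult_phi_minus in auto)

section \<open>The addition formula for \<open>E1\<close> and differential equations for phi\<close>

lemma eventually_plus_nonlattice: "eventually (\<lambda>s. s + z \<notin> \<Lambda>) (at w)"
  using eventually_nonlattice[of "w + z"] by (simp add: eventually_at_to_0[of _ w] eventually_at_to_0[of _ "w + z"] add_ac)

text \<open>In the combination that is squared the jumps -2 pi i of \<open>E1\<close> cancel, so its
  square is elliptic in z, singular only at the classes of 0 and -w. Subtracting wp(z) and wp(w + z)
  removes the double poles, no residues remain, and the value at 0 is wp(w).\<close>

lemma E1_addition:
  assumes w: "w \<notin> \<Lambda>" and z: "z \<notin> \<Lambda>" and wz: "w + z \<notin> \<Lambda>"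
  shows "(E1 \<tau> (w + z) - E1 \<tau> w - E1 \<tau> z)^2 = wp \<tau> (w + z) + wp \<tau> w + wp \<tau> z"
proof -
  let ?f = "\<lambda>z. (E1 \<tau> (w + z) - E1 \<tau> w - E1 \<tau> z)^2 - wp \<tau> (w + z) - wp \<tau> z"
  let ?S = "\<Lambda> \<union> (\<lambda>x. x - w) ` \<Lambda>"
  have S: "x \<in> ?S \<longleftrightarrow> x \<in> \<Lambda> \<or> w + x \<in> \<Lambda>" for x
    by (auto simp: image_iff algebra_simps intro: bexI[of _ "w + x"])
  \<comment> \<open>Near 0 the combination is a(z) - 1/z. As a(0) = 0, the cross term -2 a(z)/z of
    its square stays bounded, with limit -2 a'(0).\<close>
  define a where "a z = E1 \<tau> (w + z) - E1 \<tau> w - E1_reg z" for z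
  have a0: "a 0 = 0" by (simp add: a_def E1_reg_0)
  have Da: "(a has_field_derivative - E2 \<tau> w - deriv E1_reg 0) (at 0)"
    unfolding a_def[abs_def] using holomorphic_derivI[OF E1_reg_holomorphic, of 0] lattice_radius_pos
    by (auto intro!: derivative_eq_intros simp: w)
  have quot: "((\<lambda>z. a z / z) \<longlongrightarrow> - E2 \<tau> w - deriv E1_reg 0) (at 0)"
    using Da a0 by (simp add: has_field_derivative_iff)
  have acont: "(a \<longlongrightarrow> 0) (at 0)" using DERIV_isCont[OF Da] a0 by (simp add: isCont_def)
  have wpcont: "((\<lambda>z. wp \<tau> (w + z)) \<longlongrightarrow> wp \<tau> w) (at 0)"
  proof -
    have "((\<lambda>z. wp \<tau> (w + z)) has_field_derivative deriv (wp \<tau>) (w + 0) * 1) (at 0)"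
      by (rule wp_DERIV) (auto intro!: derivative_eq_intros simp: w)
    from DERIV_isCont[OF this] show ?thesis by (simp add: isCont_def)
  qed
  have "((\<lambda>z. - 2 * (a z / z) + (a z)^2 + deriv E1_reg z - wp \<tau> (w + z) - deriv E1_reg 0) \<longlongrightarrow>
     - 2 * (- E2 \<tau> w - deriv E1_reg 0) + 0^2 + deriv E1_reg 0 - wp \<tau> w - deriv E1_reg 0) (at 0)"
    using deriv_E1_reg_isCont by (intro tendsto_intros quot acont wpcont) (auto simp: isCont_def)
  also have "- 2 * (- E2 \<tau> w - deriv E1_reg 0) + 0^2 + deriv E1_reg 0 - wp \<tau> w - deriv E1_reg 0 = wp \<tau> w"
    using w by (simp add: wp_eq_E2)
  finally have lim0: "((\<lambda>z. - 2 * (a z / z) + (a z)^2 + deriv E1_reg z - wp \<tau> (w + z) - deriv E1_reg 0) \<longlongrightarrow> wp \<tau> w) (at 0)" .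
  have ev:  "eventually (\<lambda>z. - 2 * (a z / z) + (a z)^2 + deriv E1_reg z - wp \<tau> (w + z) - deriv E1_reg 0 = ?f z) (at 0)"
    using eventually_near_0
  proof eventually_elim
    case (elim z)
    then have zL: "z \<notin> \<Lambda>" using lattice_radius by auto
    have "E1 \<tau> (w + z) - E1 \<tau> w - E1 \<tau> z = a z - 1 / z" using E1_near_0 elim by (simp add: a_def)
    moreover have "wp \<tau> z = 1 / z^2 - deriv E1_reg z + deriv E1_reg 0"
      using elim zL by (simp add: wp_eq_E2 E2_near_0)
    ultimately show ?case using elim by (simp add: power2_diff power_divide)
  qed
  from lim0 ev have lim: "(?f \<longlongrightarrow> wp \<tau> w) (at 0)" by (rule Lim_transform_eventually)
  \<comment> \<open>The reflection z -> -w - z exchanges the two singular classes, so the limit at 0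
    also serves at -w.\<close>
  have sym: "?f (- w - x) = ?f x" for x
    using E1_minus[of "w + x"] wp_minus[of "w + x"] by (simp add: algebra_simps)
  have lim': "(?f \<longlongrightarrow> wp \<tau> w) (at (- w))"
  proof -
    have "((\<lambda>x. ?f (- w - x)) \<longlongrightarrow> wp \<tau> w) (at (- w))"
    proof (rule LIM_compose2[OF _ lim])
      show "(\<lambda>x. - w - x) \<midarrow>- w\<rightarrow> 0" by (auto intro!: tendsto_eq_intros)
    qed (auto intro!: exI[of _ 1])
    then show ?thesis unfolding sym .
  qed
  obtain c where c: "\<And>z. z \<notin> ?S \<Longrightarrow> ?f z = c"
  proof (rule elliptic_without_poles_const[of ?f ?S])
    have "(\<lambda>z. E1 \<tau> (w + z)) holomorphic_on - ?S" "(\<lambda>z. wp \<tau> (w + z)) holomorphic_on - ?S"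
      by (rule holomorphic_on_compose_gen[of "\<lambda>z. w + z", unfolded o_def, OF _ E1_holomorphic]
               holomorphic_on_compose_gen[of "\<lambda>z. w + z", unfolded o_def, OF _ wp_holomorphic];
          use S in \<open>auto intro!: holomorphic_intros\<close>)+
    then show "?f holomorphic_on - ?S"
      by (intro holomorphic_intros holomorphic_on_subset[OF E1_holomorphic] holomorphic_on_subset[OF wp_holomorphic]) auto
    have "\<not> x islimpt (\<lambda>x. x - w) ` \<Lambda>" for x
    proof (rule discrete_imp_not_islimpt[OF lattice_radius_pos])
      fix x y assume "x \<in> (\<lambda>x. x - w) ` \<Lambda>" "y \<in> (\<lambda>x. x - w) ` \<Lambda>" "dist y x < lattice_radius"
      then show "y = x" using lattice_nonzero_norm lattice_diff
        by (force simp: dist_norm lattice_radius_def)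
    qed
    then show "\<not> x islimpt ?S" for x using lattice_not_islimpt by (simp add: islimpt_Un)
    show "\<exists>v\<in>\<Lambda>. \<exists>L. (?f \<longlongrightarrow> L) (at (x + v))" if "x \<in> ?S" for x
      using that unfolding S
    proof
      assume "x \<in> \<Lambda>"
      then show ?thesis using lim by (intro bexI[of _ "- x"] exI[of _ "wp \<tau> w"]) auto
    next
      assume "w + x \<in> \<Lambda>"
      then show ?thesis using lim' lattice_minus[of "w + x"] by (intro bexI[of _ "- (w + x)"] exI[of _ "wp \<tau> w"]) auto
    qed
    show "x + 1 \<notin> ?S \<and> ?f (x + 1) = ?f x" if "x \<notin> ?S" for x
      using that E1_add_1[of "w + x"] wp_add_1[of "w + x"] lattice_add_1_iff[of "w + x"]
      unfolding S by (simp add: add.assoc[symmetric] wp_add_1 del: E1_add_1) (simp add: E1_add_1)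
    show "x + \<tau> \<notin> ?S \<and> ?f (x + \<tau>) = ?f x" if "x \<notin> ?S" for x
      using that E1_add_tau[of "w + x"] wp_add_tau[of "w + x"] lattice_add_tau_iff[of "w + x"]
      unfolding S by (simp add: add.assoc[symmetric] wp_add_tau E1_add_tau) (simp add: algebra_simps)
    show "x + 1 \<in> ?S" "x + \<tau> \<in> ?S" if "x \<in> ?S" for x
      using that lattice_add_1_iff[of "w + x"] lattice_add_tau_iff[of "w + x"]
      unfolding S by (simp_all add: add.assoc[symmetric])
  qed blast
  have "eventually (\<lambda>z. z \<notin> ?S) (at 0)"
  proof -
    have "eventually (\<lambda>z. w + z \<notin> \<Lambda>) (at 0)"
      using eventually_plus_nonlattice[of w 0] by (simp add: add.commute)
    with eventually_nonlattice[of 0] show ?thesis by eventually_elim (use S in auto)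
  qed
  then have "eventually (\<lambda>z. ?f z = c) (at 0)" by eventually_elim (rule c)
  with lim have "wp \<tau> w = c" by (rule tendsto_eventually_const_eq)
  moreover have "?f z = c" by (rule c) (use z wz S in auto)
  ultimately show ?thesis by (simp add: algebra_simps)
qed

text \<open>Logarithmic differentiation of the theta quotient in w. The formula breaks down where w
  + z is a period: there phi has a zero and \<open>E1\<close> a pole, while phi' need not
  vanish.\<close>

lemma phi'_eq:
  assumes "w \<notin> \<Lambda>" "w + z \<notin> \<Lambda>"
  shows "phi' \<tau> w z = phi \<tau> w z * (E1 \<tau> (w + z) - E1 \<tau> w)"
proof (cases "z \<in> \<Lambda>")
  case True
  then have "phi \<tau> s z = 0" for s by (simp add: phi_def)
  then show ?thesis by (simp add: phi'_def)
next
  case False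
  have "((\<lambda>s. phi \<tau> s z) has_field_derivative phi \<tau> w z * (E1 \<tau> (w + z) - E1 \<tau> w)) (at w)"
    unfolding phi_def E1_def using assms False
    by (auto intro!: derivative_eq_intros simp: field_simps power2_eq_square)
  then show ?thesis using phi_DERIV[OF assms(1), of z] DERIV_unique by blast
qed

text \<open>A Lame-type equation: off the zeros of \<open>\<phi>\<close> it is the addition formula for \<open>E\<^sub>1\<close>.\<close>

lemma phi''_eq:
  assumes w: "w \<notin> \<Lambda>" and z: "z \<notin> \<Lambda>"
  shows "phi'' w z = 2 * E1 \<tau> z * phi' \<tau> w z + (2 * wp \<tau> w + wp \<tau> z - (E1 \<tau> z)^2) * phi \<tau> w z"
proof -
  let ?r = "\<lambda>w. 2 * E1 \<tau> z * phi' \<tau> w z + (2 * wp \<tau> w + wp \<tau> z - (E1 \<tau> z)^2) * phi \<tau> w z"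
  have gen: "phi'' s z = ?r s" if s: "s \<notin> \<Lambda>" and sz: "s + z \<notin> \<Lambda>" for s
  proof -
    let ?B = "E1 \<tau> (s + z) - E1 \<tau> s"
    let ?U = "- \<Lambda> \<inter> (\<lambda>s. s + z) -` (- \<Lambda>)"
    have "phi'' s z = phi' \<tau> s z * ?B + phi \<tau> s z * (- E2 \<tau> (s + z) + E2 \<tau> s)"
    proof (rule DERIV_transfer_on_open)
      show "((\<lambda>s. phi' \<tau> s z) has_field_derivative phi'' s z) (at s)" using s by (rule phi'_DERIV)
      show "((\<lambda>s. phi \<tau> s z * (E1 \<tau> (s + z) - E1 \<tau> s)) has_field_derivative
          phi' \<tau> s z * ?B + phi \<tau> s z * (- E2 \<tau> (s + z) + E2 \<tau> s)) (at s)"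
        by (auto intro!: derivative_eq_intros phi_DERIV s sz)
      show "open ?U" by (intro open_Int open_nonlattice open_vimage continuous_intros)
    qed (use s sz phi'_eq in auto)
    moreover have p: "phi' \<tau> s z = phi \<tau> s z * ?B" using s sz by (rule phi'_eq)
    moreover have "- E2 \<tau> (s + z) + E2 \<tau> s = wp \<tau> s - wp \<tau> (s + z)"
      using s sz by (simp add: wp_eq_E2)
    ultimately have "phi'' s z = phi \<tau> s z * ?B * ?B + phi \<tau> s z * (wp \<tau> s - wp \<tau> (s + z))"
      by (simp only:)
    also have "\<dots> = phi \<tau> s z * (?B^2 + wp \<tau> s - wp \<tau> (s + z))"
      by (simp add: power2_eq_square algebra_simps)
    also have "?B^2 = wp \<tau> (s + z) + wp \<tau> s + wp \<tau> z + 2 * E1 \<tau> z * ?B - (E1 \<tau> z)^2"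
      using E1_addition[OF s z sz] by (simp add: power2_eq_square algebra_simps)
    also have "phi \<tau> s z * (\<dots> + wp \<tau> s - wp \<tau> (s + z)) = ?r s"
      unfolding p by (simp add: algebra_simps)
    finally show ?thesis .
  qed
  \<comment> \<open>Both sides are continuous in w off the lattice, which settles the remaining case
    that w + z is a period.\<close>
  have "?r holomorphic_on - \<Lambda>"
    by (intro holomorphic_intros phi_holomorphic phi'_holomorphic wp_holomorphic)
  then have "isCont ?r w" "isCont (\<lambda>w. phi'' w z) w"
    using holomorphic_on_imp_continuous_on[of ?r "- \<Lambda>"] holomorphic_on_imp_continuous_on[OF phi''_holomorphic[of z]] w
    by (simp_all add: continuous_on_eq_continuous_at)
  then have 1: "(?r \<longlongrightarrow> ?r w) (at w)" and 2: "((\<lambda>w. phi'' w z) \<longlongrightarrow> phi'' w z) (at w)"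
    by (auto simp: isCont_def)
  have "eventually (\<lambda>s. phi'' s z = ?r s) (at w)"
    using eventually_nonlattice[of w] eventually_plus_nonlattice[of z w] by eventually_elim (rule gen)
  from LIM_unique[OF Lim_transform_eventually[OF 2 this] 1] show ?thesis .
qed

text \<open>Dividing by phi, which is nonzero when z and w + z are not periods, leaves K + N (E1(w +
  z) - E1(w) - E1(z)) = 0. Multiplied by z, the left side tends to -N as z -> 0.\<close>

lemma leading_coefficient_eq_0:
  assumes w: "w \<notin> \<Lambda>"
    and "\<And>z. z \<notin> \<Lambda> \<Longrightarrow> K * phi \<tau> w z + N * (phi' \<tau> w z - E1 \<tau> z * phi \<tau> w z) = 0"
  shows "N = 0"
proof -
  have D: "((\<lambda>z. E1 \<tau> (w + z)) has_field_derivative - E2 \<tau> w) (at 0)"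
    by (auto intro!: derivative_eq_intros simp: w)
  have c: "((\<lambda>z. E1 \<tau> (w + z)) \<longlongrightarrow> E1 \<tau> w) (at 0)" using DERIV_isCont[OF D] by (simp add: isCont_def)
  have "((\<lambda>z. z * K + N * (z * (E1 \<tau> (w + z) - E1 \<tau> w) - z * E1_reg z - 1)) \<longlongrightarrow>
      0 * K + N * (0 * (E1 \<tau> w - E1 \<tau> w) - 0 * E1_reg 0 - 1)) (at 0)"
    using E1_reg_isCont by (intro tendsto_intros c) (auto simp: isCont_def)
  moreover have "eventually (\<lambda>z. z * K + N * (z * (E1 \<tau> (w + z) - E1 \<tau> w) - z * E1_reg z - 1) = 0) (at 0)"
    using eventually_near_0 eventually_plus_nonlattice[of w 0]
  proof eventually_elim
    case (elim z)
    then have z: "z \<notin> \<Lambda>" "w + z \<notin> \<Lambda>" using lattice_radius by (auto simp: add.commute)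
    have "phi \<tau> w z \<noteq> 0" using w z by (simp add: phi_def)
    moreover have "phi \<tau> w z * (K + N * (E1 \<tau> (w + z) - E1 \<tau> w - E1 \<tau> z)) = 0"
      using assms(2)[OF z(1)] phi'_eq[OF w z(2)] by (simp add: algebra_simps)
    ultimately have "K + N * (E1 \<tau> (w + z) - E1 \<tau> w - (1 / z + E1_reg z)) = 0"
      using E1_near_0 elim by simp
    then have "z * (K + N * (E1 \<tau> (w + z) - E1 \<tau> w - (1 / z + E1_reg z))) = 0" by simp
    then show ?case using elim by (simp add: algebra_simps)
  qed
  ultimately have "0 * K + N * (0 * (E1 \<tau> w - E1 \<tau> w) - 0 * E1_reg 0 - 1) = 0"
    by (rule tendsto_eventually_const_eq)
  then show ?thesis by simp
qed

end

section \<open>Smooth functions of one real variable\<close>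

text \<open>Counting the order recursively, with f generalised, suits induction over products and
  compositions; \<open>diffk_iff\<close> translates to the iterated derivatives in
  \<open>smooth_loop\<close>.\<close>

fun diffk :: "nat \<Rightarrow> (real \<Rightarrow> complex) \<Rightarrow> bool" where
  "diffk 0 f \<longleftrightarrow> True"
| "diffk (Suc k) f \<longleftrightarrow> (\<forall>x. f differentiable at x) \<and> diffk k (ddx f)"

definition smooth_fun :: "(real \<Rightarrow> complex) \<Rightarrow> bool" where
  "smooth_fun f \<longleftrightarrow> (\<forall>k. diffk k f)"

lemma diffk_iff: "diffk k f \<longleftrightarrow> (\<forall>j<k. \<forall>x. (ddx ^^ j) f differentiable at x)"
proof (induction k arbitrary: f)
  case (Suc k)
  have "(\<forall>j<Suc k. \<forall>x. (ddx ^^ j) f differentiable at x) \<longleftrightarrow>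
      (\<forall>x. f differentiable at x) \<and> (\<forall>j<k. \<forall>x. (ddx ^^ Suc j) f differentiable at x)"
    by (auto simp: less_Suc_eq_0_disj)
  then show ?case by (simp add: Suc funpow_Suc_right del: funpow.simps)
qed simp

lemma smooth_loop_iff: "smooth_loop l f \<longleftrightarrow> (\<forall>x. f (x + l) = f x) \<and> smooth_fun f"
  by (auto simp: smooth_loop_def smooth_fun_def diffk_iff)

lemma ddx_eqI: "(f has_vector_derivative D) (at x) \<Longrightarrow> ddx f x = D"
  by (simp add: ddx_def vector_derivative_at)

lemma differentiable_has_ddx: "f differentiable at x \<Longrightarrow> (f has_vector_derivative ddx f x) (at x)"
  by (simp add: ddx_def vector_derivative_works)

lemma diffk_Suc_I:
  assumes "\<And>x. (f has_vector_derivative f' x) (at x)" "diffk k f'" shows "diffk (Suc k) f"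
proof -
  have "ddx f = f'" using ddx_eqI[OF assms(1)] by auto
  then show ?thesis using assms by (auto intro: differentiableI_vector[OF assms(1)])
qed

lemma diffk_Suc_D: "diffk (Suc k) f \<Longrightarrow> (f has_vector_derivative ddx f x) (at x)"
  by (simp add: differentiable_has_ddx)

lemma diffk_SucD: "diffk (Suc k) f \<Longrightarrow> diffk k f"
  by (simp only: diffk_iff) auto

lemma diffk_const: "diffk k (\<lambda>_. c)"
proof (induction k arbitrary: c)
  case (Suc k) show ?case by (rule diffk_Suc_I[where f' = "\<lambda>_. 0"]) (auto intro: Suc)
qed simp

lemma diffk_add: "diffk k f \<Longrightarrow> diffk k g \<Longrightarrow> diffk k (\<lambda>x. f x + g x)"
proof (induction k arbitrary: f g)
  case (Suc k)
  show ?case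
    by (rule diffk_Suc_I[where f' = "\<lambda>x. ddx f x + ddx g x"])
       (use Suc in \<open>auto intro!: has_vector_derivative_add diffk_Suc_D\<close>)
qed simp

lemma diffk_mult: "diffk k f \<Longrightarrow> diffk k g \<Longrightarrow> diffk k (\<lambda>x. f x * g x)"
proof (induction k arbitrary: f g)
  case (Suc k)
  show ?case
  proof (rule diffk_Suc_I)
    show "((\<lambda>x. f x * g x) has_vector_derivative f x * ddx g x + ddx f x * g x) (at x)" for x
      by (intro has_vector_derivative_mult diffk_Suc_D[OF Suc.prems(1)] diffk_Suc_D[OF Suc.prems(2)])
    show "diffk k (\<lambda>x. f x * ddx g x + ddx f x * g x)"
      using Suc.prems diffk_SucD by (intro diffk_add Suc.IH) auto
  qed
qed simp

lemma has_vector_derivative_holomorphic_compose: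
  assumes "(f has_vector_derivative f') (at x)" "(F has_field_derivative F') (at (f x))"
  shows "((\<lambda>x. F (f x)) has_vector_derivative f' * F') (at x)"
  using field_vector_diff_chain_at[OF assms] by (simp add: o_def)

lemma diffk_compose:
  assumes "open S" "range f \<subseteq> S"
  shows "F holomorphic_on S \<Longrightarrow> diffk k f \<Longrightarrow> diffk k (\<lambda>x. F (f x))"
proof (induction k arbitrary: F)
  case (Suc k)
  show ?case
  proof (rule diffk_Suc_I)
    fix x
    have "(F has_field_derivative deriv F (f x)) (at (f x))"
      using Suc.prems(1) assms by (intro holomorphic_derivI[of F S]) auto
    then show "((\<lambda>x. F (f x)) has_vector_derivative ddx f x * deriv F (f x)) (at x)"
      by (rule has_vector_derivative_holomorphic_compose[OF diffk_Suc_D[OF Suc.prems(2)]])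
    have "diffk k (\<lambda>x. deriv F (f x))"
      by (rule Suc.IH[OF holomorphic_deriv[OF Suc.prems(1) assms(1)] diffk_SucD[OF Suc.prems(2)]])
    moreover have "diffk k (ddx f)" using Suc.prems(2) by simp
    ultimately show "diffk k (\<lambda>x. ddx f x * deriv F (f x))" by (intro diffk_mult)
  qed
qed simp

lemma diffk_cnj: "diffk k f \<Longrightarrow> diffk k (\<lambda>x. cnj (f x))"
proof (induction k arbitrary: f)
  case (Suc k)
  show ?case
    by (rule diffk_Suc_I[where f' = "\<lambda>x. cnj (ddx f x)"])
       (use Suc in \<open>auto intro!: has_vector_derivative_cnj diffk_Suc_D\<close>)
qed simp

lemma smooth_const [simp]: "smooth_fun (\<lambda>_. c)"
  by (simp add: smooth_fun_def diffk_const)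

lemma smooth_add: "smooth_fun f \<Longrightarrow> smooth_fun g \<Longrightarrow> smooth_fun (\<lambda>x. f x + g x)"
  by (simp add: smooth_fun_def diffk_add)

lemma smooth_mult: "smooth_fun f \<Longrightarrow> smooth_fun g \<Longrightarrow> smooth_fun (\<lambda>x. f x * g x)"
  by (simp add: smooth_fun_def diffk_mult)

lemma smooth_minus: "smooth_fun f \<Longrightarrow> smooth_fun (\<lambda>x. - f x)"
  using smooth_mult[of "\<lambda>_. - 1" f] by simp

lemma smooth_diff: "smooth_fun f \<Longrightarrow> smooth_fun g \<Longrightarrow> smooth_fun (\<lambda>x. f x - g x)"
  using smooth_add[of f "\<lambda>x. - g x"] smooth_minus[of g] by simp

lemma smooth_power: "smooth_fun f \<Longrightarrow> smooth_fun (\<lambda>x. f x ^ n)"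
  by (induction n) (auto intro: smooth_mult)

lemma smooth_compose:
  assumes "smooth_fun f" "F holomorphic_on S" "open S" "\<And>x. f x \<in> S"
  shows "smooth_fun (\<lambda>x. F (f x))"
proof -
  have "range f \<subseteq> S" using assms(4) by blast
  then show ?thesis using assms diffk_compose[of S f F] by (simp add: smooth_fun_def)
qed

lemma smooth_divide:
  assumes "smooth_fun f" "smooth_fun g" "\<And>x. g x \<noteq> 0" shows "smooth_fun (\<lambda>x. f x / g x)"
proof -
  have "smooth_fun (\<lambda>x. inverse (g x))"
    by (rule smooth_compose[of g inverse "- {0}"]) (use assms in \<open>auto intro!: holomorphic_intros\<close>)
  from smooth_mult[OF assms(1) this] show ?thesis by (simp add: divide_inverse)
qed

lemma smooth_cnj: "smooth_fun f \<Longrightarrow> smooth_fun (\<lambda>x. cnj (f x))"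
  by (simp add: smooth_fun_def diffk_cnj)

lemma smooth_ddx: "smooth_fun f \<Longrightarrow> smooth_fun (ddx f)"
  unfolding smooth_fun_def by (metis diffk.simps(2))

lemma smooth_has_ddx: "smooth_fun f \<Longrightarrow> (f has_vector_derivative ddx f x) (at x)"
  unfolding smooth_fun_def by (metis diffk_Suc_D)

lemma smooth_continuous: "smooth_fun f \<Longrightarrow> continuous_on A f"
  by (meson continuous_at_imp_continuous_on has_vector_derivative_continuous smooth_has_ddx)

lemmas smooth_intros = smooth_const smooth_add smooth_mult smooth_minus smooth_diff smooth_power
  smooth_divide smooth_ddx

lemma ddx_periodic:
  assumes "\<And>x. f (x + l) = f x" "smooth_fun f" shows "ddx f (x + l) = ddx f x"
proof -
  have "((\<lambda>x. f (x + l)) has_vector_derivative ddx f (x + l)) (at x)"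
  proof -
    have "((\<lambda>x. x + l) has_vector_derivative 1) (at x)"
      unfolding has_real_derivative_iff_has_vector_derivative[symmetric] by (auto intro!: derivative_eq_intros)
    from vector_diff_chain_at[OF this smooth_has_ddx[OF assms(2)]] show ?thesis by (simp add: o_def)
  qed
  then show ?thesis using smooth_has_ddx[OF assms(2), of x] unfolding assms(1) by (rule vector_derivative_unique_at)
qed

lemma integral_total_derivative_loop:
  fixes W :: "real \<Rightarrow> complex"
  assumes "l > 0" "\<And>x. (W has_vector_derivative w x) (at x)" "W l = W 0"
  shows "(w has_integral 0) {0..l}"
proof -
  have "(w has_integral (W l - W 0)) {0..l}"
    by (rule fundamental_theorem_of_calculus) (use assms in \<open>auto intro: has_vector_derivative_at_within\<close>)
  then show ?thesis using assms by simp
qed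

lemma variational_derivative_unique:
  assumes l: "l > 0"
    and "has_variational_derivative l F w g1" "has_variational_derivative l F w g2"
  shows "g1 = g2"
proof -
  have g1: "smooth_fun g1" "\<And>x. g1 (x + l) = g1 x" and g2: "smooth_fun g2" "\<And>x. g2 (x + l) = g2 x"
    using assms(2,3) by (auto simp: has_variational_derivative_def smooth_loop_iff)
  define \<eta> where "\<eta> x = cnj (g1 x - g2 x)" for x
  have "smooth_loop l \<eta>"
    unfolding smooth_loop_iff \<eta>_def by (auto intro!: smooth_cnj smooth_diff g1 g2 simp: g1(2) g2(2))
  then have "integral {0..l} (\<lambda>x. g1 x * \<eta> x) = integral {0..l} (\<lambda>x. g2 x * \<eta> x)"
    using assms(2,3) DERIV_unique unfolding has_variational_derivative_def by blast
  moreover have int: "(\<lambda>x. g x * \<eta> x) integrable_on {0..l}" if "smooth_fun g" for g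
    using smooth_continuous[OF smooth_mult[OF that, of \<eta>]] \<open>smooth_loop l \<eta>\<close>
    by (intro integrable_continuous_real) (auto simp: smooth_loop_iff)
  ultimately have "integral {0..l} (\<lambda>x. g1 x * \<eta> x - g2 x * \<eta> x) = 0"
    using integral_diff[OF int[OF g1(1)] int[OF g2(1)]] by simp
  moreover have "g1 x * \<eta> x - g2 x * \<eta> x = of_real ((norm (g1 x - g2 x))^2)" for x
    unfolding \<eta>_def left_diff_distrib[symmetric] by (rule complex_norm_square[symmetric])
  ultimately have "integral {0..l} (\<lambda>x. complex_of_real ((norm (g1 x - g2 x))^2)) = 0" by simp
  moreover have cont: "continuous_on {0..l} (\<lambda>x. (norm (g1 x - g2 x))^2)"
    by (intro continuous_intros smooth_continuous g1 g2)
  ultimately have 0: "integral {0..l} (\<lambda>x. (norm (g1 x - g2 x))^2) = 0"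
    using integral_unique[OF has_integral_of_real[OF integrable_integral[OF integrable_continuous_real[OF cont]], where 'b = complex]]
    by simp
  have eq: "g1 x = g2 x" if "x \<in> {0..l}" for x
  proof -
    have "((\<lambda>x. (norm (g1 x - g2 x))^2) has_integral 0) {0..l}"
      using integrable_integral[OF integrable_continuous_real[OF cont]] 0 by simp
    then have "(norm (g1 x - g2 x))^2 = 0"
      using has_integral_0_cbox_imp_0[of 0 l "\<lambda>x. (norm (g1 x - g2 x))^2" x] cont that l by simp
    then show ?thesis by simp
  qed
  \<comment> \<open>So far the two functions agree on one period only.\<close>
  have per: "g (x + real n * l) = g x" if "\<And>x. g (x + l) = g x" for g :: "real \<Rightarrow> complex" and x n
  proof (induction n)
    case (Suc n)
    then show ?case using that[of "x + real n * l"] by (simp add: algebra_simps)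
  qed simp
  have per': "g x = g (x - of_int \<lfloor>x / l\<rfloor> * l)" if "\<And>x. g (x + l) = g x" for g :: "real \<Rightarrow> complex" and x
  proof (cases "\<lfloor>x / l\<rfloor>" rule: int_cases2)
    case (nonneg n)
    then show ?thesis using per[of g "x - real n * l" n] that by simp
  next
    case (nonpos n)
    then show ?thesis using per[of g x n] that by simp
  qed
  show ?thesis
  proof
    fix x
    have "x - of_int \<lfloor>x / l\<rfloor> * l \<in> {0..l}"
    proof -
      have "of_int \<lfloor>x / l\<rfloor> \<le> x / l" "x / l \<le> of_int \<lfloor>x / l\<rfloor> + 1" by linarith+
      then have "of_int \<lfloor>x / l\<rfloor> * l \<le> x" "x \<le> (of_int \<lfloor>x / l\<rfloor> + 1) * l" using l
        by (simp_all only: pos_le_divide_eq pos_divide_le_eq)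
      then show ?thesis by (simp add: algebra_simps)
    qed
    then show "g1 x = g2 x" using eq per'[of g1 x] per'[of g2 x] g1(2) g2(2) by simp
  qed
qed

section \<open>Fields\<close>

text \<open>Periodicity in x is split off, so closure under \<open>Dx\<close> and \<open>Dt\<close>
  follows directly from the recursion of \<open>Ck_field\<close>.\<close>

definition smooth_field :: "real set \<Rightarrow> (real \<Rightarrow> real \<Rightarrow> complex) \<Rightarrow> bool" where
  "smooth_field T f \<longleftrightarrow> (\<forall>k. Ck_field k T f)"

lemma smooth_field_Dx: "smooth_field T f \<Longrightarrow> smooth_field T (Dx f)"
  and smooth_field_Dt: "smooth_field T f \<Longrightarrow> smooth_field T (Dt f)"
  unfolding smooth_field_def by (metis Ck_field.simps(2))+

lemma smooth_field_Dx_DERIV: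
  assumes "smooth_field T f" "t \<in> T" shows "((\<lambda>s. f s t) has_vector_derivative Dx f x t) (at x)"
  using assms unfolding smooth_field_def Dx_def by (metis Ck_field.simps(2) vector_derivative_works)

lemma smooth_field_Dt_DERIV:
  assumes "smooth_field T f" "t \<in> T" shows "((\<lambda>s. f x s) has_vector_derivative Dt f x t) (at t)"
  using assms unfolding smooth_field_def Dt_def by (metis Ck_field.simps(2) vector_derivative_works)

lemma smooth_field_continuous:
  assumes "smooth_field T f" shows "continuous_on (UNIV \<times> T) (\<lambda>(x, t). f x t)"
  using assms unfolding smooth_field_def by (metis Ck_field.simps(1))

lemma Dx_eq_ddx: "Dx f x t = ddx (\<lambda>s. f s t) x"
  by (simp add: Dx_def ddx_def)

lemma smooth_field_smooth_fun:
  assumes "smooth_field T f" "t \<in> T" shows "smooth_fun (\<lambda>x. f x t)"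
proof -
  have "diffk k (\<lambda>x. f x t)" for k
    using assms(1)
  proof (induction k arbitrary: f)
    case (Suc k)
    show ?case
      by (rule diffk_Suc_I[OF smooth_field_Dx_DERIV[OF Suc.prems assms(2)] Suc.IH[OF smooth_field_Dx[OF Suc.prems]]])
  qed simp
  then show ?thesis by (simp add: smooth_fun_def)
qed

text \<open>Schwarz's theorem by integration: f(y,t) - f(a,t) is the integral of f_x, which is
  differentiated in t under the integral sign and then in y by the fundamental theorem. Joint
  continuity of the mixed derivative is what the first of these steps uses.\<close>

lemma smooth_field_Dt_Dx:
  assumes f: "smooth_field T f" and T: "open T" "t \<in> T"
  shows "Dt (Dx f) x t = Dx (Dt f) x t"
proof -
  obtain d where d: "d > 0" "ball t d \<subseteq> T" using T open_contains_ball by blast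
  note fx = smooth_field_Dx[OF f]
  have cont_slice: "continuous_on A (\<lambda>s. g s t')" if "smooth_field T g" "t' \<in> T" for g t' A
    using smooth_continuous[OF smooth_field_smooth_fun[OF that]] .
  \<comment> \<open>Starting to the left of x makes x interior to [a, x + 1], so the derivative
    within that interval is a two-sided one.\<close>
  define a where "a = x - 1"
  have int: "((\<lambda>s. Dx f s t') has_integral (f y t' - f a t')) {a..y}" if "t' \<in> T" "a \<le> y" for t' y
    using that by (intro fundamental_theorem_of_calculus has_vector_derivative_at_within[OF smooth_field_Dx_DERIV[OF f]]) auto
  have *: "Dt f y t - Dt f a t = integral {a..y} (\<lambda>s. Dt (Dx f) s t)" if "a \<le> y" for y
  proof -
    have "((\<lambda>t'. integral (cbox a y) (\<lambda>s. Dx f s t')) has_vector_derivative integral (cbox a y) (\<lambda>s. Dt (Dx f) s t)) (at t within ball t d)"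
    proof (rule leibniz_rule_vector_derivative)
      show "((\<lambda>t'. Dx f s t') has_vector_derivative Dt (Dx f) s t') (at t' within ball t d)"
        if "t' \<in> ball t d" for t' s
      proof -
        have "t' \<in> T" using that d by blast
        then show ?thesis by (rule has_vector_derivative_at_within[OF smooth_field_Dt_DERIV[OF fx]])
      qed
      show "(\<lambda>s. Dx f s t') integrable_on cbox a y" if "t' \<in> ball t d" for t'
        by (rule integrable_continuous, rule cont_slice[OF fx]) (use that d in blast)
      have "continuous_on (ball t d \<times> cbox a y) (\<lambda>p. case (snd p, fst p) of (x, t) \<Rightarrow> Dt (Dx f) x t)"
        by (rule continuous_on_compose2[OF smooth_field_continuous[OF smooth_field_Dt[OF fx]]])
           (use d in \<open>auto intro!: continuous_on_Pair continuous_on_fst continuous_on_snd continuous_on_id\<close>)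
      then show "continuous_on (ball t d \<times> cbox a y) (\<lambda>(t', s). Dt (Dx f) s t')"
        by (simp add: case_prod_unfold)
    qed (use d in auto)
    then have "((\<lambda>t'. integral {a..y} (\<lambda>s. Dx f s t')) has_vector_derivative integral {a..y} (\<lambda>s. Dt (Dx f) s t)) (at t)"
      using d by (simp add: at_within_open[of t "ball t d"])
    moreover have "integral {a..y} (\<lambda>s. Dx f s t') = f y t' - f a t'" if "t' \<in> T" for t'
      using int[OF that \<open>a \<le> y\<close>] by (rule integral_unique)
    ultimately have "((\<lambda>t'. f y t' - f a t') has_vector_derivative integral {a..y} (\<lambda>s. Dt (Dx f) s t)) (at t)"
      using T by (simp add: has_vector_derivative_transform_within_open)
    moreover have "((\<lambda>t'. f y t' - f a t') has_vector_derivative Dt f y t - Dt f a t) (at t)"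
      by (intro has_vector_derivative_diff smooth_field_Dt_DERIV[OF f T(2)])
    ultimately show ?thesis by (rule vector_derivative_unique_at[symmetric])
  qed
  have "((\<lambda>y. integral {a..y} (\<lambda>s. Dt (Dx f) s t)) has_vector_derivative Dt (Dx f) x t) (at x within {a..x+1})"
    by (rule integral_has_vector_derivative[OF cont_slice[OF smooth_field_Dt[OF fx] T(2)]]) (simp add: a_def)
  then have "((\<lambda>y. Dt f y t - Dt f a t) has_vector_derivative Dt (Dx f) x t) (at x within {a..x+1})"
    by (rule has_vector_derivative_transform[rotated 2]) (use *[unfolded a_def] in \<open>auto simp: a_def\<close>)
  moreover have "x \<in> interior {a..x+1}" by (simp add: a_def)
  ultimately have 1: "((\<lambda>y. Dt f y t - Dt f a t) has_vector_derivative Dt (Dx f) x t) (at x)"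
    by (simp only: at_within_interior)
  have "((\<lambda>y. Dt f y t - Dt f a t) has_vector_derivative Dx (Dt f) x t - 0) (at x)"
    by (intro has_vector_derivative_diff smooth_field_Dx_DERIV[OF smooth_field_Dt[OF f] T(2)] has_vector_derivative_const)
  from vector_derivative_unique_at[OF 1 this] show ?thesis by simp
qed

section \<open>Variation of the Hamiltonian\<close>

lemma has_vector_derivative_divide_complex:
  fixes f g :: "real \<Rightarrow> complex"
  assumes "(f has_vector_derivative f') (at x)" "(g has_vector_derivative g') (at x)" "g x \<noteq> 0"
  shows "((\<lambda>x. f x / g x) has_vector_derivative (f' * g x - f x * g') / (g x)^2) (at x)"
proof -
  have "(inverse has_field_derivative - (inverse (g x) ^ 2)) (at (g x))"
    using DERIV_inverse[OF assms(3)] by (simp add: power2_eq_square numeral_2_eq_2)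
  from has_vector_derivative_holomorphic_compose[OF assms(2) this]
  have "((\<lambda>x. f x * inverse (g x)) has_vector_derivative
      f x * (g' * - (inverse (g x) ^ 2)) + f' * inverse (g x)) (at x)"
    by (intro has_vector_derivative_mult assms(1))
  moreover have "f x * (g' * - (inverse (g x) ^ 2)) + f' * inverse (g x) = (f' * g x - f x * g') / (g x)^2"
    using assms(3) by (simp add: field_simps power2_eq_square)
  ultimately show ?thesis by (simp add: divide_inverse)
qed

lemma has_vector_derivative_power2:
  fixes f :: "real \<Rightarrow> complex"
  assumes "(f has_vector_derivative f') (at x)"
  shows "((\<lambda>x. (f x)^2) has_vector_derivative 2 * f x * f') (at x)"
  using has_vector_derivative_mult[OF assms assms] by (simp add: power2_eq_square algebra_simps)

lemma parameter_integral_DERIV: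
  fixes f f' :: "complex \<Rightarrow> real \<Rightarrow> complex"
  assumes "\<delta> > 0"
    and "\<And>\<epsilon> x. \<epsilon> \<in> ball 0 \<delta> \<Longrightarrow> x \<in> {0..l} \<Longrightarrow> ((\<lambda>\<epsilon>. f \<epsilon> x) has_field_derivative f' \<epsilon> x) (at \<epsilon>)"
    and f: "continuous_on (ball 0 \<delta> \<times> {0..l}) (\<lambda>p. f (fst p) (snd p))"
    and f': "continuous_on (ball 0 \<delta> \<times> {0..l}) (\<lambda>p. f' (fst p) (snd p))"
  shows "((\<lambda>\<epsilon>. integral {0..l} (f \<epsilon>)) has_field_derivative integral {0..l} (f' 0)) (at 0)"
proof -
  have "((\<lambda>\<epsilon>. integral (cbox 0 l) (f \<epsilon>)) has_field_derivative integral (cbox 0 l) (f' 0)) (at 0 within ball 0 \<delta>)"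
  proof (rule leibniz_rule_field_derivative)
    show "((\<lambda>\<epsilon>. f \<epsilon> x) has_field_derivative f' \<epsilon> x) (at \<epsilon> within ball 0 \<delta>)"
      if "\<epsilon> \<in> ball 0 \<delta>" "x \<in> cbox 0 l" for \<epsilon> x
      using assms(2)[of \<epsilon> x] that by (auto intro: has_field_derivative_at_within)
    show "f \<epsilon> integrable_on cbox 0 l" if "\<epsilon> \<in> ball 0 \<delta>" for \<epsilon>
    proof (rule integrable_continuous)
      show "continuous_on (cbox 0 l) (f \<epsilon>)"
      proof -
        have "continuous_on (cbox 0 l) (\<lambda>x. f (fst (\<epsilon>, x)) (snd (\<epsilon>, x)))"
          by (rule continuous_on_compose2[OF f], intro continuous_on_Pair continuous_on_const continuous_on_id)
             (use that in auto)
        then show ?thesis by simp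
      qed
    qed
    show "continuous_on (ball 0 \<delta> \<times> cbox 0 l) (\<lambda>(\<epsilon>, x). f' \<epsilon> x)"
      using f' by (simp add: case_prod_unfold)
  qed (use assms(1) in auto)
  then show ?thesis using assms(1) by (simp add: at_within_open[of 0 "ball 0 \<delta>"])
qed

lemma ddx_perturbed:
  assumes "smooth_fun f" "smooth_fun g"
  shows "ddx (\<lambda>x. f x + c * g x) = (\<lambda>x. ddx f x + c * ddx g x)"
proof
  fix x
  have "((\<lambda>x. c * g x) has_vector_derivative c * ddx g x) (at x)"
    using has_vector_derivative_mult[OF has_vector_derivative_const smooth_has_ddx[OF assms(2)]] by simp
  then show "ddx (\<lambda>x. f x + c * g x) x = ddx f x + c * ddx g x"
    by (intro ddx_eqI has_vector_derivative_add smooth_has_ddx[OF assms(1)])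
qed

lemma smooth_continuous_snd:
  "smooth_fun f \<Longrightarrow> continuous_on A (\<lambda>p. f (snd p))"
  by (rule continuous_on_compose2[OF smooth_continuous[of f UNIV]]) (auto intro!: continuous_intros)

context upper_half begin

lemma variation_v:
  assumes l: "l > 0" and h: "h \<noteq> 0"
    and U: "smooth_fun U" "\<And>x. U (x + l) = U x" and V: "smooth_fun V" "\<And>x. V (x + l) = V x"
    and UL: "\<And>x. 2 * U x \<notin> \<Lambda>" and nz: "\<And>x. h - (ddx U x)^2 \<noteq> 0"
  shows "has_variational_derivative l (\<lambda>w. H_CM \<tau> h l U w) V
    (\<lambda>x. - V x / (8 * of_real pi ^ 2) * (1 - (ddx U x)^2 / h))"
  unfolding has_variational_derivative_def
proof (intro conjI allI impI)
  show "smooth_loop l (\<lambda>x. - V x / (8 * of_real pi ^ 2) * (1 - (ddx U x)^2 / h))"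
    unfolding smooth_loop_iff using ddx_periodic[OF U(2,1)]
    by (auto intro!: smooth_intros U V simp: V(2) h)
  fix \<eta> assume "smooth_loop l \<eta>"
  then have e: "smooth_fun \<eta>" by (simp add: smooth_loop_iff)
  note sm = smooth_ddx[OF U(1)] smooth_ddx[OF smooth_ddx[OF U(1)]]
  define c where "c x = (3 * (ddx U x)^2 - h) * wp \<tau> (2 * U x) - (ddx (ddx U) x)^2 / (4 * (h - (ddx U x)^2))" for x
  have c: "smooth_fun c" unfolding c_def[abs_def]
    by (intro smooth_intros smooth_compose[of "\<lambda>x. 2 * U x" "wp \<tau>" "- \<Lambda>"] U wp_holomorphic) (use UL nz in auto)
  define f where "f \<epsilon> x = - ((V x + \<epsilon> * \<eta> x)^2 / (16 * of_real pi ^ 2)) * (1 - (ddx U x)^2 / h) + c x" for \<epsilon> x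
  define f' where "f' \<epsilon> x = - (2 * (V x + \<epsilon> * \<eta> x) * \<eta> x / (16 * of_real pi ^ 2)) * (1 - (ddx U x)^2 / h)" for \<epsilon> x
  have "((\<lambda>\<epsilon>. integral {0..l} (f \<epsilon>)) has_field_derivative integral {0..l} (f' 0)) (at 0)"
  proof (rule parameter_integral_DERIV[of 1])
    show "((\<lambda>\<epsilon>. f \<epsilon> x) has_field_derivative f' \<epsilon> x) (at \<epsilon>)" for \<epsilon> x
    proof -
      have "((\<lambda>\<epsilon>. (V x + \<epsilon> * \<eta> x)^2) has_field_derivative 2 * (V x + \<epsilon> * \<eta> x) * \<eta> x) (at \<epsilon>)"
        by (auto intro!: derivative_eq_intros)
      then have "((\<lambda>\<epsilon>. f \<epsilon> x) has_field_derivative f' \<epsilon> x + 0) (at \<epsilon>)"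
        unfolding f_def f'_def by (intro DERIV_add DERIV_const DERIV_cmult_right DERIV_minus DERIV_cdivide)
      then show ?thesis by simp
    qed
    show "continuous_on (ball 0 1 \<times> {0..l}) (\<lambda>p. f (fst p) (snd p))"
      unfolding f_def by (intro continuous_intros smooth_continuous_snd U V e c sm) (use h in auto)
    show "continuous_on (ball 0 1 \<times> {0..l}) (\<lambda>p. f' (fst p) (snd p))"
      unfolding f'_def by (intro continuous_intros smooth_continuous_snd U V e c sm) (use h in auto)
  qed simp
  moreover have "f' 0 = (\<lambda>x. - V x / (8 * of_real pi ^ 2) * (1 - (ddx U x)^2 / h) * \<eta> x)"
    by (simp add: f'_def fun_eq_iff)
  moreover have "H_CM \<tau> h l U (\<lambda>x. V x + \<epsilon> * \<eta> x) = integral {0..l} (f \<epsilon>)" for \<epsilon>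
    unfolding H_CM_def f_def c_def by (simp add: algebra_simps)
  ultimately show "((\<lambda>\<epsilon>. H_CM \<tau> h l U (\<lambda>x. V x + \<epsilon> * \<eta> x)) has_field_derivative
     integral {0..l} (\<lambda>x. - V x / (8 * of_real pi ^ 2) * (1 - (ddx U x)^2 / h) * \<eta> x)) (at 0)" by simp
qed

text \<open>The functional contains only h - U'^2; its root N comes in through N N' = -U' U'', which
  brings the result of the two integrations by parts required by U'' to the stated form.\<close>

lemma variation_u:
  assumes l: "l > 0" and h: "h \<noteq> 0"
    and U: "smooth_fun U" "\<And>x. U (x + l) = U x" and V: "smooth_fun V" "\<And>x. V (x + l) = V x"
    and N: "smooth_fun N" "\<And>x. N (x + l) = N x" "\<And>x. N x \<noteq> 0" "\<And>x. (N x)^2 = h - (ddx U x)^2"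
    and UL: "\<And>x. 2 * U x \<notin> \<Lambda>"
  shows "has_variational_derivative l (\<lambda>w. H_CM \<tau> h l w V) U
    (\<lambda>x. - (1 / (8 * of_real pi ^ 2 * h) * ddx (\<lambda>x. (V x)^2 * ddx U x) x
       - 2 * (3 * (ddx U x)^2 - h) * deriv (wp \<tau>) (2 * U x)
       + 6 * ddx (\<lambda>x. ddx U x * wp \<tau> (2 * U x)) x
       + 1/2 * ddx (\<lambda>x. (ddx (ddx (ddx U)) x * N x - ddx N x * ddx (ddx U) x) / (N x)^3) x))"
proof -
  define U1 where "U1 = ddx U"
  define U2 where "U2 = ddx U1"
  define U3 where "U3 = ddx U2"
  define N1 where "N1 = ddx N"
  define F1 where "F1 x = (V x)^2 * U1 x" for x
  define F2 where "F2 x = U1 x * wp \<tau> (2 * U x)" for x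
  define R where "R x = (U3 x * N x - N1 x * U2 x) / (N x)^3" for x
  define g where "g x = - (1 / (8 * of_real pi ^ 2 * h) * ddx F1 x
       - 2 * (3 * (U1 x)^2 - h) * deriv (wp \<tau>) (2 * U x) + 6 * ddx F2 x + 1/2 * ddx R x)" for x
  have sm: "smooth_fun U1" "smooth_fun U2" "smooth_fun U3" "smooth_fun N1"
    unfolding U1_def U2_def U3_def N1_def by (intro smooth_ddx U N)+
  have per: "U1 (x + l) = U1 x" "U2 (x + l) = U2 x" "U3 (x + l) = U3 x" "N1 (x + l) = N1 x" for x
  proof -
    show 1: "U1 (x + l) = U1 x" for x unfolding U1_def by (rule ddx_periodic[OF U(2,1)])
    show 2: "U2 (x + l) = U2 x" for x unfolding U2_def by (rule ddx_periodic[OF 1 sm(1)])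
    show "U3 (x + l) = U3 x" unfolding U3_def by (rule ddx_periodic[OF 2 sm(2)])
    show "N1 (x + l) = N1 x" unfolding N1_def by (rule ddx_periodic[OF N(2,1)])
  qed
  have wpU: "smooth_fun (\<lambda>x. wp \<tau> (2 * U x))"
    by (rule smooth_compose[of "\<lambda>x. 2 * U x" "wp \<tau>" "- \<Lambda>"]) (use UL in \<open>auto intro!: smooth_intros U wp_holomorphic\<close>)
  have wp'U: "smooth_fun (\<lambda>x. deriv (wp \<tau>) (2 * U x))"
    by (rule smooth_compose[of "\<lambda>x. 2 * U x" "deriv (wp \<tau>)" "- \<Lambda>"])
       (use UL in \<open>auto intro!: smooth_intros U holomorphic_deriv wp_holomorphic\<close>)
  have F: "smooth_fun F1" "smooth_fun F2" "smooth_fun R"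
    unfolding F1_def[abs_def] F2_def[abs_def] R_def[abs_def]
    by (intro smooth_intros U V N(1) sm wpU; simp add: N(3))+
  have Fper: "F1 (x + l) = F1 x" "F2 (x + l) = F2 x" "R (x + l) = R x" for x
    unfolding F1_def F2_def R_def by (simp_all add: per U(2) V(2) N(2))
  have g: "smooth_loop l g"
    unfolding smooth_loop_iff
  proof (intro conjI allI)
    show "smooth_fun g" unfolding g_def[abs_def] by (intro smooth_intros F sm wp'U; use h in simp)
    show "g (x + l) = g x" for x
      unfolding g_def using ddx_periodic[OF Fper(1) F(1)] ddx_periodic[OF Fper(2) F(2)] ddx_periodic[OF Fper(3) F(3)]
      by (simp add: per U(2))
  qed
  have N1: "N x * N1 x = - U1 x * U2 x" for x
  proof -
    have "((\<lambda>x. (N x)^2) has_vector_derivative 2 * N x * N1 x) (at x)"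
      unfolding N1_def by (rule has_vector_derivative_power2[OF smooth_has_ddx[OF N(1)]])
    moreover have "((\<lambda>x. (N x)^2) has_vector_derivative 0 - 2 * U1 x * U2 x) (at x)"
      unfolding N(4) U1_def[symmetric] U2_def
      by (intro has_vector_derivative_diff has_vector_derivative_const has_vector_derivative_power2 smooth_has_ddx sm)
    ultimately have "2 * N x * N1 x = 0 - 2 * U1 x * U2 x" by (rule vector_derivative_unique_at)
    then have "2 * (N x * N1 x) = 2 * (- U1 x * U2 x)" by (simp add: mult.assoc)
    then show ?thesis by (simp only: mult_cancel_left) simp
  qed
  have nzU: "h - (U1 x)^2 \<noteq> 0" for x using N(3)[of x] unfolding U1_def N(4)[symmetric] by simp
  have "((\<lambda>\<epsilon>. H_CM \<tau> h l (\<lambda>x. U x + \<epsilon> * \<eta> x) V) has_field_derivative integral {0..l} (\<lambda>x. g x * \<eta> x)) (at 0)"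
    if \<eta>: "smooth_loop l \<eta>" for \<eta>
  proof -
    have e: "smooth_fun \<eta>" and eper: "\<And>x. \<eta> (x + l) = \<eta> x" using \<eta> by (auto simp: smooth_loop_iff)
    define e1 where "e1 = ddx \<eta>"
    define e2 where "e2 = ddx e1"
    have sme: "smooth_fun e1" "smooth_fun e2" unfolding e1_def e2_def by (intro smooth_ddx e)+
    have e1per: "e1 (x + l) = e1 x" for x unfolding e1_def by (rule ddx_periodic[OF eper e])
    \<comment> \<open>G is the open set of pairs (\<epsilon>, x) at which the perturbed density has
      no singularity. It contains {0} \<times> [0,l], and compactness of [0,l] gives one radius
      \<delta> that works for all x.\<close>
    define G where "G = (\<lambda>p. 2 * (U (snd p) + fst p * \<eta> (snd p))) -` (- \<Lambda>) \<inter>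
      (\<lambda>p. h - (U1 (snd p) + fst p * e1 (snd p))^2) -` (- {0})"
    have "open G" unfolding G_def
      by (intro open_Int open_vimage open_nonlattice continuous_intros smooth_continuous_snd U e sm sme) auto
    moreover have "{0} \<times> {0..l} \<subseteq> G"
      using UL nzU by (auto simp: G_def)
    ultimately obtain X where X: "0 \<in> X" "open X" "X \<times> {0..l} \<subseteq> G"
      using Elementary_Topology.tube_lemma[of "{0..l}" G 0] by auto
    then obtain \<delta> where \<delta>: "\<delta> > 0" "ball 0 \<delta> \<subseteq> X" using open_contains_ball by blast
    have G: "2 * (U x + \<epsilon> * \<eta> x) \<notin> \<Lambda>" "h - (U1 x + \<epsilon> * e1 x)^2 \<noteq> 0" if "\<epsilon> \<in> ball 0 \<delta>" "x \<in> {0..l}" for \<epsilon> x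
    proof -
      have "(\<epsilon>, x) \<in> G" using that \<delta> X by blast
      then show "2 * (U x + \<epsilon> * \<eta> x) \<notin> \<Lambda>" "h - (U1 x + \<epsilon> * e1 x)^2 \<noteq> 0" unfolding G_def by auto
    qed
    define f where "f \<epsilon> x = - ((V x)^2 / (16 * of_real pi ^ 2)) * (1 - (U1 x + \<epsilon> * e1 x)^2 / h)
       + (3 * (U1 x + \<epsilon> * e1 x)^2 - h) * wp \<tau> (2 * (U x + \<epsilon> * \<eta> x))
       - (U2 x + \<epsilon> * e2 x)^2 / (4 * (h - (U1 x + \<epsilon> * e1 x)^2))" for \<epsilon> x
    define f' where "f' \<epsilon> x = (V x)^2 / (16 * of_real pi ^ 2) * (2 * (U1 x + \<epsilon> * e1 x) * e1 x / h)
       + (6 * (U1 x + \<epsilon> * e1 x) * e1 x * wp \<tau> (2 * (U x + \<epsilon> * \<eta> x))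
          + (3 * (U1 x + \<epsilon> * e1 x)^2 - h) * (deriv (wp \<tau>) (2 * (U x + \<epsilon> * \<eta> x)) * (2 * \<eta> x)))
       - (2 * (U2 x + \<epsilon> * e2 x) * e2 x / (4 * (h - (U1 x + \<epsilon> * e1 x)^2))
          + (U2 x + \<epsilon> * e2 x)^2 * (2 * (U1 x + \<epsilon> * e1 x) * e1 x) / (4 * (h - (U1 x + \<epsilon> * e1 x)^2)^2))" for \<epsilon> x
    have H: "H_CM \<tau> h l (\<lambda>x. U x + \<epsilon> * \<eta> x) V = integral {0..l} (f \<epsilon>)" for \<epsilon>
      unfolding H_CM_def f_def ddx_perturbed[OF U(1) e] U1_def[symmetric] e1_def[symmetric]
        ddx_perturbed[OF sm(1) sme(1)] U2_def[symmetric] e2_def[symmetric] ..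
    have wpc: "continuous_on (ball 0 \<delta> \<times> {0..l}) (\<lambda>p. wp \<tau> (2 * (U (snd p) + fst p * \<eta> (snd p))))"
      by (rule continuous_on_compose2[OF holomorphic_on_imp_continuous_on[OF wp_holomorphic]],
          intro continuous_intros smooth_continuous_snd U e) (use G in auto)
    have wp'c: "continuous_on (ball 0 \<delta> \<times> {0..l}) (\<lambda>p. deriv (wp \<tau>) (2 * (U (snd p) + fst p * \<eta> (snd p))))"
      by (rule continuous_on_compose2[OF holomorphic_on_imp_continuous_on[OF holomorphic_deriv[OF wp_holomorphic open_nonlattice]]],
          intro continuous_intros smooth_continuous_snd U e) (use G in auto)
    have "((\<lambda>\<epsilon>. integral {0..l} (f \<epsilon>)) has_field_derivative integral {0..l} (f' 0)) (at 0)"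
    proof (rule parameter_integral_DERIV[OF \<delta>(1)])
      show "continuous_on (ball 0 \<delta> \<times> {0..l}) (\<lambda>p. f (fst p) (snd p))"
        unfolding f_def by (intro continuous_intros smooth_continuous_snd U V e sm sme wpc) (use G h in auto)
      show "continuous_on (ball 0 \<delta> \<times> {0..l}) (\<lambda>p. f' (fst p) (snd p))"
        unfolding f'_def by (intro continuous_intros smooth_continuous_snd U V e sm sme wpc wp'c) (use G h in auto)
      fix \<epsilon> :: complex and x :: real assume *: "\<epsilon> \<in> ball 0 \<delta>" "x \<in> {0..l}"
      have b: "((\<lambda>\<epsilon>. (U1 x + \<epsilon> * e1 x)^2) has_field_derivative 2 * (U1 x + \<epsilon> * e1 x) * e1 x) (at \<epsilon>)"
        and c: "((\<lambda>\<epsilon>. (U2 x + \<epsilon> * e2 x)^2) has_field_derivative 2 * (U2 x + \<epsilon> * e2 x) * e2 x) (at \<epsilon>)"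
        by (auto intro!: derivative_eq_intros)
      have w: "((\<lambda>\<epsilon>. wp \<tau> (2 * (U x + \<epsilon> * \<eta> x))) has_field_derivative deriv (wp \<tau>) (2 * (U x + \<epsilon> * \<eta> x)) * (2 * \<eta> x)) (at \<epsilon>)"
        by (rule wp_DERIV) (use G * in \<open>auto intro!: derivative_eq_intros\<close>)
      have 1: "((\<lambda>\<epsilon>. - ((V x)^2 / (16 * of_real pi ^ 2)) * (1 - (U1 x + \<epsilon> * e1 x)^2 / h)) has_field_derivative
          (V x)^2 / (16 * of_real pi ^ 2) * (2 * (U1 x + \<epsilon> * e1 x) * e1 x / h)) (at \<epsilon>)"
      proof (rule DERIV_cong)
        show "((\<lambda>\<epsilon>. - ((V x)^2 / (16 * of_real pi ^ 2)) * (1 - (U1 x + \<epsilon> * e1 x)^2 / h)) has_field_derivative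
          - ((V x)^2 / (16 * of_real pi ^ 2)) * (0 - 2 * (U1 x + \<epsilon> * e1 x) * e1 x / h)) (at \<epsilon>)"
          by (intro DERIV_cmult DERIV_diff DERIV_const DERIV_cdivide b)
      qed (simp only: diff_0 mult_minus_left mult_minus_right minus_minus)
      have 2: "((\<lambda>\<epsilon>. (3 * (U1 x + \<epsilon> * e1 x)^2 - h) * wp \<tau> (2 * (U x + \<epsilon> * \<eta> x))) has_field_derivative
          (6 * (U1 x + \<epsilon> * e1 x) * e1 x * wp \<tau> (2 * (U x + \<epsilon> * \<eta> x))
          + (3 * (U1 x + \<epsilon> * e1 x)^2 - h) * (deriv (wp \<tau>) (2 * (U x + \<epsilon> * \<eta> x)) * (2 * \<eta> x)))) (at \<epsilon>)"
      proof (rule DERIV_cong)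
        show "((\<lambda>\<epsilon>. (3 * (U1 x + \<epsilon> * e1 x)^2 - h) * wp \<tau> (2 * (U x + \<epsilon> * \<eta> x))) has_field_derivative
          ((3 * (2 * (U1 x + \<epsilon> * e1 x) * e1 x) - 0) * wp \<tau> (2 * (U x + \<epsilon> * \<eta> x))
          + deriv (wp \<tau>) (2 * (U x + \<epsilon> * \<eta> x)) * (2 * \<eta> x) * (3 * (U1 x + \<epsilon> * e1 x)^2 - h))) (at \<epsilon>)"
          by (intro DERIV_mult DERIV_diff DERIV_cmult DERIV_const b w)
      qed (simp add: algebra_simps)
      have 3: "((\<lambda>\<epsilon>. (U2 x + \<epsilon> * e2 x)^2 / (4 * (h - (U1 x + \<epsilon> * e1 x)^2))) has_field_derivative
         (2 * (U2 x + \<epsilon> * e2 x) * e2 x / (4 * (h - (U1 x + \<epsilon> * e1 x)^2))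
          + (U2 x + \<epsilon> * e2 x)^2 * (2 * (U1 x + \<epsilon> * e1 x) * e1 x) / (4 * (h - (U1 x + \<epsilon> * e1 x)^2)^2))) (at \<epsilon>)"
      proof (rule DERIV_cong)
        let ?b = "h - (U1 x + \<epsilon> * e1 x)^2"
        have nz: "?b \<noteq> 0" using G * by auto
        show "((\<lambda>\<epsilon>. (U2 x + \<epsilon> * e2 x)^2 / (4 * (h - (U1 x + \<epsilon> * e1 x)^2))) has_field_derivative
          ((2 * (U2 x + \<epsilon> * e2 x) * e2 x) * (4 * ?b) - (U2 x + \<epsilon> * e2 x)^2 * (4 * (0 - 2 * (U1 x + \<epsilon> * e1 x) * e1 x))) / ((4 * ?b) * (4 * ?b))) (at \<epsilon>)"
          by (intro DERIV_divide DERIV_diff DERIV_cmult DERIV_const b c) (use nz in simp)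
        have "(A * (4 * B) - C * (4 * (0 - D))) / ((4 * B) * (4 * B)) = A / (4 * B) + C * D / (4 * B^2)" if "B \<noteq> 0" for A B C D :: complex
          using that by (simp add: field_simps power2_eq_square)
        from this[OF nz] show "((2 * (U2 x + \<epsilon> * e2 x) * e2 x) * (4 * ?b) - (U2 x + \<epsilon> * e2 x)^2 * (4 * (0 - 2 * (U1 x + \<epsilon> * e1 x) * e1 x))) / ((4 * ?b) * (4 * ?b)) =
          2 * (U2 x + \<epsilon> * e2 x) * e2 x / (4 * ?b) + (U2 x + \<epsilon> * e2 x)^2 * (2 * (U1 x + \<epsilon> * e1 x) * e1 x) / (4 * ?b^2)" .
      qed
      show "((\<lambda>\<epsilon>. f \<epsilon> x) has_field_derivative f' \<epsilon> x) (at \<epsilon>)"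
        unfolding f_def f'_def by (intro DERIV_add DERIV_diff 1 2 3)
    qed
    also have "integral {0..l} (f' 0) = integral {0..l} (\<lambda>x. g x * \<eta> x)"
    proof -
      \<comment> \<open>Integration by parts: the first variation and \<open>g \<eta>\<close> differ by the total derivative of \<open>W\<close>.\<close>
      define W where "W x = (1 / (8 * of_real pi ^ 2 * h) * F1 x + 6 * F2 x + 1/2 * R x) * \<eta> x - U2 x / (2 * (N x)^2) * e1 x" for x
      have W: "(W has_vector_derivative f' 0 x - g x * \<eta> x) (at x)" for x
      proof -
        have Q: "((\<lambda>x. U2 x / (2 * (N x)^2)) has_vector_derivative
           (U3 x * (2 * (N x)^2) - U2 x * (2 * (2 * N x * N1 x))) / (2 * (N x)^2)^2) (at x)"
          using has_vector_derivative_mult[OF has_vector_derivative_const has_vector_derivative_power2[OF smooth_has_ddx[OF N(1), of x]], of 2]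
          unfolding U3_def N1_def
          by (intro has_vector_derivative_divide_complex smooth_has_ddx sm) (simp_all add: N(3))
        have hc: "((\<lambda>x. c * f x) has_vector_derivative c * ddx f x) (at x)" if "smooth_fun f" for c f
          using has_vector_derivative_mult[OF has_vector_derivative_const smooth_has_ddx[OF that, of x], of c] by simp
        have "(W has_vector_derivative
            (1 / (8 * of_real pi ^ 2 * h) * F1 x + 6 * F2 x + 1/2 * R x) * e1 x +
            (1 / (8 * of_real pi ^ 2 * h) * ddx F1 x + 6 * ddx F2 x + 1/2 * ddx R x) * \<eta> x -
            (U2 x / (2 * (N x)^2) * e2 x +
             (U3 x * (2 * (N x)^2) - U2 x * (2 * (2 * N x * N1 x))) / (2 * (N x)^2)^2 * e1 x)) (at x)"
          unfolding W_def[abs_def] e1_def e2_def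
          by (intro has_vector_derivative_diff has_vector_derivative_mult has_vector_derivative_add hc F Q smooth_has_ddx e sme[unfolded e1_def])
        moreover have "(1 / (8 * of_real pi ^ 2 * h) * F1 x + 6 * F2 x + 1/2 * R x) * e1 x +
            (1 / (8 * of_real pi ^ 2 * h) * ddx F1 x + 6 * ddx F2 x + 1/2 * ddx R x) * \<eta> x -
            (U2 x / (2 * (N x)^2) * e2 x +
             (U3 x * (2 * (N x)^2) - U2 x * (2 * (2 * N x * N1 x))) / (2 * (N x)^2)^2 * e1 x) = f' 0 x - g x * \<eta> x"
        proof -
          \<comment> \<open>The last term of the density contributes -U2^2 U1 / (2 N^4) to the
            coefficient of \<eta>'. The relation N N' = -U1 U2 identifies this with R/2 minus the
            derivative of U2 / (2 N^2), exactly what the boundary function W produces.\<close>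
          have "R x / 2 - (U3 x * (2 * (N x)^2) - U2 x * (2 * (2 * N x * N1 x))) / (2 * (N x)^2)^2 = U2 x * (N x * N1 x) / (2 * (N x)^4)"
            unfolding R_def using N(3)[of x] by (simp add: field_simps power2_eq_square power3_eq_cube power4_eq_xxxx)
          also have "\<dots> = - ((U2 x)^2 * U1 x / (2 * (N x)^4))" unfolding N1 by (simp add: power2_eq_square mult_ac)
          finally have *: "1/2 * R x = (U3 x * (2 * (N x)^2) - U2 x * (2 * (2 * N x * N1 x))) / (2 * (N x)^2)^2
              - (U2 x)^2 * U1 x / (2 * (N x)^4)" by (simp add: algebra_simps)
          have n: "h - (U1 x)^2 = (N x)^2" using N(4)[of x] by (simp add: U1_def)
          have n4: "((N x)^2)^2 = (N x)^4" by (simp flip: power_mult)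
          have "a^2 / (16 * P) * (2 * b * e / h) = 1 / (8 * P * h) * (a^2 * b) * e" if "P \<noteq> 0" for a b e P :: complex
            using that h by (simp add: field_simps)
          from this[of "of_real pi ^ 2" "V x" "U1 x" "e1 x"]
          have t1: "(V x)^2 / (16 * of_real pi ^ 2) * (2 * U1 x * e1 x / h) = 1 / (8 * of_real pi ^ 2 * h) * F1 x * e1 x"
            unfolding F1_def by simp
          have f0: "f' 0 x = 1 / (8 * of_real pi ^ 2 * h) * F1 x * e1 x
              + (6 * F2 x * e1 x + (3 * (U1 x)^2 - h) * (deriv (wp \<tau>) (2 * U x) * (2 * \<eta> x)))
              - (U2 x / (2 * (N x)^2) * e2 x + (U2 x)^2 * U1 x / (2 * (N x)^4) * e1 x)"
            unfolding f'_def mult_zero_left add_0_right t1 n n4 F2_def by (simp add: mult_ac)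
          show ?thesis unfolding * f0 g_def by (simp add: algebra_simps)
        qed
        ultimately show ?thesis by simp
      qed
      have "W l = W 0"
        unfolding W_def using Fper[of 0] per[of 0] N(2)[of 0] eper[of 0] e1per[of 0] by simp
      from integral_total_derivative_loop[OF l W this]
      have "((\<lambda>x. f' 0 x - g x * \<eta> x) has_integral 0) {0..l}" .
      moreover have "(\<lambda>x. g x * \<eta> x) integrable_on {0..l}"
        using g by (intro integrable_continuous_real smooth_continuous smooth_mult e) (auto simp: smooth_loop_iff)
      ultimately have "((\<lambda>x. (f' 0 x - g x * \<eta> x) + g x * \<eta> x) has_integral 0 + integral {0..l} (\<lambda>x. g x * \<eta> x)) {0..l}"
        by (intro has_integral_add integrable_integral)
      then show ?thesis by (simp add: integral_unique)
    qed
    finally show ?thesis unfolding H .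
  qed
  then have "has_variational_derivative l (\<lambda>w. H_CM \<tau> h l w V) U g"
    using g by (simp add: has_variational_derivative_def)
  then show ?thesis
    unfolding g_def[abs_def] F1_def[abs_def] F2_def[abs_def] R_def[abs_def] U3_def U2_def U1_def N1_def .
qed

end

section \<open>The zero curvature equation\<close>

definition mat2 :: "complex \<Rightarrow> complex \<Rightarrow> complex \<Rightarrow> complex \<Rightarrow> complex^2^2" where
  "mat2 a b c d = vector [vector [a, b], vector [c, d]]"

lemma mat2_eq_iff: "mat2 a b c d = mat2 a' b' c' d' \<longleftrightarrow> a = a' \<and> b = b' \<and> c = c' \<and> d = d'"
  by (auto simp: mat2_def vec_eq_iff forall_2)

lemma mat2_arith:
  "mat2 a b c d + mat2 a' b' c' d' = mat2 (a + a') (b + b') (c + c') (d + d')"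
  "mat2 a b c d - mat2 a' b' c' d' = mat2 (a - a') (b - b') (c - c') (d - d')"
  "mat2 a b c d ** mat2 a' b' c' d' = mat2 (a * a' + b * c') (a * b' + b * d') (c * a' + d * c') (c * b' + d * d')"
  "r *\<^sub>R mat2 a b c d = mat2 (r *\<^sub>R a) (r *\<^sub>R b) (r *\<^sub>R c) (r *\<^sub>R d)"
  "mat2 0 0 0 0 = 0"
  by (simp_all add: mat2_def vec_eq_iff forall_2 matrix_matrix_mult_def sum_2)

lemma has_vector_derivative_mat2:
  assumes "(a has_vector_derivative a') (at x)" "(b has_vector_derivative b') (at x)"
    "(c has_vector_derivative c') (at x)" "(d has_vector_derivative d') (at x)"
  shows "((\<lambda>x. mat2 (a x) (b x) (c x) (d x)) has_vector_derivative mat2 a' b' c' d') (at x)"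
proof -
  have "linear (\<lambda>(a, b, c, d). mat2 a b c d)"
    by (auto intro!: linearI simp: mat2_arith)
  then have "bounded_linear (\<lambda>(a, b, c, d). mat2 a b c d)" by (simp add: linear_conv_bounded_linear)
  from bounded_linear.has_vector_derivative[OF this
      has_vector_derivative_Pair[OF assms(1) has_vector_derivative_Pair[OF assms(2) has_vector_derivative_Pair[OF assms(3,4)]]]]
  show ?thesis by simp
qed

text \<open>A commutator is traceless, so the fourth entry is the negative of the first and three
  scalar equations remain.\<close>

lemma zero_curvature_traceless_iff:
  "mat2 p q r (- p) - mat2 p' q' r' (- p') +
     (mat2 m n k (- m) ** mat2 a b c (- a) - mat2 a b c (- a) ** mat2 m n k (- m)) = 0 \<longleftrightarrow>
   p - p' + (n * c - b * k) = 0 \<and> q - q' + 2 * (m * b - a * n) = 0 \<and> r - r' + 2 * (- m * c + a * k) = 0"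
  unfolding mat2_arith(1-3) mat2_arith(5)[symmetric] mat2_eq_iff
  by (auto simp: algebra_simps)

text \<open>Algebra for the upper right entry, with point values as independent variables: p, p',
  p'' are phi and its derivatives in w, e is E1(z), and W, Wz are wp at w and z. The Lame equation
  eliminates p'', and the constraint on \<nu> eliminates nx and nt; what survives is the defect of
  the u equation and its x-derivative. Since \<kappa>^2 = -1/(16 pi^2) in the application, the
  constant \<kappa> can stay symbolic.\<close>

lemma off_diagonal_curvature:
  fixes n h :: complex
  assumes n: "n \<noteq> 0" and h: "h \<noteq> 0" and n2: "n^2 = h - ux^2"
    and nx: "n * nx = - (ux * uxx)" and nt: "n * nt = - (ux * uxt)"
    and p'': "p'' = 2 * e * p' + (2 * W + Wz - e^2) * p"
  shows "(nt * p + n * (2 * ut * p'))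
     - (- 2 * \<kappa> * (nx * p' + n * (2 * ux * p''))
        + (2 * \<kappa> * e * nx - 2 * \<kappa>^2 / h * (vx * ux * n + v * uxx * n + v * ux * nx) - \<kappa> * ((uxxx * n - uxx * nx) / n^2)) * p
        + (2 * \<kappa> * e * n - 2 * \<kappa>^2 / h * (v * ux * n) - \<kappa> * (uxx / n)) * (2 * ux * p'))
     + 2 * ((- ut * e - \<kappa> * (- 2 * \<kappa>^2 / h * (v^2 * ux) + 6 * (ux * W) + 1/2 * ((uxxx * n - nx * uxx) / n^3)) + 2 * \<kappa> * ux * (W - Wz)) * (n * p)
        - (- \<kappa> * v - ux * e) * (- 2 * \<kappa> * n * p' + (2 * \<kappa> * e * n - 2 * \<kappa>^2 / h * (v * ux * n) - \<kappa> * (uxx / n)) * p))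
    = - (ux * (uxt - 2 * \<kappa>^2 / h * (vx * n^2 + 2 * v * (n * nx))) / n) * p
      + 2 * n * (ut - 2 * \<kappa>^2 * v * (n^2 / h)) * (p' - e * p)"
proof -
  \<comment> \<open>Naming the inverses of n and h makes both sides polynomials, so their equality
    can be certified by ideal membership.\<close>
  define q where "q = 1 / n"
  define g where "g = 1 / h"
  have qn: "q * n = 1" "n * q = 1" and gh: "g * h = 1" using n h by (simp_all add: q_def g_def)
  have nx': "nx = - (ux * uxx * q)" and nt': "nt = - (ux * uxt * q)"
    using nx nt n by (simp_all add: q_def field_simps)
  have r: "x / n = x * q" "x / h = x * g" "x / n^2 = x * q^2" "x / n^3 = x * q^3" for x
    by (simp_all add: q_def g_def power_divide)
  have h': "h = n^2 + ux^2" using n2 by simp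
  have one: "g * (n^2 + ux^2) = 1" using gh h' by simp
  \<comment> \<open>The explicit combination below certifies that the difference of the two sides lies in the ideal
    generated by \<open>I1\<close> and \<open>I2\<close>.\<close>
  define I1 where "I1 = q * n - 1"
  define I2 where "I2 = g * (n^2 + ux^2) - 1"
  have I: "I1 = 0" "I2 = 0" using qn one by (simp_all add: I1_def I2_def)
  let ?X = "uxxx * n + uxx * (ux * uxx * q)"
  have id: "A - B = 0 \<Longrightarrow> A = B" for A B :: complex by simp
  show ?thesis
    unfolding r p'' nx' nt'
  proof (rule id, rule trans)
    show "4 * \<kappa>^2 * v * n * I2 * p' + (- 4 * \<kappa>^2 * v * n * e * I2 - \<kappa> * ?X * q^2 * I1 - 2 * \<kappa>^2 * g * vx * ux * n * I1
      + 2 * \<kappa>^2 * v * uxx * (q * I2 + (2 * g * ux^2 * q - g * n) * I1)) * p = 0"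
      unfolding I by simp
  qed (simp add: I1_def I2_def algebra_simps power2_eq_square power3_eq_cube)
qed


context upper_half begin

section \<open>Derivatives of the entries of L and M, and their curvature\<close>

lemma scaled_phi_has_vector_derivative:
  assumes "(f has_vector_derivative f') (at x)" "c * f x \<notin> \<Lambda>"
  shows "((\<lambda>s. phi \<tau> (c * f s) z) has_vector_derivative c * f' * phi' \<tau> (c * f x) z) (at x)"
    and "((\<lambda>s. phi' \<tau> (c * f s) z) has_vector_derivative c * f' * phi'' (c * f x) z) (at x)"
proof -
  have "((\<lambda>s. c * f s) has_vector_derivative c * f') (at x)"
    using has_vector_derivative_mult[OF has_vector_derivative_const assms(1)] by simp
  from has_vector_derivative_holomorphic_compose[OF this phi_DERIV[OF assms(2)]]
    has_vector_derivative_holomorphic_compose[OF this phi'_DERIV[OF assms(2)]]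
  show "((\<lambda>s. phi \<tau> (c * f s) z) has_vector_derivative c * f' * phi' \<tau> (c * f x) z) (at x)"
    "((\<lambda>s. phi' \<tau> (c * f s) z) has_vector_derivative c * f' * phi'' (c * f x) z) (at x)" .
qed

text \<open>One computation for both entries: c is 2 or -2 and \<sigma> is \<kappa> or -\<kappa>,
  while e stands for E1(z) and k for 2 \<kappa>^2 / h.\<close>

lemma off_diagonal_M_has_vector_derivative:
  fixes N U V U1 U2 :: "real \<Rightarrow> complex"
  assumes "(U has_vector_derivative U1 x) (at x)" "(U1 has_vector_derivative U2 x) (at x)"
    "(U2 has_vector_derivative U3) (at x)" "(V has_vector_derivative V1) (at x)" "(N has_vector_derivative N1) (at x)"
    and n: "N x \<noteq> 0" and c: "c * U x \<notin> \<Lambda>"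
  shows "((\<lambda>s. - 2 * \<kappa> * (N s * phi' \<tau> (c * U s) z)
        + (2 * \<kappa> * e * N s - k * (V s * U1 s * N s) - \<sigma> * (U2 s / N s)) * phi \<tau> (c * U s) z) has_vector_derivative
      - 2 * \<kappa> * (N x * (c * U1 x * phi'' (c * U x) z) + N1 * phi' \<tau> (c * U x) z)
      + ((2 * \<kappa> * e * N x - k * (V x * U1 x * N x) - \<sigma> * (U2 x / N x)) * (c * U1 x * phi' \<tau> (c * U x) z)
        + (2 * \<kappa> * e * N1 - k * (V x * U1 x * N1 + (V x * U2 x + V1 * U1 x) * N x) - \<sigma> * ((U3 * N x - U2 x * N1) / (N x)^2)) * phi \<tau> (c * U x) z)) (at x)"
proof -
  have cm: "((\<lambda>s. a * f s) has_vector_derivative a * f') (at x)" if "(f has_vector_derivative f') (at x)" for a f' and f :: "real \<Rightarrow> complex"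
    using has_vector_derivative_mult[OF has_vector_derivative_const that, of a] by simp
  show ?thesis
    by (intro has_vector_derivative_add has_vector_derivative_diff has_vector_derivative_mult cm
      scaled_phi_has_vector_derivative has_vector_derivative_divide_complex assms)
qed

text \<open>At one point and one z, D and its x-derivative D' are independent numbers, so the
  equivalence stops at linear conditions on them. The diagonal condition does not involve z and is
  already the v equation.\<close>

lemma zero_curvature_iff:
  fixes x t :: real
  assumes h: "h \<noteq> 0" and T: "open T" "t \<in> T"
    and u: "smooth_field T u" and v: "smooth_field T v" and \<nu>: "smooth_field T \<nu>"
    and \<nu>2: "\<And>x t. t \<in> T \<Longrightarrow> (\<nu> x t)^2 = h - (Dx u x t)^2"
    and \<nu>0: "\<And>x t. t \<in> T \<Longrightarrow> \<nu> x t \<noteq> 0"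
    and uL: "\<And>x t. t \<in> T \<Longrightarrow> 2 * u x t \<notin> \<Lambda>"
    and z: "z \<notin> \<Lambda>"
  defines "D \<equiv> Dt u x t - CM_rhs_u h u v x t"
    and "D' \<equiv> Dx (Dt u) x t - Dx (CM_rhs_u h u v) x t"
  shows "Dt (CM_L \<tau> u v \<nu> z) x t - Dx (CM_M \<tau> h u v \<nu> z) x t
          + (CM_M \<tau> h u v \<nu> z x t ** CM_L \<tau> u v \<nu> z x t
             - CM_L \<tau> u v \<nu> z x t ** CM_M \<tau> h u v \<nu> z x t) = 0 \<longleftrightarrow>
     Dt v x t = CM_rhs_v \<tau> h u v \<nu> x t \<and>
     - (Dx u x t * D' / \<nu> x t) * phi \<tau> (2 * u x t) z + 2 * \<nu> x t * D * (phi' \<tau> (2 * u x t) z - E1 \<tau> z * phi \<tau> (2 * u x t) z) = 0 \<and>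
     - (Dx u x t * D' / \<nu> x t) * phi \<tau> (- 2 * u x t) z - 2 * \<nu> x t * D * (phi' \<tau> (- 2 * u x t) z - E1 \<tau> z * phi \<tau> (- 2 * u x t) z) = 0"
proof -
  \<comment> \<open>All constants of L, M and the equations become multiples of powers of \<kappa>;
    in particular 1/(8 pi^2) = -2 \<kappa>^2.\<close>
  define \<kappa> :: complex where "\<kappa> = 1 / (4 * of_real pi * \<i>)"
  have \<kappa>: "\<kappa> \<noteq> 0" by (simp add: \<kappa>_def)
  have k1: "y / (2 * of_real pi * \<i>) = 2 * \<kappa> * y" and k2: "y / (4 * of_real pi * \<i>) = \<kappa> * y"
    and k3: "y / (8 * of_real pi ^ 2 * h) = - 2 * \<kappa>^2 / h * y" and k4: "y / (8 * of_real pi ^ 2) = - 2 * \<kappa>^2 * y" for y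
    using h by (simp_all add: \<kappa>_def power_divide power_mult_distrib)
  have k5: "y / (2 * m) = 1/2 * (y / m)" for y m :: complex by simp
  define e where "e = E1 \<tau> z"
  define F1 where "F1 x = (v x t)^2 * Dx u x t" for x
  define F2 where "F2 x = Dx u x t * wp \<tau> (2 * u x t)" for x
  define R where "R x = (Dx (Dx (Dx u)) x t * \<nu> x t - Dx \<nu> x t * Dx (Dx u) x t) / (\<nu> x t)^3" for x
  define L11 where "L11 x t = - \<kappa> * v x t - Dx u x t * e" for x t
  define L12 where "L12 c x t = \<nu> x t * phi \<tau> (c * u x t) z" for c x t
  define M11 where "M11 x = - Dt u x t * e - \<kappa> * (- 2 * \<kappa>^2 / h * F1 x + 6 * F2 x + 1/2 * R x)
     + 2 * \<kappa> * (Dx u x t * (E2 \<tau> (2 * u x t) - E2 \<tau> z))" for x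
  define M12 where "M12 c \<sigma> x = - 2 * \<kappa> * (\<nu> x t * phi' \<tau> (c * u x t) z)
     + (2 * \<kappa> * e * \<nu> x t - 2 * \<kappa>^2 / h * (v x t * Dx u x t * \<nu> x t) - \<sigma> * (Dx (Dx u) x t / \<nu> x t)) * phi \<tau> (c * u x t) z" for c \<sigma> x
  have CM_L: "CM_L \<tau> u v \<nu> z x t = mat2 (L11 x t) (L12 2 x t) (L12 (- 2) x t) (- L11 x t)" for x t
    unfolding CM_L_def Let_def mat2_def[symmetric] k2 L11_def L12_def e_def by simp
  have CM_M: "CM_M \<tau> h u v \<nu> z x t = mat2 (M11 x) (M12 2 \<kappa> x) (M12 (- 2) (- \<kappa>) x) (- M11 x)" for x
    unfolding CM_M_def Let_def mat2_def[symmetric] k1 k2 k3 k5 M11_def M12_def F1_def F2_def R_def e_def mat2_eq_iff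
    by (simp add: algebra_simps)
  define ux where "ux = Dx u x t"
  define uxx where "uxx = Dx (Dx u) x t"
  define uxxx where "uxxx = Dx (Dx (Dx u)) x t"
  define n where "n = \<nu> x t"
  define nx where "nx = Dx \<nu> x t"
  define nt where "nt = Dt \<nu> x t"
  define ut where "ut = Dt u x t"
  define uxt where "uxt = Dx (Dt u) x t"
  define vx where "vx = Dx v x t"
  define w where "w = 2 * u x t"
  note u1 = smooth_field_Dx[OF u] and u2 = smooth_field_Dx[OF smooth_field_Dx[OF u]]
  note dx = smooth_field_Dx_DERIV[OF _ T(2)] and dt = smooth_field_Dt_DERIV[OF _ T(2)]
  have sf: "smooth_fun (\<lambda>x. f x t)" if "smooth_field T f" for f
    using that T(2) by (rule smooth_field_smooth_fun)
  have cm: "((\<lambda>s. a * f s) has_vector_derivative a * f') F" if "(f has_vector_derivative f') F" for a f' F and f :: "real \<Rightarrow> complex"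
    using bounded_linear.has_vector_derivative[OF bounded_linear_mult_right that] .
  have cmr: "((\<lambda>s. f s * a) has_vector_derivative f' * a) F" if "(f has_vector_derivative f') F" for a f' F and f :: "real \<Rightarrow> complex"
    using bounded_linear.has_vector_derivative[OF bounded_linear_mult_left that] .
  have wL: "w \<notin> \<Lambda>" unfolding w_def by (rule uL[OF T(2)])
  have cw: "2 * u x t \<notin> \<Lambda>" "- 2 * u x t \<notin> \<Lambda>"
    using wL lattice_minus_iff[of w] by (simp_all add: w_def)
  have n0: "n \<noteq> 0" and n2: "n^2 = h - ux^2" unfolding n_def ux_def by (simp_all add: \<nu>0[OF T(2)] \<nu>2[OF T(2)])
  have nx: "n * nx = - (ux * uxx)"
  proof -
    have "((\<lambda>x. (\<nu> x t)^2) has_vector_derivative 2 * n * nx) (at x)"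
      unfolding n_def nx_def by (rule has_vector_derivative_power2[OF dx[OF \<nu>]])
    moreover have "((\<lambda>x. (\<nu> x t)^2) has_vector_derivative 0 - 2 * ux * uxx) (at x)"
      unfolding \<nu>2[OF T(2)] ux_def uxx_def
      by (intro has_vector_derivative_diff has_vector_derivative_const has_vector_derivative_power2 dx[OF u1])
    ultimately have "2 * n * nx = 0 - 2 * ux * uxx" by (rule vector_derivative_unique_at)
    then have "2 * (n * nx) = 2 * - (ux * uxx)" by (simp add: mult.assoc)
    then show ?thesis by (simp only: mult_cancel_left) simp
  qed
  \<comment> \<open>L_t contains u_xt as the time derivative of u_x, M_x contains it as the
    x-derivative of u_t. Their equality cancels the E1(z) terms on the diagonal.\<close>
  have ut_x: "Dt (Dx u) x t = uxt" unfolding uxt_def by (rule smooth_field_Dt_Dx[OF u T])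
  have nt: "n * nt = - (ux * uxt)"
  proof -
    have "((\<lambda>r. (\<nu> x r)^2) has_vector_derivative 2 * n * nt) (at t)"
      unfolding n_def nt_def by (rule has_vector_derivative_power2[OF dt[OF \<nu>]])
    moreover have "((\<lambda>r. (\<nu> x r)^2) has_vector_derivative 0 - 2 * ux * uxt) (at t)"
    \<comment> \<open>The constraint is known only for times in T, so openness of T is what permits
      differentiating it in t.\<close>
    proof (rule has_vector_derivative_transform_within_open[OF _ T])
      show "((\<lambda>r. h - (Dx u x r)^2) has_vector_derivative 0 - 2 * ux * uxt) (at t)"
        unfolding ux_def ut_x[symmetric]
        by (intro has_vector_derivative_diff has_vector_derivative_const has_vector_derivative_power2 dt[OF u1])
    qed (simp add: \<nu>2)
    ultimately have "2 * n * nt = 0 - 2 * ux * uxt" by (rule vector_derivative_unique_at)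
    then have "2 * (n * nt) = 2 * - (ux * uxt)" by (simp add: mult.assoc)
    then show ?thesis by (simp only: mult_cancel_left) simp
  qed
  have rhs_u: "CM_rhs_u h u v x t = 2 * \<kappa>^2 * v x t * ((\<nu> x t)^2 / h)" for x
    unfolding CM_rhs_u_def k4 \<nu>2[OF T(2)] using h by (simp add: diff_divide_distrib)
  have D: "D = ut - 2 * \<kappa>^2 * v x t * (n^2 / h)" unfolding D_def rhs_u ut_def n_def ..
  have D': "D' = uxt - 2 * \<kappa>^2 / h * (vx * n^2 + 2 * v x t * (n * nx))"
  proof -
    have "((\<lambda>x. 2 * \<kappa>^2 / h * (v x t * (\<nu> x t)^2)) has_vector_derivative
        2 * \<kappa>^2 / h * (v x t * (2 * n * nx) + vx * n^2)) (at x)"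
      unfolding n_def nx_def vx_def
      by (intro cm has_vector_derivative_mult has_vector_derivative_power2 dx v \<nu>)
    moreover have "(\<lambda>x. 2 * \<kappa>^2 / h * (v x t * (\<nu> x t)^2)) = (\<lambda>x. CM_rhs_u h u v x t)"
      unfolding rhs_u by (simp add: mult.assoc)
    ultimately have "Dx (CM_rhs_u h u v) x t = 2 * \<kappa>^2 / h * (v x t * (2 * n * nx) + vx * n^2)"
      unfolding Dx_def by (simp add: vector_derivative_at)
    then show ?thesis unfolding D'_def uxt_def by (simp add: algebra_simps)
  qed
  have F: "(F1 has_vector_derivative ddx F1 x) (at x)" "(F2 has_vector_derivative ddx F2 x) (at x)" "(R has_vector_derivative ddx R x) (at x)"
  proof -
    have "smooth_fun (\<lambda>x. wp \<tau> (2 * u x t))"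
      by (rule smooth_compose[of "\<lambda>x. 2 * u x t" "wp \<tau>" "- \<Lambda>"])
         (use uL[OF T(2)] in \<open>auto intro!: smooth_intros sf[OF u] wp_holomorphic\<close>)
    then show "(F2 has_vector_derivative ddx F2 x) (at x)"
      unfolding F2_def[abs_def] by (intro smooth_has_ddx smooth_mult sf[OF u1])
    show "(F1 has_vector_derivative ddx F1 x) (at x)"
      unfolding F1_def[abs_def] by (intro smooth_has_ddx smooth_mult smooth_power sf[OF u1] sf[OF v])
    show "(R has_vector_derivative ddx R x) (at x)"
      unfolding R_def[abs_def]
      by (intro smooth_has_ddx smooth_mult smooth_divide smooth_diff smooth_power sf[OF \<nu>] sf[OF u2]
          sf[OF smooth_field_Dx[OF u2]] sf[OF smooth_field_Dx[OF \<nu>]]) (simp add: \<nu>0[OF T(2)])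
  qed
  have rhs_v: "CM_rhs_v \<tau> h u v \<nu> x t = - 2 * \<kappa>^2 / h * ddx F1 x - 2 * (3 * ux^2 - h) * deriv (wp \<tau>) w + 6 * ddx F2 x + 1/2 * ddx R x"
    unfolding CM_rhs_v_def k3 F1_def[abs_def] F2_def[abs_def] R_def[abs_def] Dx_eq_ddx[of "\<lambda>x t. (v x t)^2 * Dx u x t"]
      Dx_eq_ddx[of "\<lambda>x t. Dx u x t * wp \<tau> (2 * u x t)"]
      Dx_eq_ddx[of "\<lambda>x t. (Dx (Dx (Dx u)) x t * \<nu> x t - Dx \<nu> x t * Dx (Dx u) x t) / (\<nu> x t)^3"] ux_def w_def
    by simp
  have L11t: "((\<lambda>r. L11 x r) has_vector_derivative - \<kappa> * Dt v x t - uxt * e) (at t)"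
    unfolding L11_def ut_x[symmetric]
    by (intro has_vector_derivative_diff cm cmr dt[OF v] dt[OF u1])
  have L12t: "((\<lambda>r. L12 c x r) has_vector_derivative n * (c * ut * phi' \<tau> (c * u x t) z) + nt * phi \<tau> (c * u x t) z) (at t)"
    if "c * u x t \<notin> \<Lambda>" for c
    unfolding L12_def n_def nt_def ut_def
    by (intro has_vector_derivative_mult scaled_phi_has_vector_derivative dt \<nu> u that)
  have M11x: "(M11 has_vector_derivative - uxt * e - \<kappa> * (- 2 * \<kappa>^2 / h * ddx F1 x + 6 * ddx F2 x + 1/2 * ddx R x)
     + 2 * \<kappa> * (ux * (2 * ux * deriv (wp \<tau>) w) + uxx * (E2 \<tau> w - E2 \<tau> z))) (at x)"
  proof -
    have "((\<lambda>x. 2 * u x t) has_vector_derivative 2 * ux) (at x)"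
      unfolding ux_def by (intro cm dx u)
    moreover have "(E2 \<tau> has_field_derivative deriv (wp \<tau>) w) (at (2 * u x t))"
      using E2_DERIV[OF DERIV_ident, of w UNIV] wL by (simp add: w_def)
    ultimately have E: "((\<lambda>x. E2 \<tau> (2 * u x t)) has_vector_derivative 2 * ux * deriv (wp \<tau>) w) (at x)"
      by (rule has_vector_derivative_holomorphic_compose)
    have E': "((\<lambda>x. Dx u x t * (E2 \<tau> (2 * u x t) - E2 \<tau> z)) has_vector_derivative
       ux * (2 * ux * deriv (wp \<tau>) w) + uxx * (E2 \<tau> w - E2 \<tau> z)) (at x)"
      using has_vector_derivative_mult[OF dx[OF u1] has_vector_derivative_diff[OF E has_vector_derivative_const]]
      by (simp add: ux_def uxx_def w_def)
    have U: "((\<lambda>x. - Dt u x t * e) has_vector_derivative - uxt * e) (at x)"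
      unfolding uxt_def by (intro cmr has_vector_derivative_minus dx smooth_field_Dt u)
    show ?thesis unfolding M11_def[abs_def]
      by (intro has_vector_derivative_add has_vector_derivative_diff U E' cm F)
  qed
  have M12x: "(M12 c \<sigma> has_vector_derivative
      - 2 * \<kappa> * (n * (c * ux * phi'' (c * u x t) z) + nx * phi' \<tau> (c * u x t) z)
      + ((2 * \<kappa> * e * n - 2 * \<kappa>^2 / h * (v x t * ux * n) - \<sigma> * (uxx / n)) * (c * ux * phi' \<tau> (c * u x t) z)
        + (2 * \<kappa> * e * nx - 2 * \<kappa>^2 / h * (v x t * ux * nx + (v x t * uxx + vx * ux) * n) - \<sigma> * ((uxxx * n - uxx * nx) / n^2)) * phi \<tau> (c * u x t) z)) (at x)"
    if "c * u x t \<notin> \<Lambda>" for c \<sigma>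
    unfolding M12_def[abs_def] n_def nx_def ux_def uxx_def uxxx_def vx_def
    by (rule off_diagonal_M_has_vector_derivative) (intro dx u u1 u2 v \<nu> \<nu>0 T that)+
  have DtL: "Dt (CM_L \<tau> u v \<nu> z) x t = mat2 (- \<kappa> * Dt v x t - uxt * e)
      (n * (2 * ut * phi' \<tau> (2 * u x t) z) + nt * phi \<tau> (2 * u x t) z)
      (n * (- 2 * ut * phi' \<tau> (- 2 * u x t) z) + nt * phi \<tau> (- 2 * u x t) z) (- (- \<kappa> * Dt v x t - uxt * e))"
    unfolding Dt_def[of "CM_L \<tau> u v \<nu> z"] CM_L
    by (intro vector_derivative_at has_vector_derivative_mat2 has_vector_derivative_minus L11t L12t cw)
  note DxM = vector_derivative_at[OF has_vector_derivative_mat2[OF M11x M12x[OF cw(1), of \<kappa>] M12x[OF cw(2), of "- \<kappa>"] has_vector_derivative_minus[OF M11x]]]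
  define P where "P = phi \<tau> w z"
  define P' where "P' = phi' \<tau> w z"
  define Q where "Q = phi \<tau> (- w) z"
  define Q' where "Q' = phi' \<tau> (- w) z"
  have m2: "- 2 * u x t = - w" by (simp add: w_def)
  have EW: "E2 \<tau> w - E2 \<tau> z = wp \<tau> w - wp \<tau> z" using wL z by (simp add: wp_eq_E2)
  have pp: "phi'' w z = 2 * e * P' + (2 * wp \<tau> w + wp \<tau> z - e^2) * P"
    unfolding e_def P_def P'_def by (rule phi''_eq[OF wL z])
  have pm: "phi'' (- w) z = 2 * e * Q' + (2 * wp \<tau> w + wp \<tau> z - e^2) * Q"
    using phi''_eq[of "- w" z] wL z unfolding e_def Q_def Q'_def by simp
  have PQ: "P * Q = wp \<tau> z - wp \<tau> w" unfolding P_def Q_def by (rule phi_mult_phi_minus[OF wL z])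
  have wr: "P' * Q - P * Q' = - deriv (wp \<tau>) w" unfolding P_def Q_def P'_def Q'_def by (rule phi_wronskian[OF wL z])
  have M11: "M11 x = - ut * e - \<kappa> * (- 2 * \<kappa>^2 / h * ((v x t)^2 * ux) + 6 * (ux * wp \<tau> w) + 1/2 * ((uxxx * n - nx * uxx) / n^3)) + 2 * \<kappa> * ux * (wp \<tau> w - wp \<tau> z)"
    unfolding M11_def F1_def F2_def R_def EW[symmetric]
    by (simp add: w_def ux_def uxx_def uxxx_def n_def nx_def ut_def)
  have L11: "L11 x t = - \<kappa> * v x t - ux * e" by (simp add: L11_def ux_def)
  have L12: "L12 2 x t = n * P" "L12 (- 2) x t = n * Q"
    unfolding L12_def m2 by (simp_all add: P_def Q_def n_def w_def)
  have M12: "M12 2 \<kappa> x = - 2 * \<kappa> * n * P' + (2 * \<kappa> * e * n - 2 * \<kappa>^2 / h * (v x t * ux * n) - \<kappa> * (uxx / n)) * P"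
    "M12 (- 2) (- \<kappa>) x = - 2 * \<kappa> * n * Q' + (2 * \<kappa> * e * n - 2 * \<kappa>^2 / h * (v x t * ux * n) + \<kappa> * (uxx / n)) * Q"
    unfolding M12_def m2 by (simp_all add: P_def Q_def P'_def Q'_def n_def w_def ux_def uxx_def)
  have c11: "(- \<kappa> * Dt v x t - uxt * e) - (- uxt * e - \<kappa> * (- 2 * \<kappa>^2 / h * ddx F1 x + 6 * ddx F2 x + 1/2 * ddx R x)
       + 2 * \<kappa> * (ux * (2 * ux * deriv (wp \<tau>) w) + uxx * (E2 \<tau> w - E2 \<tau> z)))
     + (M12 2 \<kappa> x * L12 (- 2) x t - L12 2 x t * M12 (- 2) (- \<kappa>) x) = - \<kappa> * (Dt v x t - CM_rhs_v \<tau> h u v \<nu> x t)"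
  proof -
    \<comment> \<open>The coefficients containing E1(z) and v are common to both entries and cancel;
      the Wronskian and the product phi(w,z) phi(-w,z) remain.\<close>
    have "M12 2 \<kappa> x * L12 (- 2) x t - L12 2 x t * M12 (- 2) (- \<kappa>) x =
       - 2 * \<kappa> * n^2 * (P' * Q - P * Q') - 2 * \<kappa> * uxx * (P * Q)"
      unfolding M12 L12 using n0 by (simp add: algebra_simps power2_eq_square)
    also have "\<dots> = 2 * \<kappa> * (h - ux^2) * deriv (wp \<tau>) w + 2 * \<kappa> * uxx * (wp \<tau> w - wp \<tau> z)"
      unfolding wr PQ n2 by (simp add: algebra_simps)
    finally show ?thesis unfolding rhs_v EW by (simp add: algebra_simps power2_eq_square)
  qed
  have c12: "n * (2 * ut * P') + nt * P
     - (- 2 * \<kappa> * (n * (2 * ux * phi'' w z) + nx * P')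
        + ((2 * \<kappa> * e * n - 2 * \<kappa>^2 / h * (v x t * ux * n) - \<kappa> * (uxx / n)) * (2 * ux * P')
        + (2 * \<kappa> * e * nx - 2 * \<kappa>^2 / h * (v x t * ux * nx + (v x t * uxx + vx * ux) * n) - \<kappa> * ((uxxx * n - uxx * nx) / n^2)) * P))
     + 2 * (M11 x * L12 2 x t - L11 x t * M12 2 \<kappa> x)
     = - (ux * D' / n) * P + 2 * n * D * (P' - e * P)"
    unfolding M11 L11 L12 M12 D D'
    by (rule trans[OF _ off_diagonal_curvature[OF n0 h n2 nx nt pp]]) (simp add: algebra_simps)
  have c21: "n * (- 2 * ut * Q') + nt * Q
     - (- 2 * \<kappa> * (n * (- 2 * ux * phi'' (- w) z) + nx * Q')
        + ((2 * \<kappa> * e * n - 2 * \<kappa>^2 / h * (v x t * ux * n) - - \<kappa> * (uxx / n)) * (- 2 * ux * Q')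
        + (2 * \<kappa> * e * nx - 2 * \<kappa>^2 / h * (v x t * ux * nx + (v x t * uxx + vx * ux) * n) - - \<kappa> * ((uxxx * n - uxx * nx) / n^2)) * Q))
     + 2 * (- M11 x * L12 (- 2) x t + L11 x t * M12 (- 2) (- \<kappa>) x)
     = - (ux * D' / n) * Q - 2 * n * D * (Q' - e * Q)"
  proof -
    \<comment> \<open>The lower left entry is the upper right one with w, v and all derivatives of u
      and v negated, while \<nu> and \<kappa> stay fixed; D and D' change sign.\<close>
    have "n^2 = h - (- ux)^2" "n * nx = - (- ux * - uxx)" "n * nt = - (- ux * - uxt)" using n2 nx nt by simp_all
    note off = off_diagonal_curvature[OF n0 h this pm, where \<kappa> = \<kappa> and v = "- v x t" and vx = "- vx" and uxxx = "- uxxx" and ut = "- ut"]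
    show ?thesis
      unfolding M11 L11 L12 M12 D D'
      by (rule trans[OF _ trans[OF off]]) (simp_all add: algebra_simps diff_divide_distrib add_divide_distrib)
  qed
  show ?thesis
    unfolding DtL Dx_def[of "CM_M \<tau> h u v \<nu> z"] CM_M DxM CM_L zero_curvature_traceless_iff c11
    unfolding m2 w_def[symmetric] P_def[symmetric] P'_def[symmetric] Q_def[symmetric] Q'_def[symmetric]
      c12 c21 e_def[symmetric] ux_def[symmetric] n_def[symmetric]
    using \<kappa> by simp
qed

end

section \<open>Equations of motion, Hamilton's equations and zero curvature\<close>

theorem mainTheorem5:
  fixes \<tau> h :: complex
    and l :: real
    and T :: "real set"
    and u v \<nu> :: "real \<Rightarrow> real \<Rightarrow> complex"
  assumes "Im \<tau> > 0" and "h \<noteq> 0" and "l > 0" and "open T"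
    and "smooth_circle_field l T u"
    and "smooth_circle_field l T v"
    and "smooth_circle_field l T \<nu>"
    and "\<And>x t. t \<in> T \<Longrightarrow> (\<nu> x t)^2 = h - (Dx u x t)^2"
    and "\<And>x t. t \<in> T \<Longrightarrow> \<nu> x t \<noteq> 0"
    and "\<And>x t. t \<in> T \<Longrightarrow> 2 * u x t \<notin> period_lattice \<tau>"
  shows
    "(\<forall>t\<in>T.
        has_variational_derivative l (\<lambda>w. H_CM \<tau> h l (\<lambda>x. u x t) w) (\<lambda>x. v x t)
          (\<lambda>x. CM_rhs_u h u v x t) \<and>
        has_variational_derivative l (\<lambda>w. H_CM \<tau> h l w (\<lambda>x. v x t)) (\<lambda>x. u x t)
          (\<lambda>x. - CM_rhs_v \<tau> h u v \<nu> x t))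
     \<and>
     (hamilton_equations l (H_CM \<tau> h l) T u v \<longleftrightarrow>
       (\<forall>x. \<forall>t\<in>T. Dt u x t = CM_rhs_u h u v x t \<and> Dt v x t = CM_rhs_v \<tau> h u v \<nu> x t))
     \<and>
     ((\<forall>x. \<forall>t\<in>T. Dt u x t = CM_rhs_u h u v x t \<and> Dt v x t = CM_rhs_v \<tau> h u v \<nu> x t) \<longleftrightarrow>
       (\<forall>x. \<forall>t\<in>T. \<forall>z. z \<notin> period_lattice \<tau> \<longrightarrow>
          Dt (CM_L \<tau> u v \<nu> z) x t - Dx (CM_M \<tau> h u v \<nu> z) x t
          + (CM_M \<tau> h u v \<nu> z x t ** CM_L \<tau> u v \<nu> z x t
             - CM_L \<tau> u v \<nu> z x t ** CM_M \<tau> h u v \<nu> z x t) = 0))"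
proof (intro conjI)
  interpret upper_half \<tau> by unfold_locales (rule assms(1))
  have u: "smooth_field T u" "\<And>x t. t \<in> T \<Longrightarrow> u (x + l) t = u x t"
    and v: "smooth_field T v" "\<And>x t. t \<in> T \<Longrightarrow> v (x + l) t = v x t"
    and \<nu>: "smooth_field T \<nu>" "\<And>x t. t \<in> T \<Longrightarrow> \<nu> (x + l) t = \<nu> x t"
    using assms(5-7) by (auto simp: smooth_circle_field_def smooth_field_def)
  have nz: "h - (Dx u x t)^2 \<noteq> 0" if "t \<in> T" for x t
    using assms(8,9)[OF that, of x] by (metis power_eq_0_iff zero_neq_numeral)
  show var: "\<forall>t\<in>T.
        has_variational_derivative l (\<lambda>w. H_CM \<tau> h l (\<lambda>x. u x t) w) (\<lambda>x. v x t)
          (\<lambda>x. CM_rhs_u h u v x t) \<and>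
        has_variational_derivative l (\<lambda>w. H_CM \<tau> h l w (\<lambda>x. v x t)) (\<lambda>x. u x t)
          (\<lambda>x. - CM_rhs_v \<tau> h u v \<nu> x t)"
  proof (intro ballI conjI)
    fix t assume t: "t \<in> T"
    note sf = smooth_field_smooth_fun[OF u(1) t] smooth_field_smooth_fun[OF v(1) t] smooth_field_smooth_fun[OF \<nu>(1) t]
    show "has_variational_derivative l (\<lambda>w. H_CM \<tau> h l (\<lambda>x. u x t) w) (\<lambda>x. v x t) (\<lambda>x. CM_rhs_u h u v x t)"
      unfolding CM_rhs_u_def Dx_eq_ddx
      by (rule variation_v[OF assms(3,2) sf(1) u(2)[OF t] sf(2) v(2)[OF t]])
         (use assms(10)[OF t] nz[OF t] in \<open>simp_all add: Dx_eq_ddx\<close>)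
    show "has_variational_derivative l (\<lambda>w. H_CM \<tau> h l w (\<lambda>x. v x t)) (\<lambda>x. u x t) (\<lambda>x. - CM_rhs_v \<tau> h u v \<nu> x t)"
      unfolding CM_rhs_v_def Dx_eq_ddx
      by (rule variation_u[OF assms(3,2) sf(1) u(2)[OF t] sf(2) v(2)[OF t] sf(3) \<nu>(2)[OF t]])
         (use assms(8,9,10)[OF t] in \<open>simp_all add: Dx_eq_ddx\<close>)
  qed
  show "hamilton_equations l (H_CM \<tau> h l) T u v \<longleftrightarrow>
       (\<forall>x. \<forall>t\<in>T. Dt u x t = CM_rhs_u h u v x t \<and> Dt v x t = CM_rhs_v \<tau> h u v \<nu> x t)"
  proof
    assume H: "hamilton_equations l (H_CM \<tau> h l) T u v"
    show "\<forall>x. \<forall>t\<in>T. Dt u x t = CM_rhs_u h u v x t \<and> Dt v x t = CM_rhs_v \<tau> h u v \<nu> x t"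
    proof (intro allI ballI)
      fix x t assume t: "t \<in> T"
      have "(\<lambda>x. Dt u x t) = (\<lambda>x. CM_rhs_u h u v x t)"
        using H var t variational_derivative_unique[OF assms(3)] unfolding hamilton_equations_def by blast
      moreover have "(\<lambda>x. - Dt v x t) = (\<lambda>x. - CM_rhs_v \<tau> h u v \<nu> x t)"
        using H var t variational_derivative_unique[OF assms(3)] unfolding hamilton_equations_def by blast
      ultimately show "Dt u x t = CM_rhs_u h u v x t \<and> Dt v x t = CM_rhs_v \<tau> h u v \<nu> x t"
        by (simp add: fun_eq_iff)
    qed
  next
    assume "\<forall>x. \<forall>t\<in>T. Dt u x t = CM_rhs_u h u v x t \<and> Dt v x t = CM_rhs_v \<tau> h u v \<nu> x t"
    then show "hamilton_equations l (H_CM \<tau> h l) T u v"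
      using var unfolding hamilton_equations_def by simp
  qed
  note zc = zero_curvature_iff[OF assms(2,4) _ u(1) v(1) \<nu>(1) assms(8-10)]
  show "(\<forall>x. \<forall>t\<in>T. Dt u x t = CM_rhs_u h u v x t \<and> Dt v x t = CM_rhs_v \<tau> h u v \<nu> x t) \<longleftrightarrow>
       (\<forall>x. \<forall>t\<in>T. \<forall>z. z \<notin> period_lattice \<tau> \<longrightarrow>
          Dt (CM_L \<tau> u v \<nu> z) x t - Dx (CM_M \<tau> h u v \<nu> z) x t
          + (CM_M \<tau> h u v \<nu> z x t ** CM_L \<tau> u v \<nu> z x t
             - CM_L \<tau> u v \<nu> z x t ** CM_M \<tau> h u v \<nu> z x t) = 0)" (is "?eq \<longleftrightarrow> ?zc")
  proof
    assume eq: ?eq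
    show ?zc
    proof (intro allI ballI impI)
      fix x t z assume t: "t \<in> T" and z: "z \<notin> period_lattice \<tau>"
      \<comment> \<open>Equality for all x at this time also makes the x-derivative of the defect
        vanish.\<close>
      have "(\<lambda>x. Dt u x t) = (\<lambda>x. CM_rhs_u h u v x t)" using eq t by blast
      then have "Dx (Dt u) x t = Dx (CM_rhs_u h u v) x t" unfolding Dx_def by simp
      then show "Dt (CM_L \<tau> u v \<nu> z) x t - Dx (CM_M \<tau> h u v \<nu> z) x t
          + (CM_M \<tau> h u v \<nu> z x t ** CM_L \<tau> u v \<nu> z x t
             - CM_L \<tau> u v \<nu> z x t ** CM_M \<tau> h u v \<nu> z x t) = 0"
        using eq t by (subst zc[OF t _ _ _ z]) auto
    qed
  next
    assume zero: ?zc
    show ?eq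
    proof (intro allI ballI)
      fix x t assume t: "t \<in> T"
      have A: "Dt v x t = CM_rhs_v \<tau> h u v \<nu> x t"
        and B: "- (Dx u x t * (Dx (Dt u) x t - Dx (CM_rhs_u h u v) x t) / \<nu> x t) * phi \<tau> (2 * u x t) z
           + 2 * \<nu> x t * (Dt u x t - CM_rhs_u h u v x t) * (phi' \<tau> (2 * u x t) z - E1 \<tau> z * phi \<tau> (2 * u x t) z) = 0"
        if "z \<notin> period_lattice \<tau>" for z
        using zero t that zc[OF t _ _ _ that, of x] by auto
      \<comment> \<open>The coefficient of D_x at this point plays the part of K and needs no
        knowledge; N is 2 \<nu> D, and \<nu> does not vanish.\<close>
      have "2 * \<nu> x t * (Dt u x t - CM_rhs_u h u v x t) = 0"
        using leading_coefficient_eq_0[OF assms(10)[OF t] B] .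
      then have "Dt u x t = CM_rhs_u h u v x t" using assms(9)[OF t, of x] by simp
      \<comment> \<open>The v equation is free of z, so one admissible value suffices; 1/2 is never
        a period.\<close>
      with A[OF half_not_lattice(1)] show "Dt u x t = CM_rhs_u h u v x t \<and> Dt v x t = CM_rhs_v \<tau> h u v \<nu> x t" by simp
    qed
  qed
qed

end
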